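(* Let $\mathbf{k}$ be an algebraically closed field, let $Q$ be a quiver of Dynkin type $D_l$ ($l\ge4$, arbitrary orientation), let $n$ be a positive integer, let $M$ be a finite-dimensional representation of $Q$ over $\mathbf{k}$, and write $$M\cong\bigoplus_{\mathbf{d}\in\Phi^+}a_{\mathbf{d}}M(\mathbf{d}),\qquad M^{\otimes n}\cong\bigoplus_{\mathbf{d}\in\Phi^+}a^{(n)}_{\mathbf{d}}M(\mathbf{d}).$$ Then $$b_n(M)=\sum_{i\in Q_0}(\dim M_i)^n-\sum_{\substack{\mathbf{d}\in\Phi^+\\ \ell(\mathbf{d})=2}}\Bigl(\sum_{\substack{\mathbf{d}'\in\Phi^+\\ \mathbf{d}'\ge\mathbf{d}}}m(\mathbf{d}'*\mathbf{d})\,a_{\mathbf{d}'}\Bigr)^{n}-\sum_{\mathbf{d}\in\Phi^+_{\mathrm{tw}}}a^{(n)}_{\mathbf{d}} .$$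
   Context: The underlying graph of $Q$ has vertices $a,b,c_1,\dots,c_{l-2}$ and edges $\alpha$ between $a$ and $c_1$, $\beta$ between $b$ and $c_1$, and $\gamma_k$ between $c_k$ and $c_{k+1}$ for $1\le k\le l-3$. $\Phi^+\subset\mathbb{N}^{Q_0}$ is the set of positive roots of $Q$; by Gabriel's theorem, for each $\mathbf{d}\in\Phi^+$ there is, up to isomorphism, a unique indecomposable representation $M(\mathbf{d})$ with dimension vector $\mathbf{d}$, and these are all the indecomposables. $a M(\mathbf{d})$ denotes the $a$-fold direct sum. The pointwise tensor product is $(M\otimes N)_i=M_i\otimes_{\mathbf{k}}N_i$, $(M\otimes N)_\alpha=M_\alpha\otimes N_\alpha$, and $M^{\otimes n}$ is the $n$-fold power. $b_n(M)$ is the number of indecomposable direct summands of $M^{\otimes n}$ counted with multiplicities. For $\mathbf{d}=(d_i)\in\mathbb{N}^{Q_0}$: $\ell(\mathbf{d})=\sum_i d_i$; if $\mathbf{d}\neq0$, $m(\mathbf{d})=\min\{d_i\mid d_i>0\}$; $\mathbf{d}*\mathbf{d}'$ is the componentwise product; $\mathbf{d}'\ge\mathbf{d}$ means $d'_i\ge d_i$ for all $i$. $\Phi^+_{\mathrm{tw}}$ is the set of twin roots $$\mathbf{x}_{i,j}=\mathbf{1}_a+\mathbf{1}_b+\sum_{k=1}^{i}\mathbf{1}_{c_k}+\sum_{k=1}^{j}\mathbf{1}_{c_k},\qquad 1\le i<j\le l-2,$$ where $\mathbf{1}_v$ is the standard basis vector at the vertex $v$. *)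

theory Defs
  imports
    "HOL-Computational_Algebra.Polynomial"
    "Jordan_Normal_Form.Matrix"
    "Graph_Theory.Digraph"
begin

section \<open>Finite-dimensional representations of quivers\<close>

text \<open>
  A quiver is a directed multigraph, i.e. a \<open>pre_digraph\<close>.  A finite-dimensional representation is
  given in coordinates: the space at a vertex \<open>v\<close> is \<open>k ^ vdim M v\<close>, and the linear map along an
  arrow \<open>e\<close> is a matrix acting on column vectors.  Values at vertices and arrows outside the quiver
  are irrelevant.
\<close>

record ('v, 'e, 'k) quiver_rep =
  vdim :: "'v \<Rightarrow> nat"
  vmap :: "'e \<Rightarrow> 'k mat"

definition is_rep :: "('v, 'e) pre_digraph \<Rightarrow> ('v, 'e, 'k) quiver_rep \<Rightarrow> bool" where
  "is_rep Q M \<longleftrightarrow>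
     (\<forall>e\<in>arcs Q. vmap M e \<in> carrier_mat (vdim M (head Q e)) (vdim M (tail Q e)))"

text \<open>Dimension vectors are extended by 0 outside \<open>Q\<^sub>0\<close>.\<close>

definition dim_vector :: "('v, 'e) pre_digraph \<Rightarrow> ('v, 'e, 'k) quiver_rep \<Rightarrow> 'v \<Rightarrow> nat" where
  "dim_vector Q M = (\<lambda>v. if v \<in> verts Q then vdim M v else 0)"

definition rep_hom :: "('v, 'e) pre_digraph \<Rightarrow> ('v, 'e, 'k::semiring_1) quiver_rep
    \<Rightarrow> ('v, 'e, 'k) quiver_rep \<Rightarrow> ('v \<Rightarrow> 'k mat) \<Rightarrow> bool" where
  "rep_hom Q M N P \<longleftrightarrow>
     (\<forall>v\<in>verts Q. P v \<in> carrier_mat (vdim N v) (vdim M v)) \<and>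
     (\<forall>e\<in>arcs Q. P (head Q e) * vmap M e = vmap N e * P (tail Q e))"

definition rep_iso :: "('v, 'e) pre_digraph \<Rightarrow> ('v, 'e, 'k::semiring_1) quiver_rep
    \<Rightarrow> ('v, 'e, 'k) quiver_rep \<Rightarrow> bool" where
  "rep_iso Q M N \<longleftrightarrow>
     (\<exists>P P'. rep_hom Q M N P \<and> rep_hom Q N M P' \<and>
        (\<forall>v\<in>verts Q. P' v * P v = 1\<^sub>m (vdim M v) \<and> P v * P' v = 1\<^sub>m (vdim N v)))"

definition direct_sum :: "('v, 'e, 'k::zero) quiver_rep list \<Rightarrow> ('v, 'e, 'k) quiver_rep" where
  "direct_sum Ms =
     \<lparr>vdim = (\<lambda>v. \<Sum>M\<leftarrow>Ms. vdim M v),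
      vmap = (\<lambda>e. diag_block_mat (map (\<lambda>M. vmap M e) Ms))\<rparr>"

definition multiple :: "nat \<Rightarrow> ('v, 'e, 'k::zero) quiver_rep \<Rightarrow> ('v, 'e, 'k) quiver_rep" where
  "multiple a M = direct_sum (replicate a M)"

text \<open>
  The direct sum of a family over a finite index set.  The summands are taken in some chosen
  order; up to isomorphism the result does not depend on it.
\<close>

definition direct_sum_over :: "'i set \<Rightarrow> ('i \<Rightarrow> ('v, 'e, 'k::zero) quiver_rep)
    \<Rightarrow> ('v, 'e, 'k) quiver_rep" where
  "direct_sum_over I F = direct_sum (map F (SOME is. distinct is \<and> set is = I))"

definition zero_rep :: "('v, 'e) pre_digraph \<Rightarrow> ('v, 'e, 'k) quiver_rep \<Rightarrow> bool" where
  "zero_rep Q M \<longleftrightarrow> (\<forall>v\<in>verts Q. vdim M v = 0)"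

definition indecomposable :: "('v, 'e) pre_digraph \<Rightarrow> ('v, 'e, 'k::semiring_1) quiver_rep \<Rightarrow> bool"
  where
  "indecomposable Q M \<longleftrightarrow> is_rep Q M \<and> \<not> zero_rep Q M \<and>
     (\<forall>A B. is_rep Q A \<longrightarrow> is_rep Q B \<longrightarrow> rep_iso Q M (direct_sum [A, B]) \<longrightarrow>
        zero_rep Q A \<or> zero_rep Q B)"

text \<open>
  The number of indecomposable direct summands, counted with multiplicities; it is well defined
  by the Krull--Schmidt theorem.
\<close>

definition num_indec_summands :: "('v, 'e) pre_digraph \<Rightarrow> ('v, 'e, 'k::semiring_1) quiver_rep \<Rightarrow> nat"
  where
  "num_indec_summands Q M =
     (THE r. \<exists>Ns. length Ns = r \<and> (\<forall>N\<in>set Ns. indecomposable Q N) \<and>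
        rep_iso Q M (direct_sum Ns))"

section \<open>Pointwise tensor products\<close>

text \<open>
  The Kronecker product is the matrix of the tensor product of two linear maps with respect to the
  lexicographically ordered bases \<open>e\<^sub>i \<otimes> e\<^sub>j\<close>.
\<close>

definition kronecker :: "'k::times mat \<Rightarrow> 'k mat \<Rightarrow> 'k mat" where
  "kronecker A B =
     mat (dim_row A * dim_row B) (dim_col A * dim_col B)
       (\<lambda>(i, j). A $$ (i div dim_row B, j div dim_col B) * B $$ (i mod dim_row B, j mod dim_col B))"

definition rep_tensor :: "('v, 'e, 'k::times) quiver_rep \<Rightarrow> ('v, 'e, 'k) quiver_rep
    \<Rightarrow> ('v, 'e, 'k) quiver_rep" where
  "rep_tensor M N =
     \<lparr>vdim = (\<lambda>v. vdim M v * vdim N v), vmap = (\<lambda>e. kronecker (vmap M e) (vmap N e))\<rparr>"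

primrec tensor_power :: "('v, 'e, 'k::semiring_1) quiver_rep \<Rightarrow> nat \<Rightarrow> ('v, 'e, 'k) quiver_rep"
  where
  "tensor_power M 0 = \<lparr>vdim = (\<lambda>v. 1), vmap = (\<lambda>e. 1\<^sub>m 1)\<rparr>"
| "tensor_power M (Suc n) = rep_tensor (tensor_power M n) M"

definition num_summands_power :: "('v, 'e) pre_digraph \<Rightarrow> ('v, 'e, 'k::semiring_1) quiver_rep
    \<Rightarrow> nat \<Rightarrow> nat" where
  "num_summands_power Q M n = num_indec_summands Q (tensor_power M n)"

section \<open>Positive roots\<close>

definition tits_form :: "('v, 'e) pre_digraph \<Rightarrow> ('v \<Rightarrow> nat) \<Rightarrow> int" where
  "tits_form Q d =
     (\<Sum>v\<in>verts Q. (int (d v))\<^sup>2) - (\<Sum>e\<in>arcs Q. int (d (tail Q e)) * int (d (head Q e)))"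

text \<open>
  The positive roots of a Dynkin quiver, as vectors in \<open>\<nat> ^ Q\<^sub>0\<close> (functions vanishing off \<open>Q\<^sub>0\<close>)
  on which the Tits form takes the value 1.
\<close>

definition pos_roots :: "('v, 'e) pre_digraph \<Rightarrow> ('v \<Rightarrow> nat) set" where
  "pos_roots Q = {d. (\<forall>v. v \<notin> verts Q \<longrightarrow> d v = 0) \<and> d \<noteq> (\<lambda>_. 0) \<and> tits_form Q d = 1}"

definition dv_length :: "('v, 'e) pre_digraph \<Rightarrow> ('v \<Rightarrow> nat) \<Rightarrow> nat" where
  "dv_length Q d = (\<Sum>v\<in>verts Q. d v)"

definition dv_min :: "('v, 'e) pre_digraph \<Rightarrow> ('v \<Rightarrow> nat) \<Rightarrow> nat" where
  "dv_min Q d = Min {d v | v. v \<in> verts Q \<and> d v > 0}"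

definition dv_mult :: "('v \<Rightarrow> nat) \<Rightarrow> ('v \<Rightarrow> nat) \<Rightarrow> 'v \<Rightarrow> nat" where
  "dv_mult d d' = (\<lambda>v. d v * d' v)"

section \<open>Quivers of Dynkin type D\<close>

datatype dvertex = VA | VB | VC nat

datatype darrow = Alpha | Beta | Gamma nat

fun D_ends :: "darrow \<Rightarrow> dvertex set" where
  "D_ends Alpha = {VA, VC 1}"
| "D_ends Beta = {VB, VC 1}"
| "D_ends (Gamma k) = {VC k, VC (k + 1)}"

text \<open>
  The orientation is arbitrary: the two ends of an arrow are distinct, so its tail can be either of
  them.
\<close>

definition dynkin_D :: "nat \<Rightarrow> (dvertex, darrow) pre_digraph \<Rightarrow> bool" where
  "dynkin_D l Q \<longleftrightarrow>
     verts Q = {VA, VB} \<union> VC ` {1..l - 2} \<and>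
     arcs Q = {Alpha, Beta} \<union> Gamma ` {1..l - 3} \<and>
     (\<forall>e\<in>arcs Q. {tail Q e, head Q e} = D_ends e)"

definition std_basis :: "'v \<Rightarrow> 'v \<Rightarrow> nat" where
  "std_basis v = (\<lambda>w. if w = v then 1 else 0)"

definition twin_root :: "nat \<Rightarrow> nat \<Rightarrow> dvertex \<Rightarrow> nat" where
  "twin_root i j = (\<lambda>v. std_basis VA v + std_basis VB v
     + (\<Sum>k=1..i. std_basis (VC k) v) + (\<Sum>k=1..j. std_basis (VC k) v))"

definition twin_roots :: "nat \<Rightarrow> (dvertex \<Rightarrow> nat) set" where
  "twin_roots l = {twin_root i j | i j. 1 \<le> i \<and> i < j \<and> j \<le> l - 2}"

end

theory Submission
  imports Defs "Jordan_Normal_Form.Determinant" "HOL-Library.Function_Algebras"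
begin

text \<open>
  The dimension at a vertex and the rank along an arrow are additive over direct sums, invariant
  under isomorphism, and multiplicative under the pointwise tensor product; hence their values on
  the \<open>n\<close>-th tensor power of \<open>M\<close> are the \<open>n\<close>-th powers of their values on \<open>M\<close>.  The formula
  follows by expressing the number of indecomposable summands through these invariants.

  Let \<open>N\<close> be indecomposable with a root \<open>d\<close> as dimension vector.  Every arrow of \<open>N\<close> has the largest
  rank that its format permits, namely the smaller one of the two entries of \<open>d\<close> at its ends
  (\<open>root_rep_arc_rank\<close>).  Moreover the sum of the entries of \<open>d\<close> minus the sum of these minima over
  all arrows is 1, except for a twin root, where it is 2 (\<open>root_defect\<close>).  In a direct sum of copies
  of the indecomposables one therefore obtains the number of summands by subtracting from the total
  dimension the ranks of all arrows and the number of summands with a twin root as dimension vector.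
  The roots of length 2 are exactly the vectors with entries 1 at the two ends of an arrow and 0
  elsewhere (\<open>roots_of_length_2\<close>), so the inner sums of the theorem are the ranks of the arrows of
  \<open>M\<close>.

  The statement on \<open>d\<close> comes from writing four times the Tits form as a sum of squares.  It shows
  that a root with an entry greater than 1 is a twin root (\<open>root_cases\<close>).  If all entries are at
  most 1, then entries equal their squares and minima equal products, so that the sum in question is
  the Tits form itself.

  The statement on ranks uses that an indecomposable representation has no idempotent endomorphisms
  except 0 and 1 (\<open>indecomposable_idempotent_trivial\<close>).  Removing an arrow disconnects the tree, so
  the projection onto one side would be an endomorphism if the arrow were zero (\<open>arc_nonzero\<close>).  This
  leaves the arrows between two spaces of dimension 2, which occur only for twin roots.  If such a
  map had rank 1, one of the two sides of the arrow would split along the image or the kernel of the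
  map.  The splitting is constructed from the last two-dimensional space of the chain downwards
  (\<open>adapted\<close>).

  That the number of indecomposable summands is well defined is the Krull--Schmidt property
  (\<open>Krull_Schmidt_length\<close>).  Decompositions of \<open>M\<close> into indecomposables give decompositions of the
  identity of its endomorphism ring into orthogonal primitive idempotents, and the exchange argument
  (\<open>card_primitive_decomposition\<close>) shows that two of these have the same number of members.  It
  applies to rings in which every element has a power that is invertible up to an idempotent.  For
  endomorphism rings this follows from the stabilisation of the ranks of the powers of a matrix
  (\<open>End_ring_pi_regular\<close>).
\<close>

section \<open>Ranks of matrices\<close>

lemma mat_assoc:
  fixes A B C :: "'a::semiring_0 mat"
  assumes "dim_col A = dim_row B" "dim_col B = dim_row C"
  shows "A * B * C = A * (B * C)"
  by (rule assoc_mult_mat[OF carrier_matI[OF refl assms(1)] carrier_matI[OF refl assms(2)]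
        carrier_matI[OF refl refl]])

lemma left_inverse_cancel:
  fixes A B X :: "'a::semiring_1 mat"
  assumes "A * B = 1\<^sub>m r" "dim_col A = dim_row B" "dim_col B = dim_row X" "dim_row X = r"
  shows "A * (B * X) = X"
proof -
  have "A * (B * X) = (A * B) * X" using assms(2,3) by (simp add: mat_assoc)
  also have "\<dots> = X" unfolding assms(1) using assms(4) by (intro left_mult_one_mat) auto
  finally show ?thesis .
qed

text \<open>
  Padding both factors with zeros to square matrices turns the one-sided inverse into a two-sided
  one, but a padded factor has a zero row and is not invertible.
\<close>

lemma identity_factor_le:
  fixes X Y :: "'a::field mat"
  assumes X: "X \<in> carrier_mat a b" and Y: "Y \<in> carrier_mat b a" and XY: "X * Y = 1\<^sub>m a"
  shows "a \<le> b"
proof (rule ccontr)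
  assume "\<not> a \<le> b"
  then have ba: "b < a" by simp
  define X' where "X' = mat a a (\<lambda>(i,j). if j < b then X $$ (i,j) else 0)"
  define Y' where "Y' = mat a a (\<lambda>(i,j). if i < b then Y $$ (i,j) else 0)"
  have c: "X' \<in> carrier_mat a a" "Y' \<in> carrier_mat a a" by (auto simp: X'_def Y'_def)
  have "X' * Y' = X * Y"
  proof (rule eq_matI)
    fix i j assume ij: "i < dim_row (X * Y)" "j < dim_col (X * Y)"
    then have i: "i < a" and j: "j < a" using X Y by auto
    have "(X' * Y') $$ (i,j) = (\<Sum>k\<in>{0..<a}. X' $$ (i,k) * Y' $$ (k,j))"
      using i j c by (simp add: scalar_prod_def)
    also have "\<dots> = (\<Sum>k\<in>{0..<b}. X' $$ (i,k) * Y' $$ (k,j))"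
      using i j ba by (intro sum.mono_neutral_right) (auto simp: X'_def Y'_def)
    also have "\<dots> = (\<Sum>k\<in>{0..<b}. X $$ (i,k) * Y $$ (k,j))"
      using i j ba by (intro sum.cong) (auto simp: X'_def Y'_def)
    also have "\<dots> = (X * Y) $$ (i,j)" using i j X Y by (simp add: scalar_prod_def)
    finally show "(X' * Y') $$ (i,j) = (X * Y) $$ (i,j)" .
  qed (use c X Y in auto)
  then have "X' * Y' = 1\<^sub>m a" using XY by simp
  from mat_mult_left_right_inverse[OF c this]
  have "(Y' * X') $$ (a - 1, a - 1) = 1" using ba by simp
  moreover have "(Y' * X') $$ (a - 1, a - 1) = 0"
    using c ba by (simp add: scalar_prod_def, intro sum.neutral) (auto simp: Y'_def)
  ultimately show False by simp
qed

lemma one_mat_eq_zero: "(1\<^sub>m n :: 'a::field mat) = 0\<^sub>m n n \<Longrightarrow> n = 0"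
proof (rule ccontr)
  assume eq: "(1\<^sub>m n :: 'a mat) = 0\<^sub>m n n" and n: "n \<noteq> 0"
  have "(1\<^sub>m n :: 'a mat) $$ (0,0) = 1" "(0\<^sub>m n n :: 'a mat) $$ (0,0) = 0" using n by auto
  then show False using eq by simp
qed

text \<open>
  A factorisation through dimension \<open>r\<close> together with one-sided inverses of its factors.  All
  operations on representations that occur below transport such data directly, and the inverses make
  \<open>r\<close> unique.
\<close>

definition has_rank :: "'a::field mat \<Rightarrow> nat \<Rightarrow> bool" where
  "has_rank A r \<longleftrightarrow> (\<exists>B C L R. B \<in> carrier_mat (dim_row A) r \<and> C \<in> carrier_mat r (dim_col A) \<and>
     L \<in> carrier_mat r (dim_row A) \<and> R \<in> carrier_mat (dim_col A) r \<and>
     A = B * C \<and> L * B = 1\<^sub>m r \<and> C * R = 1\<^sub>m r)"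

lemma has_rankE:
  assumes "has_rank A r" "A \<in> carrier_mat m n"
  obtains B C L R where "B \<in> carrier_mat m r" "C \<in> carrier_mat r n" "L \<in> carrier_mat r m"
    "R \<in> carrier_mat n r" "A = B * C" "L * B = 1\<^sub>m r" "C * R = 1\<^sub>m r"
  using assms unfolding has_rank_def by (metis carrier_matD)

lemma has_rankI:
  assumes "B \<in> carrier_mat m r" "C \<in> carrier_mat r n" "L \<in> carrier_mat r m"
    "R \<in> carrier_mat n r" "A = B * C" "L * B = 1\<^sub>m r" "C * R = 1\<^sub>m r"
  shows "has_rank A r"
proof -
  have "dim_row A = m" "dim_col A = n" using assms by auto
  then show ?thesis unfolding has_rank_def using assms by blast
qed

lemma has_rank_le_inner:
  fixes A :: "'a::field mat"
  assumes r: "has_rank A r" and U: "U \<in> carrier_mat m s" and V: "V \<in> carrier_mat s n" and A: "A = U * V"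
  shows "r \<le> s"
proof -
  have "A \<in> carrier_mat m n" using U V A by auto
  then obtain B C L R where c: "B \<in> carrier_mat m r" "C \<in> carrier_mat r n" "L \<in> carrier_mat r m"
    "R \<in> carrier_mat n r" and e: "A = B * C" "L * B = 1\<^sub>m r" "C * R = 1\<^sub>m r"
    using has_rankE[OF r] by metis
  have "(L * U) * (V * R) = L * (U * V) * R" using c U V by (simp add: mat_assoc)
  also have "\<dots> = L * (B * C) * R" using A e by simp
  also have "\<dots> = (L * B) * (C * R)" using c by (simp add: mat_assoc)
  also have "\<dots> = 1\<^sub>m r" using e by simp
  finally show ?thesis using c U V by (intro identity_factor_le[of "L * U" r s "V * R"]) auto
qed

lemma has_rank_le_dim:
  assumes "has_rank A r" "A \<in> carrier_mat m n"
  shows "r \<le> m" "r \<le> n"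
  using has_rank_le_inner[OF assms(1), of "1\<^sub>m m" m m A n]
    has_rank_le_inner[OF assms(1), of A m n "1\<^sub>m n" n] assms by auto

lemma has_rank_mult_le:
  assumes "has_rank (X * Z * Y) r" "has_rank Z s"
    "X \<in> carrier_mat a m" "Z \<in> carrier_mat m n" "Y \<in> carrier_mat n b"
  shows "r \<le> s"
proof -
  obtain B C where c: "B \<in> carrier_mat m s" "C \<in> carrier_mat s n" and e: "Z = B * C"
    using has_rankE[OF assms(2,4)] by metis
  have "X * Z * Y = (X * B) * (C * Y)" unfolding e using assms c by (simp add: mat_assoc)
  then show ?thesis using assms c
    by (intro has_rank_le_inner[OF assms(1), of "X * B" a s "C * Y" b]) auto
qed

lemma has_rank_unique:
  assumes "has_rank A r" "has_rank A s" shows "r = s"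
proof -
  have *: "r \<le> s" if r: "has_rank A r" and s: "has_rank A s" for r s
  proof -
    have A: "A \<in> carrier_mat (dim_row A) (dim_col A)" by simp
    obtain B C where "B \<in> carrier_mat (dim_row A) s" "C \<in> carrier_mat s (dim_col A)" "A = B * C"
      using has_rankE[OF s A] by metis
    then show ?thesis by (rule has_rank_le_inner[OF r])
  qed
  show ?thesis using * assms by (simp add: antisym)
qed

lemma has_rank_zero: "has_rank (0\<^sub>m m n :: 'a::field mat) 0"
  by (rule has_rankI[of "0\<^sub>m m 0" m 0 "0\<^sub>m 0 n" n "0\<^sub>m 0 m" "0\<^sub>m n 0"]) auto

lemma has_rank_0D:
  fixes A :: "'a::field mat"
  assumes "has_rank A 0" "A \<in> carrier_mat m n"
  shows "A = 0\<^sub>m m n"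
proof -
  obtain B C :: "'a mat" where "B \<in> carrier_mat m 0" "C \<in> carrier_mat 0 n" "A = B * C"
    using has_rankE[OF assms] by metis
  then show ?thesis by (intro eq_matI) (auto simp: scalar_prod_def)
qed

lemma has_rank_one: "has_rank (1\<^sub>m n :: 'a::field mat) n"
  by (rule has_rankI[of "1\<^sub>m n" n n "1\<^sub>m n" n "1\<^sub>m n" "1\<^sub>m n"]) auto

text \<open>
  Gaussian elimination.  Subtracting the rank-one matrix through a nonzero entry \<open>A (p, q)\<close> clears row
  \<open>p\<close> and column \<open>q\<close>; a factorisation of the remaining matrix is extended by one row and one column.
\<close>

lemma has_rank_exists:
  fixes A :: "'a::field mat"
  assumes "A \<in> carrier_mat m n"
  shows "\<exists>r. has_rank A r"
  using assms
proof (induction "card {i. i < m \<and> (\<exists>j<n. A $$ (i,j) \<noteq> 0)}" arbitrary: A rule: less_induct)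
  case less
  note A = less.prems
  show ?case
  proof (cases "\<exists>p<m. \<exists>q<n. A $$ (p,q) \<noteq> 0")
    case False
    then have "A = 0\<^sub>m m n" using A by (intro eq_matI) auto
    then show ?thesis using has_rank_zero by blast
  next
    case True
    then obtain p q where p: "p < m" and q: "q < n" and a0: "A $$ (p,q) \<noteq> 0" by blast
    define a where "a = A $$ (p,q)"
    define A' where "A' = mat m n (\<lambda>(i,j). A $$ (i,j) - A $$ (i,q) * A $$ (p,j) / a)"
    have A': "A' \<in> carrier_mat m n" by (simp add: A'_def)
    have row0: "A' $$ (p,j) = 0" if "j < n" for j using that p a0 by (simp add: A'_def a_def)
    have col0: "A' $$ (i,q) = 0" if "i < m" for i using that q a0 by (simp add: A'_def a_def)
    have "card {i. i < m \<and> (\<exists>j<n. A' $$ (i,j) \<noteq> 0)} < card {i. i < m \<and> (\<exists>j<n. A $$ (i,j) \<noteq> 0)}"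
    proof (rule psubset_card_mono)
      show "{i. i < m \<and> (\<exists>j<n. A' $$ (i,j) \<noteq> 0)} \<subset> {i. i < m \<and> (\<exists>j<n. A $$ (i,j) \<noteq> 0)}"
      proof
        show "{i. i < m \<and> (\<exists>j<n. A' $$ (i,j) \<noteq> 0)} \<subseteq> {i. i < m \<and> (\<exists>j<n. A $$ (i,j) \<noteq> 0)}"
        proof (clarify, rule ccontr)
          fix i j assume i: "i < m" "j < n" "A' $$ (i,j) \<noteq> 0" and "\<not> (\<exists>j<n. A $$ (i,j) \<noteq> 0)"
          then show False using q by (simp add: A'_def)
        qed
        have "p \<in> {i. i < m \<and> (\<exists>j<n. A $$ (i,j) \<noteq> 0)}" using p q a0 by auto
        moreover have "p \<notin> {i. i < m \<and> (\<exists>j<n. A' $$ (i,j) \<noteq> 0)}" using row0 by auto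
        ultimately show "{i. i < m \<and> (\<exists>j<n. A' $$ (i,j) \<noteq> 0)} \<noteq> {i. i < m \<and> (\<exists>j<n. A $$ (i,j) \<noteq> 0)}"
          by blast
      qed
    qed simp
    from less.hyps[OF this A'] obtain r where r: "has_rank A' r" by blast
    from has_rankE[OF r A'] obtain B C L R where
      c: "B \<in> carrier_mat m r" "C \<in> carrier_mat r n" "L \<in> carrier_mat r m" "R \<in> carrier_mat n r"
      and e: "A' = B * C" "L * B = 1\<^sub>m r" "C * R = 1\<^sub>m r" by metis
    have B: "B = A' * R" using c e by (simp add: mat_assoc)
    have C: "C = L * A'" using c e by (simp add: left_inverse_cancel)
    have Brow: "B $$ (p,k) = 0" if "k < r" for k
      unfolding B using that c p A' by (simp add: scalar_prod_def row0)
    have Ccol: "C $$ (k,q) = 0" if "k < r" for k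
      unfolding C using that c q A' by (simp add: scalar_prod_def col0)
    define u where "u = mat m 1 (\<lambda>(i,j). A $$ (i,q))"
    define v where "v = mat 1 n (\<lambda>(i,j). A $$ (p,j) / a)"
    \<comment> \<open>\<open>ep\<close> and \<open>eq\<close> pick out row \<open>p\<close> and column \<open>q\<close>; they invert the new factors \<open>u\<close> and \<open>v\<close> and
      vanish on the old ones.\<close>
    define ep where "ep = mat 1 m (\<lambda>(i,j). if j = p then 1 / a else 0)"
    define eq where "eq = mat n 1 (\<lambda>(i,j). if i = q then (1::'a) else 0)"
    note d = u_def v_def ep_def eq_def
    have cu: "u \<in> carrier_mat m 1" "v \<in> carrier_mat 1 n" "ep \<in> carrier_mat 1 m" "eq \<in> carrier_mat n 1"
      by (auto simp: d)
    have s1: "ep * u = 1\<^sub>m 1" using p a0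
      by (intro eq_matI) (auto simp: d scalar_prod_def a_def if_distrib[of "\<lambda>x. x * _"] sum.delta cong: if_cong)
    have s2: "ep * B = 0\<^sub>m 1 r" using p c
      by (intro eq_matI) (auto simp: d scalar_prod_def Brow if_distrib[of "\<lambda>x. x * _"] sum.delta cong: if_cong)
    have s3: "v * eq = 1\<^sub>m 1" using q a0
      by (intro eq_matI) (auto simp: d scalar_prod_def a_def if_distrib[of "\<lambda>x. _ * x"] sum.delta cong: if_cong)
    have s4: "C * eq = 0\<^sub>m r 1" using q c
      by (intro eq_matI) (auto simp: d scalar_prod_def Ccol if_distrib[of "\<lambda>x. _ * x"] sum.delta cong: if_cong)
    have uv: "A = u * v + B * C"
      unfolding e(1)[symmetric] using A A' by (intro eq_matI) (auto simp: d scalar_prod_def A'_def)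
    let ?z = "\<lambda>a b. 0\<^sub>m a b :: 'a mat"
    \<comment> \<open>Zero-sized blocks turn four-block matrices into block rows and block columns.  The old one-sided
      inverses \<open>L\<close> and \<open>R\<close> are corrected so that they annihilate the new column \<open>u\<close> and row \<open>v\<close>.\<close>
    define BB where "BB = four_block_mat u B (?z 0 1) (?z 0 r)"
    define CC where "CC = four_block_mat v (?z 1 0) C (?z r 0)"
    define LL where "LL = four_block_mat ep (?z 1 0) (L - L * (u * ep)) (?z r 0)"
    define RR where "RR = four_block_mat eq (R - eq * (v * R)) (?z 0 1) (?z 0 r)"
    have cB: "BB \<in> carrier_mat (m + 0) (1 + r)" "CC \<in> carrier_mat (1 + r) (n + 0)"
      "LL \<in> carrier_mat (1 + r) (m + 0)" "RR \<in> carrier_mat (n + 0) (1 + r)"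
      unfolding BB_def CC_def LL_def RR_def using c cu by (intro four_block_carrier_mat; auto)+
    have z[simp]: "four_block_mat X (?z a 0) (?z 0 b) (?z 0 0) = X" if "X \<in> carrier_mat a b" for X a b
      using that by (intro eq_matI) auto
    have zz: "X * Y = ?z a b" if "X \<in> carrier_mat a 0" "Y \<in> carrier_mat 0 b" for a b X Y
      using that by (intro eq_matI) (auto simp: scalar_prod_def)
    have "BB * CC = four_block_mat (u * v + B * C) (u * ?z 1 0 + B * ?z r 0)
        (?z 0 1 * v + ?z 0 r * C) (?z 0 1 * ?z 1 0 + ?z 0 r * ?z r 0)"
      unfolding BB_def CC_def using c cu by (intro mult_four_block_mat) auto
    also have "\<dots> = A" using c cu A by (simp add: uv[symmetric])
    finally have m1: "A = BB * CC" ..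
    have mz: "X - ?z a b = X" if "X \<in> carrier_mat a b" for X a b
      using that by (intro eq_matI) auto
    have left: "(L - L * (u * ep)) * X = L * X - L * (u * (ep * X))" if "X \<in> carrier_mat m k" for X k
      using c cu that by (subst minus_mult_distrib_mat[of _ r m]) (auto simp: mat_assoc)
    have right: "Y * (R - eq * (v * R)) = Y * R - Y * eq * (v * R)" if "Y \<in> carrier_mat k n" for Y k
      using c cu that by (subst mult_minus_distrib_mat[of _ k n _ r]) (auto simp: mat_assoc)
    have t1: "(L - L * (u * ep)) * u = ?z r 1" using left[OF cu(1)] c cu s1 by simp
    have t2: "(L - L * (u * ep)) * B = 1\<^sub>m r" using left[OF c(1)] c cu s2 e by (simp add: mz)
    have t3: "v * (R - eq * (v * R)) = ?z 1 r" using right[OF cu(2)] c cu s3 by simp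
    have t4: "C * (R - eq * (v * R)) = 1\<^sub>m r" using right[OF c(2)] c cu s4 e by (simp add: mz)
    have "LL * BB = four_block_mat (ep * u + ?z 1 0 * ?z 0 1) (ep * B + ?z 1 0 * ?z 0 r)
      ((L - L * (u * ep)) * u + ?z r 0 * ?z 0 1) ((L - L * (u * ep)) * B + ?z r 0 * ?z 0 r)"
      unfolding BB_def LL_def using c cu by (intro mult_four_block_mat) auto
    also have "\<dots> = 1\<^sub>m (1 + r)" using c cu by (simp add: zz s1 s2 t1 t2)
    finally have m2: "LL * BB = 1\<^sub>m (1 + r)" .
    have "CC * RR = four_block_mat (v * eq + ?z 1 0 * ?z 0 1) (v * (R - eq * (v * R)) + ?z 1 0 * ?z 0 r)
      (C * eq + ?z r 0 * ?z 0 1) (C * (R - eq * (v * R)) + ?z r 0 * ?z 0 r)"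
      unfolding CC_def RR_def using c cu by (intro mult_four_block_mat) auto
    also have "\<dots> = 1\<^sub>m (1 + r)" using c cu by (simp add: zz s3 s4 t3 t4)
    finally have m3: "CC * RR = 1\<^sub>m (1 + r)" .
    show ?thesis using has_rankI[OF cB m1 m2 m3] by blast
  qed
qed

definition mrank :: "'a::field mat \<Rightarrow> nat" where "mrank A = (THE r. has_rank A r)"

lemma has_rank_mrank: "has_rank A (mrank A)"
  unfolding mrank_def using has_rank_exists[OF carrier_matI[OF refl refl], of A] has_rank_unique
  by (metis theI)

lemma has_rank_transform:
  fixes A :: "'a::field mat"
  assumes r: "has_rank A r" and A: "A \<in> carrier_mat m n"
    and X: "X \<in> carrier_mat m' m" "X' \<in> carrier_mat m m'" "X' * X = 1\<^sub>m m"
    and Y: "Y \<in> carrier_mat n n'" "Y' \<in> carrier_mat n' n" "Y * Y' = 1\<^sub>m n"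
  shows "has_rank (X * A * Y) r"
proof -
  obtain B C L R where c: "B \<in> carrier_mat m r" "C \<in> carrier_mat r n" "L \<in> carrier_mat r m"
    "R \<in> carrier_mat n r" and e: "A = B * C" "L * B = 1\<^sub>m r" "C * R = 1\<^sub>m r"
    using has_rankE[OF r A] by metis
  show ?thesis
  proof (rule has_rankI[of "X * B" m' r "C * Y" n' "L * X'" "Y' * R"])
    show "X * A * Y = X * B * (C * Y)" unfolding e(1) using c X(1,2) Y(1,2) by (simp add: mat_assoc)
    have "L * X' * (X * B) = L * (X' * X) * B" using c X(1,2) by (simp add: mat_assoc)
    also have "\<dots> = 1\<^sub>m r" using c X e by simp
    finally show "L * X' * (X * B) = 1\<^sub>m r" .
    have "C * Y * (Y' * R) = C * (Y * Y') * R" using c Y(1,2) by (simp add: mat_assoc)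
    also have "\<dots> = 1\<^sub>m r" using c Y e by simp
    finally show "C * Y * (Y' * R) = 1\<^sub>m r" .
  qed (use c X Y in auto)
qed

lemma has_rank_block:
  fixes A A' :: "'a::field mat"
  assumes r: "has_rank A r" "A \<in> carrier_mat m n" and r': "has_rank A' r'" "A' \<in> carrier_mat m' n'"
  shows "has_rank (four_block_mat A (0\<^sub>m m n') (0\<^sub>m m' n) A') (r + r')"
proof -
  obtain B C L R where c: "B \<in> carrier_mat m r" "C \<in> carrier_mat r n" "L \<in> carrier_mat r m"
    "R \<in> carrier_mat n r" and e: "A = B * C" "L * B = 1\<^sub>m r" "C * R = 1\<^sub>m r"
    using has_rankE[OF r] by metis
  obtain B' C' L' R' where c': "B' \<in> carrier_mat m' r'" "C' \<in> carrier_mat r' n'" "L' \<in> carrier_mat r' m'"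
    "R' \<in> carrier_mat n' r'" and e': "A' = B' * C'" "L' * B' = 1\<^sub>m r'" "C' * R' = 1\<^sub>m r'"
    using has_rankE[OF r'] by metis
  have mult: "four_block_mat X (0\<^sub>m a b') (0\<^sub>m a' b) X' * four_block_mat Y (0\<^sub>m b d') (0\<^sub>m b' d) Y' =
    four_block_mat (X * Y) (0\<^sub>m a d') (0\<^sub>m a' d) (X' * Y')"
    if "X \<in> carrier_mat a b" "X' \<in> carrier_mat a' b'" "Y \<in> carrier_mat b d" "Y' \<in> carrier_mat b' d'"
    for X X' Y Y' :: "'a mat" and a b a' b' d d'
  proof -
    have "four_block_mat X (0\<^sub>m a b') (0\<^sub>m a' b) X' * four_block_mat Y (0\<^sub>m b d') (0\<^sub>m b' d) Y' =
      four_block_mat (X * Y + 0\<^sub>m a b' * 0\<^sub>m b' d) (X * 0\<^sub>m b d' + 0\<^sub>m a b' * Y')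
       (0\<^sub>m a' b * Y + X' * 0\<^sub>m b' d) (0\<^sub>m a' b * 0\<^sub>m b d' + X' * Y')"
      using that by (intro mult_four_block_mat) auto
    then show ?thesis using that by simp
  qed
  show ?thesis
    by (rule has_rankI[of "four_block_mat B (0\<^sub>m m r') (0\<^sub>m m' r) B'" "m + m'" "r + r'"
          "four_block_mat C (0\<^sub>m r n') (0\<^sub>m r' n) C'" "n + n'"
          "four_block_mat L (0\<^sub>m r m') (0\<^sub>m r' m) L'" "four_block_mat R (0\<^sub>m n r') (0\<^sub>m n' r) R'"])
      (use c c' e e' in \<open>auto simp: mult[OF c(1) c'(1) c(2) c'(2)] mult[OF c(3) c'(3) c(1) c'(1)]
          mult[OF c(2) c'(2) c(4) c'(4)]\<close>)
qed

lemma has_rank_diag_block_mat: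
  fixes f :: "'x \<Rightarrow> 'a::field mat"
  assumes "\<And>x. x \<in> set xs \<Longrightarrow> has_rank (f x) (r x)"
  shows "has_rank (diag_block_mat (map f xs)) (\<Sum>x\<leftarrow>xs. r x)"
  using assms
proof (induction xs)
  case Nil
  then show ?case using has_rank_zero[of 0 0] by simp
next
  case (Cons x xs)
  have "has_rank (f x) (r x)" "has_rank (diag_block_mat (map f xs)) (\<Sum>x\<leftarrow>xs. r x)"
    using Cons by auto
  from has_rank_block[OF this(1) carrier_matI[OF refl refl] this(2) carrier_matI[OF refl refl]]
  show ?case by (simp add: Let_def)
qed

section \<open>Kronecker products and tensor powers\<close>

lemma sum_div_mod:
  fixes f :: "nat \<Rightarrow> nat \<Rightarrow> 'a::comm_monoid_add"
  shows "(\<Sum>t\<in>{0..<n * r}. f (t div r) (t mod r)) = (\<Sum>k\<in>{0..<n}. \<Sum>l\<in>{0..<r}. f k l)"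
proof -
  have less: "k * r + l < n * r" if "k < n" "l < r" for k l
  proof -
    have "k * r + l < Suc k * r" using that by simp
    also have "\<dots> \<le> n * r" using that by (intro mult_le_mono1) simp
    finally show ?thesis .
  qed
  have "(\<Sum>t\<in>{0..<n * r}. f (t div r) (t mod r)) = (\<Sum>(k,l)\<in>{0..<n}\<times>{0..<r}. f k l)"
  proof (rule sum.reindex_bij_witness[of _ "\<lambda>(k,l). k * r + l" "\<lambda>t. (t div r, t mod r)"])
    fix t assume "t \<in> {0..<n * r}"
    then have t: "t < n * r" by simp
    then have "0 < r" by (cases r) auto
    then show "(t div r, t mod r) \<in> {0..<n} \<times> {0..<r}"
      using t by (auto simp: less_mult_imp_div_less)
  qed (auto simp: less)
  then show ?thesis by (simp add: sum.cartesian_product)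
qed

lemma kronecker_carrier:
  "A \<in> carrier_mat m n \<Longrightarrow> B \<in> carrier_mat p q \<Longrightarrow> kronecker A B \<in> carrier_mat (m * p) (n * q)"
  by (auto simp: kronecker_def)

lemma div_mod_less:
  fixes i m q :: nat
  assumes "i < m * q" shows "i div q < m" "i mod q < q"
proof -
  have "0 < q" using assms by (cases q) auto
  then show "i div q < m" "i mod q < q" using assms by (auto simp: less_mult_imp_div_less)
qed

lemma kronecker_mult:
  fixes A B C D :: "'a::comm_ring_1 mat"
  assumes A: "A \<in> carrier_mat m n" and B: "B \<in> carrier_mat n p"
    and C: "C \<in> carrier_mat q r" and D: "D \<in> carrier_mat r s"
  shows "kronecker A C * kronecker B D = kronecker (A * B) (C * D)"
proof (rule eq_matI)
  fix i j assume "i < dim_row (kronecker (A * B) (C * D))" "j < dim_col (kronecker (A * B) (C * D))"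
  then have i: "i < m * q" and j: "j < p * s" using assms by (auto simp: kronecker_def)
  note b = div_mod_less[OF i] div_mod_less[OF j]
  have "(kronecker A C * kronecker B D) $$ (i,j) =
     (\<Sum>t\<in>{0..<n * r}. kronecker A C $$ (i,t) * kronecker B D $$ (t,j))"
    using i j assms by (simp add: kronecker_def scalar_prod_def)
  also have "\<dots> = (\<Sum>t\<in>{0..<n * r}. (A $$ (i div q, t div r) * B $$ (t div r, j div s)) *
      (C $$ (i mod q, t mod r) * D $$ (t mod r, j mod s)))"
    using i j assms by (intro sum.cong) (auto simp: kronecker_def ac_simps)
  also have "\<dots> = (\<Sum>k\<in>{0..<n}. \<Sum>l\<in>{0..<r}. (A $$ (i div q, k) * B $$ (k, j div s)) *
      (C $$ (i mod q, l) * D $$ (l, j mod s)))"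
    by (rule sum_div_mod[of "\<lambda>k l. (A $$ (i div q, k) * B $$ (k, j div s)) * (C $$ (i mod q, l) * D $$ (l, j mod s))"])
  also have "\<dots> = (A * B) $$ (i div q, j div s) * (C * D) $$ (i mod q, j mod s)"
    using b assms by (simp add: scalar_prod_def sum_product)
  also have "\<dots> = kronecker (A * B) (C * D) $$ (i,j)"
    using i j assms by (simp add: kronecker_def)
  finally show "(kronecker A C * kronecker B D) $$ (i,j) = kronecker (A * B) (C * D) $$ (i,j)" .
qed (use assms in \<open>auto simp: kronecker_def\<close>)

lemma kronecker_one: "kronecker (1\<^sub>m m) (1\<^sub>m n) = (1\<^sub>m (m * n) :: 'a::comm_ring_1 mat)"
proof (rule eq_matI)
  fix i j assume ij: "i < dim_row (1\<^sub>m (m * n) :: 'a mat)" "j < dim_col (1\<^sub>m (m * n) :: 'a mat)"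
  then have i: "i < m * n" and j: "j < m * n" by auto
  have "i = j \<longleftrightarrow> i div n = j div n \<and> i mod n = j mod n"
    by (metis div_mult_mod_eq)
  then show "kronecker (1\<^sub>m m) (1\<^sub>m n) $$ (i, j) = (1\<^sub>m (m * n) :: 'a mat) $$ (i,j)"
    using i j div_mod_less[OF i] div_mod_less[OF j] by (auto simp: kronecker_def)
qed (auto simp: kronecker_def)

text \<open>
  The Kronecker product is multiplicative, so it maps the factorisations and the one-sided inverses
  of both matrices to those of their product.
\<close>

lemma has_rank_kronecker:
  fixes A A' :: "'a::field mat"
  assumes r: "has_rank A r" and r': "has_rank A' r'"
  shows "has_rank (kronecker A A') (r * r')"
proof -
  obtain B C L R where c: "B \<in> carrier_mat (dim_row A) r" "C \<in> carrier_mat r (dim_col A)"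
    "L \<in> carrier_mat r (dim_row A)" "R \<in> carrier_mat (dim_col A) r"
    and e: "A = B * C" "L * B = 1\<^sub>m r" "C * R = 1\<^sub>m r"
    using r unfolding has_rank_def by metis
  obtain B' C' L' R' where c': "B' \<in> carrier_mat (dim_row A') r'" "C' \<in> carrier_mat r' (dim_col A')"
    "L' \<in> carrier_mat r' (dim_row A')" "R' \<in> carrier_mat (dim_col A') r'"
    and e': "A' = B' * C'" "L' * B' = 1\<^sub>m r'" "C' * R' = 1\<^sub>m r'"
    using r' unfolding has_rank_def by metis
  show ?thesis
  proof (rule has_rankI)
    show "kronecker A A' = kronecker B B' * kronecker C C'"
      using kronecker_mult[OF c(1,2) c'(1,2)] e(1) e'(1) by simp
    show "kronecker L L' * kronecker B B' = 1\<^sub>m (r * r')"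
      using kronecker_mult[OF c(3,1) c'(3,1)] e e' by (simp add: kronecker_one)
    show "kronecker C C' * kronecker R R' = 1\<^sub>m (r * r')"
      using kronecker_mult[OF c(2,4) c'(2,4)] e e' by (simp add: kronecker_one)
  qed (use c c' in \<open>auto intro!: kronecker_carrier\<close>)
qed

lemma tensor_power_vdim: "vdim (tensor_power M n) v = vdim M v ^ n"
  by (induction n) (auto simp: rep_tensor_def)

lemma is_rep_tensor_power:
  assumes "is_rep Q M"
  shows "is_rep Q (tensor_power M n)"
proof (induction n)
  case (Suc n)
  then show ?case using assms
    by (auto simp: is_rep_def rep_tensor_def tensor_power_vdim intro!: kronecker_carrier)
qed (auto simp: is_rep_def)

lemma has_rank_tensor_power:
  assumes "has_rank (vmap M e) r"
  shows "has_rank (vmap (tensor_power M n) e) (r ^ n)"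
proof (induction n)
  case 0
  then show ?case using has_rank_one[of 1] by simp
next
  case (Suc n)
  then show ?case using has_rank_kronecker[OF Suc.IH assms] by (simp add: rep_tensor_def mult.commute)
qed

section \<open>Decompositions into primitive idempotents\<close>

lemma square_zero_conj:
  fixes n x y :: "'r::ring_1"
  assumes n: "n * n = 0"
  shows "((1 + n) * x * (1 - n)) * ((1 + n) * y * (1 - n)) = (1 + n) * (x * y) * (1 - n)"
proof -
  have "(1 - n) * (1 + n) = 1" using n by (simp add: algebra_simps)
  then show ?thesis by (metis mult.assoc mult_1)
qed

lemma square_zero_conj_inverse:
  fixes n x :: "'r::ring_1"
  assumes n: "n * n = 0"
  shows "(1 - n) * ((1 + n) * x * (1 - n)) * (1 + n) = x"
proof -
  have "(1 - n) * (1 + n) = 1" using n by (simp add: algebra_simps)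
  then show ?thesis by (metis mult.assoc mult_1 mult_1_right)
qed

text \<open>
  A subring, possibly with a different unit or none, all of whose elements are strongly
  \<open>\<pi>\<close>-regular: some positive power \<open>z\<close> commutes with an \<open>s\<close> such that \<open>z s z = z\<close>.  Then \<open>z s\<close> is an
  idempotent, by which \<open>x\<close> splits into an invertible and a nilpotent part.  For endomorphisms of
  finite-dimensional spaces this is Fitting's lemma.
\<close>

locale pi_regular_subring =
  fixes A :: "'r::ring_1 set"
  assumes zero_closed: "0 \<in> A"
    and add_closed: "x \<in> A \<Longrightarrow> y \<in> A \<Longrightarrow> x + y \<in> A"
    and minus_closed: "x \<in> A \<Longrightarrow> - x \<in> A"
    and mult_closed: "x \<in> A \<Longrightarrow> y \<in> A \<Longrightarrow> x * y \<in> A"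
    and pi_regular: "x \<in> A \<Longrightarrow> \<exists>m. \<exists>s\<in>A. x ^ Suc m * s = s * x ^ Suc m \<and> x ^ Suc m * s * x ^ Suc m = x ^ Suc m"
begin

lemma diff_closed: "x \<in> A \<Longrightarrow> y \<in> A \<Longrightarrow> x - y \<in> A"
  using add_closed minus_closed by (metis diff_conv_add_uminus)

lemma power_mult_closed: "x \<in> A \<Longrightarrow> s \<in> A \<Longrightarrow> x ^ m * s \<in> A"
  by (induction m) (auto simp: mult.assoc intro: mult_closed)

text \<open>
  An idempotent \<open>e \<noteq> 0\<close> of \<open>A\<close> such that the corner ring \<open>e A e\<close> contains no idempotents but its zero
  and its unit \<open>e\<close>.
\<close>

definition primitive :: "'r \<Rightarrow> bool" where
  "primitive e \<longleftrightarrow> e \<in> A \<and> e * e = e \<and> e \<noteq> 0 \<and>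
     (\<forall>w\<in>A. w * w = w \<longrightarrow> e * w = w \<longrightarrow> w * e = w \<longrightarrow> w = 0 \<or> w = e)"

definition corner :: "'r \<Rightarrow> 'r set" where
  "corner e = {x \<in> A. e * x = x \<and> x * e = x}"

definition unit_in :: "'r \<Rightarrow> 'r \<Rightarrow> bool" where
  "unit_in e x \<longleftrightarrow> (\<exists>u\<in>corner e. x * u = e \<and> u * x = e)"

lemma corner_mult: "x \<in> corner e \<Longrightarrow> y \<in> corner e \<Longrightarrow> x * y \<in> corner e"
  by (auto simp: corner_def mult_closed mult.assoc) (metis mult.assoc)

lemma corner_add: "x \<in> corner e \<Longrightarrow> y \<in> corner e \<Longrightarrow> x + y \<in> corner e"
  by (auto simp: corner_def add_closed algebra_simps)

lemma corner_zero: "0 \<in> corner e"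
  by (auto simp: corner_def zero_closed)

text \<open>
  The idempotent by which \<open>x\<close> splits lies in the corner ring, hence it is \<open>0\<close> or \<open>e\<close>.
\<close>

lemma unit_or_nilpotent:
  assumes e: "primitive e" and x: "x \<in> corner e"
  shows "unit_in e x \<or> (\<exists>m. x ^ Suc m = 0)"
proof -
  have xA: "x \<in> A" and ex: "e * x = x" and xe: "x * e = x" using x by (auto simp: corner_def)
  have eA: "e \<in> A" and ee: "e * e = e" using e by (auto simp: primitive_def)
  obtain m s where s: "s \<in> A" and comm: "x ^ Suc m * s = s * x ^ Suc m"
    and reg: "x ^ Suc m * s * x ^ Suc m = x ^ Suc m" using pi_regular[OF xA] by blast
  define z where "z = x ^ Suc m"
  define w where "w = z * s"
  have ez: "e * z = z" by (simp add: z_def mult.assoc[symmetric] ex)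
  have ze: "z * e = z" unfolding z_def power_Suc2 by (simp add: mult.assoc xe)
  have sz: "s * z = w" using comm by (simp add: w_def z_def)
  have wz: "w * z = z" using reg by (simp add: w_def z_def)
  have wA: "w \<in> A" using power_mult_closed[OF xA s, of "Suc m"] by (simp add: w_def z_def)
  have ww: "w * w = w" unfolding w_def mult.assoc[symmetric] using wz by (simp add: w_def)
  have ew: "e * w = w" by (simp add: w_def mult.assoc[symmetric] ez)
  have we: "w * e = w" by (simp add: sz[symmetric] mult.assoc ze)
  from e wA ww ew we have "w = 0 \<or> w = e" by (auto simp: primitive_def)
  then show ?thesis
  proof
    assume "w = 0"
    then have "z = 0" using wz by simp
    then show ?thesis by (auto simp: z_def)
  next
    assume "w = e"
    define r where "r = x ^ m * s"
    define l where "l = s * x ^ m"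
    have xr: "x * r = e" using \<open>w = e\<close> by (simp add: r_def w_def z_def mult.assoc)
    have lx: "l * x = e" using \<open>w = e\<close> sz by (simp add: l_def z_def power_Suc2 mult.assoc del: power_Suc)
    define u where "u = e * r"
    have u: "u = l * e" using xr lx by (metis mult.assoc u_def)
    have "u \<in> A" unfolding u_def r_def by (intro mult_closed eA power_mult_closed xA s)
    moreover have "e * u = u" by (simp add: u_def mult.assoc[symmetric] ee)
    moreover have "u * e = u" by (simp add: u mult.assoc ee)
    moreover have "x * u = e" by (simp add: u_def mult.assoc[symmetric] xe xr)
    moreover have "u * x = e" by (simp add: u mult.assoc ex lx)
    ultimately show ?thesis by (auto simp: unit_in_def corner_def)
  qed
qed

text \<open>
  If \<open>x\<close> were nilpotent, the powers of \<open>x\<close> times those of its right inverse would be both \<open>e\<close> and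
  eventually \<open>0\<close>.
\<close>

lemma right_invertible_imp_unit:
  assumes e: "primitive e" and x: "x \<in> corner e" and r: "r \<in> corner e" and xr: "x * r = e"
  shows "unit_in e x"
proof (rule ccontr)
  assume "\<not> unit_in e x"
  then obtain m where m: "x ^ Suc m = 0" using unit_or_nilpotent[OF e x] by blast
  have "x ^ k * r ^ k * e = e" for k
  proof (induction k)
    case (Suc k)
    have "r ^ k * e = e * (r ^ k * e)" 
      by (induction k) (use r e in \<open>auto simp: corner_def primitive_def mult.assoc[symmetric]\<close>)
    then have "x * (r * (r ^ k * e)) = r ^ k * e" by (metis mult.assoc xr)
    then have "x ^ k * (x * (r * (r ^ k * e))) = e" using Suc by (simp add: mult.assoc)
    then show ?case by (metis mult.assoc power_Suc power_Suc2)
  qed simp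
  from this[of "Suc m"] have "e = 0" using m by simp
  then show False using e by (simp add: primitive_def)
qed

text \<open>
  The corner ring of a primitive idempotent is local.  Let both \<open>x\<close> and \<open>y = e - x\<close> be nilpotent, and
  let \<open>t\<close> be the last nonzero power of \<open>x\<close>.  Then \<open>y t = t\<close>, so no power of \<open>y\<close> is zero.
\<close>

lemma sum_two_units:
  assumes e: "primitive e" and x: "x \<in> corner e" and y: "y \<in> corner e" and xy: "x + y = e"
  shows "unit_in e x \<or> unit_in e y"
proof (rule ccontr)
  assume "\<not> ?thesis"
  then obtain k l where k: "x ^ Suc k = 0" and l: "y ^ Suc l = 0"
    using unit_or_nilpotent[OF e x] unit_or_nilpotent[OF e y] by blast
  have e0: "e \<noteq> 0" "e * e = e" and ex: "e * x = x" using e x by (auto simp: primitive_def corner_def)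
  define m where "m = (LEAST m. x ^ m * e = 0)"
  have m: "x ^ m * e = 0" unfolding m_def by (rule LeastI[of _ "Suc k"]) (simp add: k del: power_Suc)
  then have "m \<noteq> 0" using e0 by (cases m) auto
  then obtain p where p: "m = Suc p" by (cases m) auto
  define t where "t = x ^ p * e"
  have t0: "t \<noteq> 0" using not_less_Least[of p "\<lambda>m. x ^ m * e = 0"] p by (auto simp: t_def m_def)
  have xt: "x * t = 0" using m p by (simp add: t_def mult.assoc)
  have et: "e * t = t" unfolding t_def by (cases p) (use e0 ex in \<open>auto simp: mult.assoc[symmetric]\<close>)
  have yt: "y * t = t" using xt et by (metis xy add_0 distrib_right)
  have "y ^ q * t = t" for q by (induction q) (simp_all add: mult.assoc yt)
  from this[of "Suc l"] show False using l t0 by simp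
qed

lemma unit_in_add:
  assumes e: "primitive e" and x: "x \<in> corner e" and y: "y \<in> corner e" and xy: "unit_in e (x + y)"
  shows "unit_in e x \<or> unit_in e y"
proof -
  obtain u where u: "u \<in> corner e" "(x + y) * u = e" using xy by (auto simp: unit_in_def)
  have "unit_in e (x * u) \<or> unit_in e (y * u)"
    using u(2) by (intro sum_two_units[OF e] corner_mult x y u) (simp add: algebra_simps)
  moreover have "unit_in e x" if x: "x \<in> corner e" and xu: "unit_in e (x * u)" for x
  proof -
    obtain v where "v \<in> corner e" "x * u * v = e" using xu by (auto simp: unit_in_def)
    then show ?thesis using right_invertible_imp_unit[OF e x, of "u * v"] u by (simp add: mult.assoc corner_mult)
  qed
  ultimately show ?thesis using x y by blast
qed

lemma unit_in_sum:
  assumes e: "primitive e" and "finite J" and "\<And>j. j \<in> J \<Longrightarrow> x j \<in> corner e" and "unit_in e (sum x J)"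
  shows "\<exists>j\<in>J. unit_in e (x j)"
  using assms(2-)
proof (induction J)
  case empty
  then show ?case using e by (auto simp: unit_in_def primitive_def)
next
  case (insert j J)
  have "sum x K \<in> corner e" if "finite K" "\<And>k. k \<in> K \<Longrightarrow> x k \<in> corner e" for K
    using that by (induction K) (auto intro: corner_zero corner_add)
  then have "sum x J \<in> corner e" using insert by blast
  then show ?case using unit_in_add[OF e, of "x j" "sum x J"] insert by auto
qed

lemma conj_closed: "n \<in> A \<Longrightarrow> x \<in> A \<Longrightarrow> (1 + n) * x * (1 - n) \<in> A"
proof -
  assume "n \<in> A" "x \<in> A"
  moreover have "(1 + n) * x * (1 - n) = x + n * x - x * n - n * x * n" by (simp add: algebra_simps)
  ultimately show ?thesis by (simp add: add_closed diff_closed mult_closed)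
qed

lemma primitive_conj:
  assumes n: "n * n = 0" "n \<in> A" and e: "primitive e"
  shows "primitive ((1 + n) * e * (1 - n))"
  unfolding primitive_def
proof (intro conjI ballI impI)
  let ?c = "\<lambda>x. (1 + n) * x * (1 - n)" and ?d = "\<lambda>x. (1 - n) * x * (1 + n)"
  have n': "(- n) * (- n) = 0" "- n \<in> A" using n minus_closed by auto
  have dc: "?d (?c x) = x" for x using square_zero_conj_inverse[OF n(1)] .
  have cd: "?c (?d x) = x" for x using square_zero_conj_inverse[OF n'(1), of x] by simp
  show "?c e \<in> A" using conj_closed n e by (auto simp: primitive_def)
  show "?c e * ?c e = ?c e" using square_zero_conj[OF n(1)] e by (simp add: primitive_def)
  show "?c e \<noteq> 0" using dc[of e] e by (auto simp: primitive_def)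
  fix w assume w: "w \<in> A" "w * w = w" "?c e * w = w" "w * ?c e = w"
  have mult: "?d x * ?d y = ?d (x * y)" for x y using square_zero_conj[OF n'(1), of x y] by simp
  have "?d w \<in> A" using conj_closed[OF n'(2) w(1)] by simp
  moreover have "?d w * ?d w = ?d w" using mult w by simp
  moreover have "e * ?d w = ?d w" using mult[of "?c e" w] w dc[of e] by simp
  moreover have "?d w * e = ?d w" using mult[of w "?c e"] w dc[of e] by simp
  ultimately have "?d w = 0 \<or> ?d w = e" using e by (auto simp: primitive_def)
  then show "w = 0 \<or> w = ?c e" using cd[of w] by auto
qed

text \<open>
  The exchange argument.  Let \<open>e\<close> be one of the \<open>e i\<close>.  Since \<open>e\<close> is the sum of the elements
  \<open>e (f j) e\<close> of its local corner ring, one of these is invertible there, with inverse \<open>u\<close>, say.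
  Put \<open>F = f j\<close>.  Then \<open>g = u F\<close> is an idempotent with the same image as \<open>e\<close> and the same kernel as
  \<open>F\<close>.  Two idempotents with the same image or with the same kernel differ by an element \<open>n\<close> of square
  zero and are conjugate under \<open>1 + n\<close>.  Hence a conjugation takes \<open>F\<close> to \<open>e\<close> and fixes the common
  sum \<open>E\<close>; after it, \<open>e\<close> can be removed from both decompositions.
\<close>

theorem card_primitive_decomposition:
  fixes e :: "'i \<Rightarrow> 'r" and f :: "'j \<Rightarrow> 'r"
  assumes "finite I" "finite J"
    and "\<And>i. i \<in> I \<Longrightarrow> primitive (e i)"
    and "\<And>i i'. i \<in> I \<Longrightarrow> i' \<in> I \<Longrightarrow> i \<noteq> i' \<Longrightarrow> e i * e i' = 0"
    and "\<And>j. j \<in> J \<Longrightarrow> primitive (f j)"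
    and "\<And>j j'. j \<in> J \<Longrightarrow> j' \<in> J \<Longrightarrow> j \<noteq> j' \<Longrightarrow> f j * f j' = 0"
    and "(\<Sum>i\<in>I. e i) = (\<Sum>j\<in>J. f j)"
  shows "card I = card J"
  using assms
proof (induction I arbitrary: J f)
  case empty
  have "J = {}"
  proof (rule ccontr)
    assume "J \<noteq> {}"
    then obtain j where j: "j \<in> J" by blast
    have "f j * sum f J = (\<Sum>k\<in>J. if k = j then f j else 0)"
      unfolding sum_distrib_left
      using empty.prems(4)[OF j] empty.prems(5)[OF j] j
      by (intro sum.cong) (auto simp: primitive_def)
    then show False using j empty by (auto simp: primitive_def)
  qed
  then show ?case by simp
next
  case (insert i I)
  define E where "E = (\<Sum>j\<in>J. f j)"
  have E: "E = e i + (\<Sum>i\<in>I. e i)" using insert by (simp add: E_def)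
  have prim_e: "primitive (e i)" and eA: "e i \<in> A" and ee: "e i * e i = e i"
    using insert.prems(2)[of i] by (auto simp: primitive_def)
  have "e i * (\<Sum>i\<in>I. e i) = 0" "(\<Sum>i\<in>I. e i) * e i = 0"
    unfolding sum_distrib_left sum_distrib_right
    using insert.prems(3) insert.hyps by (auto intro!: sum.neutral)
  then have eE: "e i * E = e i" and Ee: "E * e i = e i" by (simp_all add: E distrib_left distrib_right ee)
  have fE: "f j * E = f j" and Ef: "E * f j = f j" if j: "j \<in> J" for j
  proof -
    have "f j * E = (\<Sum>k\<in>J. if k = j then f j else 0)"
      unfolding sum_distrib_left E_def
      using insert.prems(4)[OF j] insert.prems(5)[OF j] j by (intro sum.cong) (auto simp: primitive_def)
    then show "f j * E = f j" using j insert.prems by simp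
    have "E * f j = (\<Sum>k\<in>J. if k = j then f j else 0)"
      unfolding sum_distrib_right E_def
      using insert.prems(4)[OF j] insert.prems(5)[OF _ j] j by (intro sum.cong) (auto simp: primitive_def)
    then show "E * f j = f j" using j insert.prems by simp
  qed
  have "(\<Sum>j\<in>J. e i * f j * e i) = e i * E * e i"
    by (simp add: E_def sum_distrib_left sum_distrib_right)
  then have sum: "(\<Sum>j\<in>J. e i * f j * e i) = e i" by (simp add: eE ee)
  have fA: "f j \<in> A" if "j \<in> J" for j using insert.prems(4)[OF that] by (auto simp: primitive_def)
  have "\<exists>j\<in>J. unit_in (e i) (e i * f j * e i)"
  proof (rule unit_in_sum[OF prim_e insert.prems(1)])
    show "e i * f j * e i \<in> corner (e i)" if "j \<in> J" for j
      using fA[OF that] eA ee by (simp add: corner_def mult_closed mult.assoc) (simp add: mult.assoc[symmetric])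
    show "unit_in (e i) (\<Sum>j\<in>J. e i * f j * e i)"
      unfolding sum unit_in_def using eA ee by (intro bexI[of _ "e i"]) (auto simp: corner_def)
  qed
  then obtain j u where j: "j \<in> J" and u: "u \<in> A" "e i * u = u" "u * e i = u"
    and xu: "(e i * f j * e i) * u = e i" and ux: "u * (e i * f j * e i) = e i"
    unfolding unit_in_def corner_def by blast
  define F where "F = f j"
  have FF: "F * F = F" and prim_F: "primitive F" using insert.prems(4)[OF j] by (auto simp: F_def primitive_def)
  \<comment> \<open>\<open>u F u = u\<close> makes \<open>F u F\<close> an idempotent under the primitive \<open>F\<close>, so it equals \<open>F\<close>.\<close>
  have uFu: "u * F * u = u"
  proof -
    have "u * F * u = (u * e i) * F * (e i * u)" using u by simp
    also have "\<dots> = (u * (e i * f j * e i)) * u" by (simp add: F_def mult.assoc)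
    finally show ?thesis by (simp add: ux u)
  qed
  have uFe: "u * F * e i = e i"
    using ux u by (simp add: F_def mult.assoc[symmetric])
  define g where "g = u * F"
  have ge: "g * e i = e i" and eg: "e i * g = g" and gF: "g * F = g"
    using uFe u FF by (simp_all add: g_def mult.assoc[symmetric]) (simp add: mult.assoc)
  have gg: "g * g = g" using uFu by (simp add: g_def mult.assoc[symmetric])
  have gA: "g \<in> A" using u fA[OF j] by (simp add: g_def F_def mult_closed)
  have Fg: "F * g = F"
  proof -
    have "F * u * F = 0 \<or> F * u * F = F"
    proof -
      have "F * u * F \<in> A" using u fA[OF j] by (simp add: F_def mult_closed)
      moreover have "(F * u * F) * (F * u * F) = F * u * F"
      proof -
        have "(F * u * F) * (F * u * F) = F * (u * (F * F) * u) * F" by (simp add: mult.assoc)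
        then show ?thesis by (simp add: FF uFu)
      qed
      moreover have "F * (F * u * F) = F * u * F" by (simp add: mult.assoc[symmetric] FF)
      moreover have "F * u * F * F = F * u * F" by (simp add: mult.assoc FF)
      ultimately show ?thesis using prim_F by (simp add: primitive_def)
    qed
    moreover have "F * u * F \<noteq> 0"
    proof
      assume 0: "F * u * F = 0"
      have "u = u * F * (u * F * u)" by (simp add: uFu)
      also have "\<dots> = u * (F * u * F) * u" by (simp add: mult.assoc)
      finally have "u = 0" using 0 by simp
      then show False using xu prim_e by (simp add: primitive_def)
    qed
    ultimately show ?thesis by (simp add: g_def mult.assoc)
  qed
  \<comment> \<open>\<open>e i\<close> and \<open>g\<close> have the same image, \<open>g\<close> and \<open>F\<close> the same kernel, whence both differences
    have square zero.\<close>
  define n1 where "n1 = g - e i"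
  define n2 where "n2 = g - F"
  have n1: "n1 * n1 = 0" "n1 \<in> A" and n2: "n2 * n2 = 0" "n2 \<in> A"
    using gg ge eg ee gF Fg FF gA eA fA[OF j] by (auto simp: n1_def n2_def algebra_simps diff_closed F_def)
  have Eg: "E * g = g" "g * E = g"
  proof -
    show "E * g = g" using eg Ee by (metis mult.assoc)
    show "g * E = g" using fE[OF j] by (simp add: g_def F_def mult.assoc)
  qed
  have En: "E * n1 = n1" "n1 * E = n1" "E * n2 = n2" "n2 * E = n2"
    using Eg Ee eE fE[OF j] Ef[OF j] by (simp_all add: n1_def n2_def algebra_simps F_def)
  have conjE: "(1 + n) * E * (1 - n) = E" if "n * n = 0" "E * n = n" "n * E = n" for n
    using that by (simp add: algebra_simps) 
  have conjF: "(1 + n2) * F * (1 - n2) = g"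
    using gg gF Fg FF by (simp add: n2_def algebra_simps)
  have conjg: "(1 + n1) * g * (1 - n1) = e i"
    using gg ge eg ee by (simp add: n1_def algebra_simps)
  define c where "c x = (1 + n1) * ((1 + n2) * x * (1 - n2)) * (1 - n1)" for x
  have cE: "c E = E" by (simp add: c_def conjE n1 n2 En)
  have cF: "c F = e i" by (simp add: c_def conjF conjg)
  have c_sum: "c (sum h K) = (\<Sum>k\<in>K. c (h k))" for h and K :: "'j set"
    by (simp add: c_def sum_distrib_left sum_distrib_right)
  have c_mult: "c x * c y = c (x * y)" for x y
    unfolding c_def using square_zero_conj[OF n1(1)] square_zero_conj[OF n2(1)] by simp
  have c_0: "c 0 = 0" by (simp add: c_def)
  have "card I = card (J - {j})"
  proof (rule insert.IH[where f = "\<lambda>k. c (f k)"])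
    show "primitive (c (f k))" if "k \<in> J - {j}" for k
      unfolding c_def using that by (intro primitive_conj n1 n2 insert.prems) auto
    show "c (f k) * c (f k') = 0" if "k \<in> J - {j}" "k' \<in> J - {j}" "k \<noteq> k'" for k k'
      using that insert.prems by (simp add: c_mult c_0)
    have "c E = c F + (\<Sum>k\<in>J - {j}. c (f k))"
      unfolding E_def c_sum using sum.remove[OF insert.prems(1) j, of "\<lambda>k. c (f k)"] by (simp add: F_def)
    then show "(\<Sum>i\<in>I. e i) = (\<Sum>k\<in>J - {j}. c (f k))" unfolding cE cF using E by (metis add_left_imp_eq)
  qed (use insert.prems in auto)
  then show ?case using insert.hyps card.remove[OF insert.prems(1) j] by simp
qed

end

section \<open>Families of matrices as additive operators\<close>

text \<open>
  In this ring products are always defined and associative and there is only one zero.  Families of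
  matrices of all formats are embedded into it by \<open>block_op\<close>, which frees the reasoning about
  idempotents from side conditions on dimensions.
\<close>

typedef (overloaded) ('i, 'k::field) additive_op =
  "{f :: ('i \<Rightarrow> 'k) \<Rightarrow> ('i \<Rightarrow> 'k). \<forall>x y. f (x + y) = f x + f y}"
  morphisms app Abs_additive_op
  by (rule exI[of _ "\<lambda>x. x"]) simp

setup_lifting type_definition_additive_op

instantiation additive_op :: (type, field) ring_1
begin

lift_definition zero_additive_op :: "('a, 'b) additive_op" is "\<lambda>_. 0" by simp
lift_definition one_additive_op :: "('a, 'b) additive_op" is "\<lambda>x. x" by simp
lift_definition plus_additive_op :: "('a, 'b) additive_op \<Rightarrow> ('a, 'b) additive_op \<Rightarrow> ('a, 'b) additive_op" is "\<lambda>f g x. f x + g x"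
  by (simp add: algebra_simps)
lift_definition uminus_additive_op :: "('a, 'b) additive_op \<Rightarrow> ('a, 'b) additive_op" is "\<lambda>f x. - f x"
  by (simp add: algebra_simps)
lift_definition minus_additive_op :: "('a, 'b) additive_op \<Rightarrow> ('a, 'b) additive_op \<Rightarrow> ('a, 'b) additive_op" is "\<lambda>f g x. f x - g x"
  by (simp add: algebra_simps)
lift_definition times_additive_op :: "('a, 'b) additive_op \<Rightarrow> ('a, 'b) additive_op \<Rightarrow> ('a, 'b) additive_op" is "\<lambda>f g x. f (g x)"
  by simp

instance
proof
  show "(0::('a,'b) additive_op) \<noteq> 1"
  proof (transfer, rule notI)
    assume "(\<lambda>_. 0 :: 'a \<Rightarrow> 'b) = (\<lambda>x. x)"
    from fun_cong[OF this, of "\<lambda>_. 1"] show False by (simp add: fun_eq_iff)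
  qed
qed (transfer; simp add: fun_eq_iff algebra_simps; fail)+

end

text \<open>
  The matrix \<open>P v\<close> acts on the coordinates \<open>(v, 0), (v, 1), \<dots>\<close>; rectangular matrices are extended
  by zero.
\<close>

lift_definition block_op :: "'v set \<Rightarrow> ('v \<Rightarrow> 'k::field mat) \<Rightarrow> ('v \<times> nat, 'k) additive_op" is
  "\<lambda>V P x. (\<lambda>(v,i). if v \<in> V \<and> i < dim_row (P v) then \<Sum>j<dim_col (P v). P v $$ (i,j) * x (v,j) else 0)"
  by (auto simp: fun_eq_iff sum.distrib algebra_simps)

lemma block_op_cong:
  assumes "\<And>v. v \<in> V \<Longrightarrow> P v = P' v"
  shows "block_op V P = block_op V P'"
  using assms by transfer (auto simp: fun_eq_iff)

lemma block_op_mult: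
  assumes "\<And>v. v \<in> V \<Longrightarrow> dim_col (P v) = dim_row (P' v)"
  shows "block_op V P * block_op V P' = block_op V (\<lambda>v. P v * P' v)"
  using assms
proof transfer
  fix V and P P' :: "'v \<Rightarrow> 'k::field mat"
  assume d: "\<And>v. v \<in> V \<Longrightarrow> dim_col (P v) = dim_row (P' v)"
  let ?b = "\<lambda>P x. (\<lambda>(v,i). if v \<in> V \<and> i < dim_row (P v) then \<Sum>j<dim_col (P v). P v $$ (i,j) * x (v,j) else 0)"
  have "?b P (?b P' x) (v,i) = ?b (\<lambda>v. P v * P' v) x (v,i)" for x v i
  proof (cases "v \<in> V \<and> i < dim_row (P v)")
    case True
    then have "?b P (?b P' x) (v,i) = (\<Sum>j<dim_col (P v). \<Sum>k<dim_col (P' v). P v $$ (i,j) * P' v $$ (j,k) * x (v,k))"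
      using d by (auto simp: sum_distrib_left mult.assoc intro!: sum.cong)
    also have "\<dots> = (\<Sum>k<dim_col (P' v). (\<Sum>j<dim_col (P v). P v $$ (i,j) * P' v $$ (j,k)) * x (v,k))"
      unfolding sum_distrib_right by (rule sum.swap)
    also have "\<dots> = ?b (\<lambda>v. P v * P' v) x (v,i)"
      using True d by (auto simp: scalar_prod_def atLeast0LessThan intro!: sum.cong)
    finally show ?thesis .
  qed (use d in auto)
  then show "(\<lambda>x. ?b P (?b P' x)) = ?b (\<lambda>v. P v * P' v)" by (simp add: fun_eq_iff)
qed

lemma block_op_add:
  assumes "\<And>v. v \<in> V \<Longrightarrow> P v \<in> carrier_mat (a v) (b v)" "\<And>v. v \<in> V \<Longrightarrow> P' v \<in> carrier_mat (a v) (b v)"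
  shows "block_op V P + block_op V P' = block_op V (\<lambda>v. P v + P' v)"
  using assms
proof transfer
  fix V a b and P P' :: "'v \<Rightarrow> 'k::field mat"
  assume d: "\<And>v. v \<in> V \<Longrightarrow> P v \<in> carrier_mat (a v) (b v)" "\<And>v. v \<in> V \<Longrightarrow> P' v \<in> carrier_mat (a v) (b v)"
  have "dim_row (P v) = a v" "dim_col (P v) = b v" "dim_row (P' v) = a v" "dim_col (P' v) = b v" if "v \<in> V" for v
    using d[OF that] by auto
  then show "(\<lambda>x. (\<lambda>(v,i). if v \<in> V \<and> i < dim_row (P v) then \<Sum>j<dim_col (P v). P v $$ (i,j) * x (v,j) else 0)
    + (\<lambda>(v,i). if v \<in> V \<and> i < dim_row (P' v) then \<Sum>j<dim_col (P' v). P' v $$ (i,j) * x (v,j) else 0))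
    = (\<lambda>x. (\<lambda>(v,i). if v \<in> V \<and> i < dim_row (P v + P' v) then \<Sum>j<dim_col (P v + P' v). (P v + P' v) $$ (i,j) * x (v,j) else 0))"
    by (auto simp: fun_eq_iff sum.distrib[symmetric] distrib_right intro!: sum.cong)
qed

lemma block_op_uminus: "- block_op V P = block_op V (\<lambda>v. - P v)"
  by transfer (auto simp: fun_eq_iff sum_negf[symmetric] intro!: sum.cong)

lemma block_op_zero: "block_op V (\<lambda>v. 0\<^sub>m (a v) (b v)) = 0"
  by transfer (auto simp: fun_eq_iff)

text \<open>
  Evaluation at unit vectors recovers the entries, once the formats are known to agree.
\<close>

lemma block_op_inject:
  assumes "\<And>v. v \<in> V \<Longrightarrow> P v \<in> carrier_mat (a v) (b v)" "\<And>v. v \<in> V \<Longrightarrow> P' v \<in> carrier_mat (a v) (b v)"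
    and eq: "block_op V P = block_op V P'" and v: "v \<in> V"
  shows "P v = P' v"
proof (rule eq_matI)
  have c: "P v \<in> carrier_mat (a v) (b v)" "P' v \<in> carrier_mat (a v) (b v)" using assms by auto
  fix i j assume ij: "i < dim_row (P' v)" "j < dim_col (P' v)"
  let ?x = "\<lambda>w. if w = (v,j) then 1 else 0"
  have "app (block_op V P) ?x (v,i) = app (block_op V P') ?x (v,i)" using eq by simp
  then show "P v $$ (i,j) = P' v $$ (i,j)"
    using ij c v by (simp add: block_op.rep_eq if_distrib[of "\<lambda>x. _ * x"] cong: if_cong)
qed (use assms(1)[OF v] assms(2)[OF v] in auto)

definition group_inverse :: "'r::ring \<Rightarrow> 'r \<Rightarrow> bool" where
  "group_inverse z s \<longleftrightarrow> z * s = s * z \<and> z * s * z = z \<and> s * z * s = s"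

text \<open>
  \<open>z s\<close> and \<open>y t\<close> are the projections onto the images of \<open>z\<close> and \<open>y\<close> along their kernels.  As \<open>f\<close> maps
  image to image and kernel to kernel, it intertwines them, and therefore also the inverses on the
  images.
\<close>

lemma group_inverse_intertwine:
  fixes f :: "'r::ring"
  assumes z: "group_inverse z s" and y: "group_inverse y t" and f: "f * z = y * f"
  shows "f * s = t * f"
proof -
  have zs: "z * s = s * z" and zsz: "z * s * z = z" and szs: "s * z * s = s"
    and yt: "y * t = t * y" and yty: "y * t * y = y" and tyt: "t * y * t = t"
    using z y by (auto simp: group_inverse_def)
  have 1: "f * (z * s) = (y * t) * f * (z * s)"
    by (metis f yty mult.assoc)
  have 2: "(y * t) * f = (y * t) * f * (z * s)"
  proof -
    have "(y * t) * f = t * (y * f)" by (simp add: yt mult.assoc)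
    also have "\<dots> = t * (f * (z * s * z))" by (simp add: f[symmetric] zsz)
    also have "\<dots> = t * ((f * z) * (s * z))" by (simp add: mult.assoc)
    also have "\<dots> = (t * y) * f * (z * s)" by (simp add: f zs mult.assoc)
    finally show ?thesis by (simp add: yt)
  qed
  have w: "f * (z * s) = (y * t) * f" using 1 2 by simp
  have "f * s = f * (z * s) * s" by (metis szs zs mult.assoc)
  also have "\<dots> = t * (y * f) * s" by (simp add: w yt mult.assoc)
  also have "\<dots> = t * (f * (z * s))" by (simp add: f[symmetric] mult.assoc)
  also have "\<dots> = (t * y * t) * f" by (simp add: w mult.assoc)
  finally show ?thesis by (simp add: tyt)
qed

text \<open>
  If \<open>Z = B C\<close> is a rank factorisation and \<open>Z\<close> and its square have equal rank, then \<open>C B\<close> is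
  invertible; with its inverse \<open>H\<close>, the group inverse of \<open>Z\<close> is \<open>B H H C\<close>.
\<close>

lemma mat_group_inverse_exists:
  fixes Z :: "'a::field mat"
  assumes Z: "Z \<in> carrier_mat n n" and r: "has_rank Z r" and r2: "has_rank (Z * Z) r"
  shows "\<exists>S\<in>carrier_mat n n. Z * S = S * Z \<and> Z * S * Z = Z \<and> S * Z * S = S"
proof -
  obtain B C where c: "B \<in> carrier_mat n r" "C \<in> carrier_mat r n" and e: "Z = B * C"
    using has_rankE[OF r Z] by metis
  have ZZ: "Z * Z \<in> carrier_mat n n" using Z by simp
  obtain B2 C2 L R where c2: "B2 \<in> carrier_mat n r" "C2 \<in> carrier_mat r n" "L \<in> carrier_mat r n" "R \<in> carrier_mat n r"
    and e2: "Z * Z = B2 * C2" "L * B2 = 1\<^sub>m r" "C2 * R = 1\<^sub>m r"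
    using has_rankE[OF r2 ZZ] by metis
  define G where "G = C * B"
  define H where "H = (C * R) * (L * B)"
  have cG: "G \<in> carrier_mat r r" "H \<in> carrier_mat r r" "L * B \<in> carrier_mat r r" "C * R \<in> carrier_mat r r"
    using c c2 by (auto simp: G_def H_def)
  have "(L * B) * (G * (C * R)) = L * (Z * Z) * R"
    using c c2 by (simp add: e G_def mat_assoc)
  also have "\<dots> = (L * B2) * (C2 * R)" unfolding e2(1) using c2 by (simp add: mat_assoc)
  also have "\<dots> = 1\<^sub>m r" by (simp add: e2)
  finally have "(G * (C * R)) * (L * B) = 1\<^sub>m r"
    using cG by (intro mat_mult_left_right_inverse[of "L * B" r]) auto
  then have GH: "G * H = 1\<^sub>m r" using c c2 cG by (simp add: H_def mat_assoc)
  then have HG: "H * G = 1\<^sub>m r" using cG mat_mult_left_right_inverse by blast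
  have GHX: "C * (B * (H * X)) = X" "H * (C * (B * X)) = X" if "X \<in> carrier_mat r k" for X k
  proof -
    have "C * (B * (H * X)) = (G * H) * X" using c cG that by (simp add: G_def mat_assoc)
    then show "C * (B * (H * X)) = X" using GH that by simp
    have "H * (C * (B * X)) = (H * G) * X" using c cG that by (simp add: G_def mat_assoc)
    then show "H * (C * (B * X)) = X" using HG that by simp
  qed
  define S where "S = B * (H * (H * C))"
  have cS: "S \<in> carrier_mat n n" using c cG by (simp add: S_def)
  have "Z * S = B * (H * C)" unfolding e S_def using c cG by (simp add: mat_assoc GHX[of "H * C" n])
  moreover have "S * Z = B * (H * C)" unfolding e S_def using c cG by (simp add: mat_assoc GHX[of C n])
  moreover have "B * (H * C) * Z = Z" unfolding e using c cG by (simp add: mat_assoc GHX[of C n])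
  moreover have "B * (H * C) * S = S" unfolding S_def using c cG by (simp add: mat_assoc GHX[of "H * C" n])
  ultimately show ?thesis using cS by (intro bexI[of _ S]) auto
qed

lemma mat_group_inverse_intertwine:
  fixes F :: "'a::field mat"
  assumes c: "Z \<in> carrier_mat n n" "S \<in> carrier_mat n n" "Y \<in> carrier_mat m m" "T \<in> carrier_mat m m"
      "F \<in> carrier_mat m n"
    and z: "Z * S = S * Z" "Z * S * Z = Z" "S * Z * S = S"
    and y: "Y * T = T * Y" "Y * T * Y = Y" "T * Y * T = T"
    and f: "F * Z = Y * F"
  shows "F * S = T * F"
proof -
  let ?o = "\<lambda>A. block_op {()} (\<lambda>_. A)"
  have m: "?o A * ?o B = ?o (A * B)" if "dim_col A = dim_row B" for A B :: "'a mat"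
    using that by (intro block_op_mult) auto
  have "?o F * ?o S = ?o T * ?o F"
    using c z y f by (intro group_inverse_intertwine[of "?o Z" "?o S" "?o Y" "?o T"])
      (auto simp: group_inverse_def m)
  then have "?o (F * S) = ?o (T * F)" using c by (simp add: m)
  from block_op_inject[OF _ _ this, of "\<lambda>_. m" "\<lambda>_. n" "()"] show ?thesis using c by auto
qed

section \<open>Endomorphism rings of representations\<close>

definition End_ring :: "('v, 'e) pre_digraph \<Rightarrow> ('v, 'e, 'k::field) quiver_rep \<Rightarrow> ('v \<times> nat, 'k) additive_op set" where
  "End_ring Q M = block_op (verts Q) ` {P. rep_hom Q M M P}"

lemma rep_homD:
  assumes "rep_hom Q M N P"
  shows "v \<in> verts Q \<Longrightarrow> P v \<in> carrier_mat (vdim N v) (vdim M v)"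
    "e \<in> arcs Q \<Longrightarrow> P (head Q e) * vmap M e = vmap N e * P (tail Q e)"
  using assms by (auto simp: rep_hom_def)

lemma is_repD: "is_rep Q M \<Longrightarrow> e \<in> arcs Q \<Longrightarrow> vmap M e \<in> carrier_mat (vdim M (head Q e)) (vdim M (tail Q e))"
  by (auto simp: is_rep_def)

lemma (in wf_digraph) rep_hom_comp:
  assumes P: "rep_hom G M N P" and P': "rep_hom G N L P'" and r: "is_rep G M" "is_rep G N" "is_rep G L"
  shows "rep_hom G M L (\<lambda>v. P' v * P v)"
  unfolding rep_hom_def
proof (intro conjI ballI)
  fix v assume "v \<in> verts G"
  then show "P' v * P v \<in> carrier_mat (vdim L v) (vdim M v)"
    using rep_homD(1)[OF P] rep_homD(1)[OF P'] by (metis mult_carrier_mat)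
next
  fix e assume e: "e \<in> arcs G"
  note v = head_in_verts[OF e] tail_in_verts[OF e]
  note c = rep_homD(1)[OF P v(1)] rep_homD(1)[OF P v(2)] rep_homD(1)[OF P' v(1)] rep_homD(1)[OF P' v(2)]
    is_repD[OF r(1) e] is_repD[OF r(2) e] is_repD[OF r(3) e]
  have "P' (head G e) * P (head G e) * vmap M e = P' (head G e) * (P (head G e) * vmap M e)"
    using c by (simp add: mat_assoc)
  also have "\<dots> = P' (head G e) * vmap N e * P (tail G e)"
    unfolding rep_homD(2)[OF P e] using c by (simp add: mat_assoc)
  also have "\<dots> = vmap L e * (P' (tail G e) * P (tail G e))"
    unfolding rep_homD(2)[OF P' e] using c by (simp add: mat_assoc)
  finally show "P' (head G e) * P (head G e) * vmap M e = vmap L e * (P' (tail G e) * P (tail G e))" .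
qed

lemma (in wf_digraph) rep_hom_add:
  assumes P: "rep_hom G M N P" and P': "rep_hom G M N P'" and r: "is_rep G M" "is_rep G N"
  shows "rep_hom G M N (\<lambda>v. P v + P' v)"
  unfolding rep_hom_def
proof (intro conjI ballI)
  fix e assume e: "e \<in> arcs G"
  note v = head_in_verts[OF e] tail_in_verts[OF e]
  note c = rep_homD(1)[OF P v(1)] rep_homD(1)[OF P v(2)] rep_homD(1)[OF P' v(1)] rep_homD(1)[OF P' v(2)]
    is_repD[OF r(1) e] is_repD[OF r(2) e]
  show "(P (head G e) + P' (head G e)) * vmap M e = vmap N e * (P (tail G e) + P' (tail G e))"
    using c rep_homD(2)[OF P e] rep_homD(2)[OF P' e]
    by (simp add: add_mult_distrib_mat[OF c(1,3,5)] mult_add_distrib_mat[OF c(6,2,4)])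
qed (use rep_homD(1)[OF P] rep_homD(1)[OF P'] in auto)

lemma (in wf_digraph) rep_hom_uminus:
  fixes M N :: "('a, 'b, 'k::field) quiver_rep"
  assumes P: "rep_hom G M N P" and r: "is_rep G M" "is_rep G N"
  shows "rep_hom G M N (\<lambda>v. - P v)"
  unfolding rep_hom_def
proof (intro conjI ballI)
  fix e assume e: "e \<in> arcs G"
  note v = head_in_verts[OF e] tail_in_verts[OF e]
  note c = rep_homD(1)[OF P v(1)] rep_homD(1)[OF P v(2)] is_repD[OF r(1) e] is_repD[OF r(2) e]
  show "- P (head G e) * vmap M e = vmap N e * - P (tail G e)"
    using c[THEN carrier_matD(1)] c[THEN carrier_matD(2)] rep_homD(2)[OF P e] by simp
qed (use rep_homD(1)[OF P] in auto)

lemma (in wf_digraph) rep_hom_zero: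
  assumes r: "is_rep G M" "is_rep G N"
  shows "rep_hom G M N (\<lambda>v. 0\<^sub>m (vdim N v) (vdim M v))"
  unfolding rep_hom_def
proof (intro conjI ballI)
  fix e assume e: "e \<in> arcs G"
  show "0\<^sub>m (vdim N (head G e)) (vdim M (head G e)) * vmap M e
      = vmap N e * 0\<^sub>m (vdim N (tail G e)) (vdim M (tail G e))"
    using is_repD[OF r(1) e] is_repD[OF r(2) e] by simp
qed simp

lemma (in wf_digraph) rep_hom_one:
  assumes r: "is_rep G M"
  shows "rep_hom G M M (\<lambda>v. 1\<^sub>m (vdim M v))"
  unfolding rep_hom_def
proof (intro conjI ballI)
  fix e assume e: "e \<in> arcs G"
  show "1\<^sub>m (vdim M (head G e)) * vmap M e = vmap M e * 1\<^sub>m (vdim M (tail G e))"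
    using is_repD[OF r e] by simp
qed simp

lemma mat_pow_add:
  fixes A :: "'a::semiring_1 mat"
  assumes "A \<in> carrier_mat n n"
  shows "A ^\<^sub>m (k + l) = A ^\<^sub>m k * A ^\<^sub>m l"
proof (induction l)
  case (Suc l)
  then show ?case using assms pow_carrier_mat[OF assms, of k] pow_carrier_mat[OF assms, of l]
    by (simp add: mat_assoc)
qed (use pow_carrier_mat[OF assms, of k] assms in simp)

lemma block_op_power:
  assumes c: "\<And>v. v \<in> V \<Longrightarrow> P v \<in> carrier_mat (d v) (d v)"
  shows "block_op V P ^ Suc m = block_op V (\<lambda>v. P v ^\<^sub>m Suc m)"
proof (induction m)
  case 0
  show ?case using c by (auto intro!: block_op_cong)
next
  case (Suc m)
  have d: "v \<in> V \<Longrightarrow> dim_col (P v ^\<^sub>m Suc m) = dim_row (P v)" for v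
    using c pow_carrier_mat by (metis carrier_matD)
  have "block_op V P ^ Suc (Suc m) = block_op V P ^ Suc m * block_op V P" by (rule power_Suc2)
  also have "\<dots> = block_op V (\<lambda>v. P v ^\<^sub>m Suc m * P v)" unfolding Suc.IH
    by (rule block_op_mult) (rule d)
  finally show ?case by simp
qed

text \<open>
  Minimising the sum of all ranks over the exponents gives one exponent for all vertices: passing to
  the doubled exponent cannot increase any rank and cannot decrease the sum.
\<close>

lemma uniform_rank_stabilisation:
  fixes P :: "'v \<Rightarrow> 'a::field mat"
  assumes V: "finite V" and c: "\<And>v. v \<in> V \<Longrightarrow> P v \<in> carrier_mat (d v) (d v)"
  shows "\<exists>m. \<forall>v\<in>V. mrank (P v ^\<^sub>m Suc m * P v ^\<^sub>m Suc m) = mrank (P v ^\<^sub>m Suc m)"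
proof -
  define R where "R m = (\<Sum>v\<in>V. mrank (P v ^\<^sub>m Suc m))" for m
  obtain m where min: "\<And>k. R m \<le> R k" using ex_has_least_nat[of "\<lambda>_. True" 0 R] by blast
  have le: "mrank (P v ^\<^sub>m Suc (m + Suc m)) \<le> mrank (P v ^\<^sub>m Suc m)" if v: "v \<in> V" for v
  proof -
    have eq: "P v ^\<^sub>m Suc (m + Suc m) = 1\<^sub>m (d v) * P v ^\<^sub>m Suc m * P v ^\<^sub>m Suc m"
      using mat_pow_add[OF c[OF v], of "Suc m" "Suc m"]
      unfolding left_mult_one_mat[OF pow_carrier_mat[OF c[OF v], of "Suc m"]] add_Suc .
    note p = pow_carrier_mat[OF c[OF v], of "Suc m"]
    show ?thesis
      by (rule has_rank_mult_le[OF _ has_rank_mrank one_carrier_mat p p])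
        (use has_rank_mrank[of "P v ^\<^sub>m Suc (m + Suc m)"] in \<open>simp only: eq\<close>)
  qed
  have "mrank (P v ^\<^sub>m Suc (m + Suc m)) = mrank (P v ^\<^sub>m Suc m)" if v: "v \<in> V" for v
  proof (rule ccontr)
    assume "\<not> ?thesis"
    then have "R (m + Suc m) < R m" unfolding R_def
      using le v V by (intro sum_strict_mono_ex1) (auto simp: le_less)
    then show False using min[of "m + Suc m"] by simp
  qed
  moreover have "P v ^\<^sub>m Suc (m + Suc m) = P v ^\<^sub>m Suc m * P v ^\<^sub>m Suc m" if "v \<in> V" for v
    using mat_pow_add[OF c[OF that], of "Suc m" "Suc m"] by simp
  ultimately show ?thesis by metis
qed

lemma (in wf_digraph) rep_hom_pow:
  assumes P: "rep_hom G M M P" and r: "is_rep G M"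
  shows "rep_hom G M M (\<lambda>v. P v ^\<^sub>m Suc m)"
proof (induction m)
  case 0
  have "rep_hom G M M (\<lambda>v. 1\<^sub>m (vdim M v) * P v)" by (rule rep_hom_comp[OF P rep_hom_one[OF r] r r r])
  then show ?case using rep_homD(1)[OF P] P head_in_verts tail_in_verts by (auto simp: rep_hom_def)
next
  case (Suc m)
  show ?case using rep_hom_comp[OF P Suc r r r] by simp
qed

text \<open>
  The group inverses of a sufficiently high power of an endomorphism are taken vertex by vertex.  They
  form an endomorphism again because group inverses are intertwined by the arrows.
\<close>

theorem (in fin_digraph) End_ring_pi_regular:
  assumes r: "is_rep G M"
  shows "pi_regular_subring (End_ring G M)"
proof
  show "0 \<in> End_ring G M"
    unfolding End_ring_def using rep_hom_zero[OF r r] block_op_zero[of "verts G" "vdim M" "vdim M"]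
    by (metis (mono_tags, lifting) image_eqI mem_Collect_eq)
  fix x assume "x \<in> End_ring G M"
  then obtain P where P: "rep_hom G M M P" and x: "x = block_op (verts G) P" by (auto simp: End_ring_def)
  note cP = rep_homD(1)[OF P]
  show "- x \<in> End_ring G M"
    unfolding x block_op_uminus End_ring_def using rep_hom_uminus[OF P r r] by blast
  {
    fix y assume "y \<in> End_ring G M"
    then obtain P' where P': "rep_hom G M M P'" and y: "y = block_op (verts G) P'" by (auto simp: End_ring_def)
    have "x + y = block_op (verts G) (\<lambda>v. P v + P' v)"
      unfolding x y by (rule block_op_add[OF cP rep_homD(1)[OF P']])
    then show "x + y \<in> End_ring G M" unfolding End_ring_def using rep_hom_add[OF P P' r r] by blast
    have "x * y = block_op (verts G) (\<lambda>v. P v * P' v)"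
      unfolding x y using cP rep_homD(1)[OF P'] by (intro block_op_mult) (metis carrier_matD)
    then show "x * y \<in> End_ring G M" unfolding End_ring_def using rep_hom_comp[OF P' P r r r] by blast
  }
  obtain m where m: "\<forall>v\<in>verts G. mrank (P v ^\<^sub>m Suc m * P v ^\<^sub>m Suc m) = mrank (P v ^\<^sub>m Suc m)"
    using uniform_rank_stabilisation[of "verts G" P, OF finite_verts cP] by blast
  define Z where "Z v = P v ^\<^sub>m Suc m" for v
  have Z: "rep_hom G M M Z" unfolding Z_def by (rule rep_hom_pow[OF P r])
  note cZ = rep_homD(1)[OF Z]
  have "\<exists>S\<in>carrier_mat (vdim M v) (vdim M v). Z v * S = S * Z v \<and> Z v * S * Z v = Z v \<and> S * Z v * S = S"
    if v: "v \<in> verts G" for v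
    using m v has_rank_mrank[of "Z v"] has_rank_mrank[of "Z v * Z v"]
    by (intro mat_group_inverse_exists[OF cZ[OF v]]) (auto simp: Z_def)
  then obtain S where cS: "\<And>v. v \<in> verts G \<Longrightarrow> S v \<in> carrier_mat (vdim M v) (vdim M v)"
    and S: "\<And>v. v \<in> verts G \<Longrightarrow> Z v * S v = S v * Z v" "\<And>v. v \<in> verts G \<Longrightarrow> Z v * S v * Z v = Z v"
      "\<And>v. v \<in> verts G \<Longrightarrow> S v * Z v * S v = S v"
    by metis
  have hS: "rep_hom G M M S" unfolding rep_hom_def
  proof (intro conjI ballI)
    fix e assume e: "e \<in> arcs G"
    note h = head_in_verts[OF e] and t = tail_in_verts[OF e]
    show "S (head G e) * vmap M e = vmap M e * S (tail G e)"
      by (rule mat_group_inverse_intertwine[symmetric, OF cZ[OF t] cS[OF t] cZ[OF h] cS[OF h] is_repD[OF r e]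
            S(1-3)[OF t] S(1-3)[OF h] rep_homD(2)[OF Z e, symmetric]])
  qed (rule cS)
  define s where "s = block_op (verts G) S"
  have xm: "x ^ Suc m = block_op (verts G) Z" unfolding x Z_def by (rule block_op_power[OF cP])
  have d: "v \<in> verts G \<Longrightarrow> dim_row (Z v) = vdim M v \<and> dim_col (Z v) = vdim M v \<and> dim_row (S v) = vdim M v \<and> dim_col (S v) = vdim M v" for v
    using cZ[of v] cS[of v] by auto
  have "x ^ Suc m * s = s * x ^ Suc m"
    unfolding xm s_def using d S(1) by (simp add: block_op_mult) (rule block_op_cong, simp)
  moreover have "x ^ Suc m * s * x ^ Suc m = x ^ Suc m"
    unfolding xm s_def using d S(2) by (simp add: block_op_mult) (rule block_op_cong, simp)
  moreover have "s \<in> End_ring G M" unfolding s_def End_ring_def using hS by blast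
  ultimately show "\<exists>m. \<exists>s\<in>End_ring G M. x ^ Suc m * s = s * x ^ Suc m \<and> x ^ Suc m * s * x ^ Suc m = x ^ Suc m"
    by blast
qed

section \<open>Block rows and block columns\<close>

definition row_block :: "'a::zero mat \<Rightarrow> 'a mat \<Rightarrow> 'a mat" where
  "row_block A B = four_block_mat A B (0\<^sub>m 0 (dim_col A)) (0\<^sub>m 0 (dim_col B))"

definition col_block :: "'a::zero mat \<Rightarrow> 'a mat \<Rightarrow> 'a mat" where
  "col_block C D = four_block_mat C (0\<^sub>m (dim_row C) 0) D (0\<^sub>m (dim_row D) 0)"

lemma row_block_carrier: "A \<in> carrier_mat m a \<Longrightarrow> B \<in> carrier_mat m b \<Longrightarrow> row_block A B \<in> carrier_mat m (a + b)"
  using four_block_carrier_mat[of A m a "0\<^sub>m 0 b" 0 b] by (simp add: row_block_def)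

lemma col_block_carrier: "C \<in> carrier_mat a n \<Longrightarrow> D \<in> carrier_mat b n \<Longrightarrow> col_block C D \<in> carrier_mat (a + b) n"
  using four_block_carrier_mat[of C a n "0\<^sub>m b 0" b 0] by (simp add: col_block_def)

lemma empty_block: "X \<in> carrier_mat a b \<Longrightarrow> four_block_mat X (0\<^sub>m a 0) (0\<^sub>m 0 b) (0\<^sub>m 0 0) = X"
  by (intro eq_matI) auto

lemma mult_empty: "X \<in> carrier_mat a 0 \<Longrightarrow> Y \<in> carrier_mat 0 b \<Longrightarrow> X * Y = (0\<^sub>m a b :: 'a::semiring_0 mat)"
  by (intro eq_matI) (auto simp: scalar_prod_def)

lemma row_col_mult:
  fixes A B C D :: "'a::semiring_1 mat"
  assumes c: "A \<in> carrier_mat m a" "B \<in> carrier_mat m b" "C \<in> carrier_mat a n" "D \<in> carrier_mat b n"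
  shows "row_block A B * col_block C D = A * C + B * D"
proof -
  have "row_block A B * col_block C D =
    four_block_mat (A * C + B * D) (A * 0\<^sub>m a 0 + B * 0\<^sub>m b 0)
      (0\<^sub>m 0 a * C + 0\<^sub>m 0 b * D) (0\<^sub>m 0 a * 0\<^sub>m a 0 + 0\<^sub>m 0 b * 0\<^sub>m b 0)"
    unfolding row_block_def col_block_def using c
    by (subst mult_four_block_mat[of A m a B b _ 0 _ C n _ 0 D]) auto
  also have "\<dots> = A * C + B * D" using c by (simp add: empty_block)
  finally show ?thesis .
qed

lemma col_row_mult:
  fixes A B C D :: "'a::semiring_1 mat"
  assumes c: "C \<in> carrier_mat a n" "D \<in> carrier_mat b n" "A \<in> carrier_mat n a'" "B \<in> carrier_mat n b'"
  shows "col_block C D * row_block A B = four_block_mat (C * A) (C * B) (D * A) (D * B)"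
proof -
  have "col_block C D * row_block A B = four_block_mat (C * A + 0\<^sub>m a 0 * 0\<^sub>m 0 a') (C * B + 0\<^sub>m a 0 * 0\<^sub>m 0 b')
     (D * A + 0\<^sub>m b 0 * 0\<^sub>m 0 a') (D * B + 0\<^sub>m b 0 * 0\<^sub>m 0 b')"
    unfolding row_block_def col_block_def using c
    by (subst mult_four_block_mat[of C a n _ 0 D b _ A a' B b']) auto
  then show ?thesis using c by (simp add: mult_empty[where b=a'] mult_empty[where b=b'])
qed

lemma diag_col_mult:
  fixes C D X Y :: "'a::semiring_1 mat"
  assumes c: "X \<in> carrier_mat a' a" "Y \<in> carrier_mat b' b" "C \<in> carrier_mat a n" "D \<in> carrier_mat b n"
  shows "four_block_mat X (0\<^sub>m a' b) (0\<^sub>m b' a) Y * col_block C D = col_block (X * C) (Y * D)"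
proof -
  have "four_block_mat X (0\<^sub>m a' b) (0\<^sub>m b' a) Y * col_block C D =
    four_block_mat (X * C + 0\<^sub>m a' b * D) (X * 0\<^sub>m a 0 + 0\<^sub>m a' b * 0\<^sub>m b 0)
      (0\<^sub>m b' a * C + Y * D) (0\<^sub>m b' a * 0\<^sub>m a 0 + Y * 0\<^sub>m b 0)"
    unfolding col_block_def using c
    by (subst mult_four_block_mat[of X a' a _ b _ b' Y C n _ 0 D]) auto
  then show ?thesis using c by (simp add: col_block_def)
qed

lemma row_diag_mult:
  fixes A B X Y :: "'a::semiring_1 mat"
  assumes c: "X \<in> carrier_mat a a'" "Y \<in> carrier_mat b b'" "A \<in> carrier_mat n a" "B \<in> carrier_mat n b"
  shows "row_block A B * four_block_mat X (0\<^sub>m a b') (0\<^sub>m b a') Y = row_block (A * X) (B * Y)"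
proof -
  have "row_block A B * four_block_mat X (0\<^sub>m a b') (0\<^sub>m b a') Y =
    four_block_mat (A * X + B * 0\<^sub>m b a') (A * 0\<^sub>m a b' + B * Y)
      (0\<^sub>m 0 a * X + 0\<^sub>m 0 b * 0\<^sub>m b a') (0\<^sub>m 0 a * 0\<^sub>m a b' + 0\<^sub>m 0 b * Y)"
    unfolding row_block_def using c
    by (subst mult_four_block_mat[of A n a B b _ 0 _ X a' _ b' _ Y]) auto
  then show ?thesis using c by (simp add: row_block_def)
qed

lemma col_mult:
  fixes C D X :: "'a::semiring_1 mat"
  assumes c: "C \<in> carrier_mat a m" "D \<in> carrier_mat b m" "X \<in> carrier_mat m n"
  shows "col_block C D * X = col_block (C * X) (D * X)"
proof -
  have "col_block C D * four_block_mat X (0\<^sub>m m 0) (0\<^sub>m 0 n) (0\<^sub>m 0 0) =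
    four_block_mat (C * X + 0\<^sub>m a 0 * 0\<^sub>m 0 n) (C * 0\<^sub>m m 0 + 0\<^sub>m a 0 * 0\<^sub>m 0 0)
      (D * X + 0\<^sub>m b 0 * 0\<^sub>m 0 n) (D * 0\<^sub>m m 0 + 0\<^sub>m b 0 * 0\<^sub>m 0 0)"
    unfolding col_block_def using c
    by (subst mult_four_block_mat[of C a m _ 0 D b _ X n _ 0]) auto
  then show ?thesis using c by (simp add: col_block_def empty_block mult_empty[where b=n])
qed

lemma mult_row:
  fixes A B X :: "'a::semiring_1 mat"
  assumes c: "X \<in> carrier_mat n m" "A \<in> carrier_mat m a" "B \<in> carrier_mat m b"
  shows "X * row_block A B = row_block (X * A) (X * B)"
proof -
  have "four_block_mat X (0\<^sub>m n 0) (0\<^sub>m 0 m) (0\<^sub>m 0 0) * row_block A B =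
    four_block_mat (X * A + 0\<^sub>m n 0 * 0\<^sub>m 0 a) (X * B + 0\<^sub>m n 0 * 0\<^sub>m 0 b)
      (0\<^sub>m 0 m * A + 0\<^sub>m 0 0 * 0\<^sub>m 0 a) (0\<^sub>m 0 m * B + 0\<^sub>m 0 0 * 0\<^sub>m 0 b)"
    unfolding row_block_def using c
    by (subst mult_four_block_mat[of X n m _ 0 _ 0 _ A a B b]) auto
  then show ?thesis using c by (simp add: row_block_def empty_block mult_empty[where b=a] mult_empty[where b=b])
qed

section \<open>Direct sums and idempotent endomorphisms\<close>

lemma direct_sum_Nil: "vdim (direct_sum []) v = 0" "vmap (direct_sum []) e = 0\<^sub>m 0 0"
  by (auto simp: direct_sum_def)

lemma direct_sum_Cons_vdim: "vdim (direct_sum (N # Ns)) v = vdim N v + vdim (direct_sum Ns) v"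
  by (auto simp: direct_sum_def)

lemma direct_sum_Cons_vmap:
  assumes "vmap N e \<in> carrier_mat a b" "vmap (direct_sum Ns) e \<in> carrier_mat a' b'"
  shows "vmap (direct_sum (N # Ns)) e = four_block_mat (vmap N e) (0\<^sub>m a b') (0\<^sub>m a' b) (vmap (direct_sum Ns) e)"
  using assms by (auto simp: direct_sum_def Let_def)

lemma is_rep_direct_sum: "(\<And>N. N \<in> set Ns \<Longrightarrow> is_rep Q N) \<Longrightarrow> is_rep Q (direct_sum Ns)"
proof (induction Ns)
  case (Cons N Ns)
  have N: "is_rep Q N" and D: "is_rep Q (direct_sum Ns)" using Cons by auto
  show ?case unfolding is_rep_def
    using direct_sum_Cons_vmap[OF is_repD[OF N] is_repD[OF D]] is_repD[OF N] is_repD[OF D]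
    by (simp add: direct_sum_Cons_vdim)
qed (auto simp: is_rep_def direct_sum_Nil)

lemma direct_sum_concat:
  "direct_sum (map direct_sum Nss) = direct_sum (concat Nss)"
proof -
  have "diag_block_mat (map (\<lambda>M. vmap M e) (map direct_sum Nss)) = diag_block_mat (map (\<lambda>M. vmap M e) (concat Nss))" for e
    by (induction Nss) (auto simp: diag_block_mat_append direct_sum_def Let_def)
  moreover have "(\<Sum>M\<leftarrow>map direct_sum Nss. vdim M v) = (\<Sum>M\<leftarrow>concat Nss. vdim M v)" for v
    by (induction Nss) (auto simp: direct_sum_def)
  ultimately show ?thesis unfolding direct_sum_def[of "map _ _"] direct_sum_def[of "concat _"] by simp
qed

text \<open>
  If \<open>E = B C\<close> is a rank factorisation, cancelling the one-sided inverses from \<open>B C B C = B C\<close> leaves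
  \<open>C B = 1\<close>.
\<close>

lemma split_idempotent:
  fixes E :: "'a::field mat"
  assumes E: "E \<in> carrier_mat n n" and EE: "E * E = E"
  shows "\<exists>r B C. B \<in> carrier_mat n r \<and> C \<in> carrier_mat r n \<and> E = B * C \<and> C * B = 1\<^sub>m r"
proof -
  obtain r where r: "has_rank E r" using has_rank_exists[OF E] by blast
  obtain B C L R where c: "B \<in> carrier_mat n r" "C \<in> carrier_mat r n" "L \<in> carrier_mat r n" "R \<in> carrier_mat n r"
    and e: "E = B * C" "L * B = 1\<^sub>m r" "C * R = 1\<^sub>m r"
    using has_rankE[OF r E] by metis
  have "C * B = (L * B) * (C * B) * (C * R)" using c e(2,3) by simp
  also have "\<dots> = L * (E * E) * R" unfolding e(1) using c by (simp add: mat_assoc)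
  also have "\<dots> = (L * B) * (C * R)" unfolding EE unfolding e(1) using c by (simp add: mat_assoc)
  also have "\<dots> = 1\<^sub>m r" using c e by simp
  finally show ?thesis using c e by blast
qed

text \<open>
  Splitting \<open>P\<close> and \<open>1 - P\<close> at every vertex exhibits \<open>M\<close> as the direct sum of their images, on which
  the arrows act by \<open>C (head e) * M e * B (tail e)\<close>.
\<close>

lemma (in wf_digraph) indecomposable_idempotent_trivial:
  fixes M :: "('a, 'b, 'k::field) quiver_rep"
  assumes ind: "indecomposable G M" and P: "rep_hom G M M P"
    and PP: "\<And>v. v \<in> verts G \<Longrightarrow> P v * P v = P v"
  shows "(\<forall>v\<in>verts G. P v = 0\<^sub>m (vdim M v) (vdim M v)) \<or> (\<forall>v\<in>verts G. P v = 1\<^sub>m (vdim M v))"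
proof -
  have r: "is_rep G M" using ind by (simp add: indecomposable_def)
  let ?n = "vdim M"
  define P' where "P' v = 1\<^sub>m (?n v) - P v" for v
  note cP = rep_homD(1)[OF P]
  have cP': "P' v \<in> carrier_mat (?n v) (?n v)" if "v \<in> verts G" for v
    unfolding P'_def using cP[OF that] by (rule minus_carrier_mat)
  have PP': "P v * P' v = 0\<^sub>m (?n v) (?n v)" "P' v * P v = 0\<^sub>m (?n v) (?n v)" "P' v * P' v = P' v"
    "P v + P' v = 1\<^sub>m (?n v)" if v: "v \<in> verts G" for v
  proof -
    note c = cP[OF v]
    show 1: "P v * P' v = 0\<^sub>m (?n v) (?n v)" "P' v * P v = 0\<^sub>m (?n v) (?n v)"
      unfolding P'_def using c PP[OF v]
      by (simp_all add: mult_minus_distrib_mat[OF c one_carrier_mat c] minus_mult_distrib_mat[OF one_carrier_mat c c])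
    show "P' v * P' v = P' v"
      using mult_minus_distrib_mat[OF cP'[OF v] one_carrier_mat c] 1 cP'[OF v] by (subst P'_def) (auto intro!: eq_matI)
    show "P v + P' v = 1\<^sub>m (?n v)" using c by (intro eq_matI) (auto simp: P'_def)
  qed
  have comm': "P' (head G e) * vmap M e = vmap M e * P' (tail G e)" if e: "e \<in> arcs G" for e
  proof -
    note h = head_in_verts[OF e] and t = tail_in_verts[OF e]
    note m = is_repD[OF r e]
    show ?thesis unfolding P'_def using rep_homD(2)[OF P e] m
      by (simp add: mult_minus_distrib_mat[OF m one_carrier_mat cP[OF t]]
          minus_mult_distrib_mat[OF one_carrier_mat cP[OF h] m])
  qed
  obtain s B C where c: "\<And>v. v \<in> verts G \<Longrightarrow> B v \<in> carrier_mat (?n v) (s v)"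
    "\<And>v. v \<in> verts G \<Longrightarrow> C v \<in> carrier_mat (s v) (?n v)"
    and BC: "\<And>v. v \<in> verts G \<Longrightarrow> P v = B v * C v" and CB: "\<And>v. v \<in> verts G \<Longrightarrow> C v * B v = 1\<^sub>m (s v)"
    using split_idempotent[OF cP PP] by metis
  obtain s' B' C' where c': "\<And>v. v \<in> verts G \<Longrightarrow> B' v \<in> carrier_mat (?n v) (s' v)"
    "\<And>v. v \<in> verts G \<Longrightarrow> C' v \<in> carrier_mat (s' v) (?n v)"
    and BC': "\<And>v. v \<in> verts G \<Longrightarrow> P' v = B' v * C' v" and CB': "\<And>v. v \<in> verts G \<Longrightarrow> C' v * B' v = 1\<^sub>m (s' v)"
    using split_idempotent[OF cP' PP'(3)] by metis
  have orth: "C v * B' v = 0\<^sub>m (s v) (s' v)" "C' v * B v = 0\<^sub>m (s' v) (s v)" if v: "v \<in> verts G" for v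
  proof -
    note cc = c(1)[OF v] c(2)[OF v] c'(1)[OF v] c'(2)[OF v]
    have "C v * B' v = (C v * B v) * (C v * B' v) * (C' v * B' v)"
      unfolding CB[OF v] CB'[OF v] using cc by simp
    also have "\<dots> = C v * (P v * P' v) * B' v" unfolding BC[OF v] BC'[OF v] using cc by (simp add: mat_assoc)
    also have "\<dots> = 0\<^sub>m (s v) (s' v)" unfolding PP'(1)[OF v] using cc by simp
    finally show "C v * B' v = 0\<^sub>m (s v) (s' v)" .
    have "C' v * B v = (C' v * B' v) * (C' v * B v) * (C v * B v)"
      unfolding CB[OF v] CB'[OF v] using cc by simp
    also have "\<dots> = C' v * (P' v * P v) * B v" unfolding BC[OF v] BC'[OF v] using cc by (simp add: mat_assoc)
    also have "\<dots> = 0\<^sub>m (s' v) (s v)" unfolding PP'(2)[OF v] using cc by simp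
    finally show "C' v * B v = 0\<^sub>m (s' v) (s v)" .
  qed
  define N where "N = \<lparr>vdim = s, vmap = (\<lambda>e. C (head G e) * (vmap M e * B (tail G e)))\<rparr>"
  define N' where "N' = \<lparr>vdim = s', vmap = (\<lambda>e. C' (head G e) * (vmap M e * B' (tail G e)))\<rparr>"
  have cN: "vmap N e \<in> carrier_mat (s (head G e)) (s (tail G e))"
    "vmap N' e \<in> carrier_mat (s' (head G e)) (s' (tail G e))" if e: "e \<in> arcs G" for e
    using c(1)[OF tail_in_verts[OF e]] c'(1)[OF tail_in_verts[OF e]] c(2)[OF head_in_verts[OF e]]
      c'(2)[OF head_in_verts[OF e]] is_repD[OF r e]
    by (auto simp: N_def N'_def intro!: mult_carrier_mat)
  have rN: "is_rep G N" "is_rep G N'" using cN by (auto simp: is_rep_def N_def N'_def)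
  have dim: "vdim (direct_sum [N, N']) v = s v + s' v" for v by (simp add: direct_sum_def N_def N'_def)
  have map: "vmap (direct_sum [N, N']) e = four_block_mat (vmap N e) (0\<^sub>m (s (head G e)) (s' (tail G e)))
      (0\<^sub>m (s' (head G e)) (s (tail G e))) (vmap N' e)" if e: "e \<in> arcs G" for e
    using cN[OF e] by (simp add: direct_sum_def empty_block)
  define F where "F v = col_block (C v) (C' v)" for v
  define F' where "F' v = row_block (B v) (B' v)" for v
  have F: "rep_hom G M (direct_sum [N, N']) F" unfolding rep_hom_def dim
  proof (intro conjI ballI)
    fix e assume e: "e \<in> arcs G"
    note h = head_in_verts[OF e] and t = tail_in_verts[OF e]
    note cc = c(1)[OF h] c(2)[OF h] c(1)[OF t] c(2)[OF t] c'(1)[OF h] c'(2)[OF h] c'(1)[OF t] c'(2)[OF t] is_repD[OF r e]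
    have "vmap N e * C (tail G e) = C (head G e) * (vmap M e * (B (tail G e) * C (tail G e)))"
      using cc by (simp add: N_def mat_assoc)
    also have "\<dots> = C (head G e) * B (head G e) * (C (head G e) * vmap M e)"
      unfolding BC[OF t, symmetric] rep_homD(2)[OF P e, symmetric] BC[OF h] using cc by (simp add: mat_assoc)
    finally have 1: "vmap N e * C (tail G e) = C (head G e) * vmap M e" unfolding CB[OF h] using cc by simp
    have "vmap N' e * C' (tail G e) = C' (head G e) * (vmap M e * (B' (tail G e) * C' (tail G e)))"
      using cc by (simp add: N'_def mat_assoc)
    also have "\<dots> = C' (head G e) * B' (head G e) * (C' (head G e) * vmap M e)"
      unfolding BC'[OF t, symmetric] comm'[OF e, symmetric] BC'[OF h] using cc by (simp add: mat_assoc)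
    finally have 2: "vmap N' e * C' (tail G e) = C' (head G e) * vmap M e" unfolding CB'[OF h] using cc by simp
    show "F (head G e) * vmap M e = vmap (direct_sum [N, N']) e * F (tail G e)"
      unfolding map[OF e] F_def col_mult[OF cc(2,6,9)] diag_col_mult[OF cN[OF e] cc(4,8)] 1 2 ..
  qed (use c c' in \<open>auto simp: F_def intro!: col_block_carrier\<close>)
  have F': "rep_hom G (direct_sum [N, N']) M F'" unfolding rep_hom_def dim
  proof (intro conjI ballI)
    fix e assume e: "e \<in> arcs G"
    note h = head_in_verts[OF e] and t = tail_in_verts[OF e]
    note cc = c(1)[OF h] c(2)[OF h] c(1)[OF t] c(2)[OF t] c'(1)[OF h] c'(2)[OF h] c'(1)[OF t] c'(2)[OF t] is_repD[OF r e]
    have "B (head G e) * vmap N e = (B (head G e) * C (head G e)) * vmap M e * B (tail G e)"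
      using cc by (simp add: N_def mat_assoc)
    also have "\<dots> = vmap M e * B (tail G e) * (C (tail G e) * B (tail G e))"
      unfolding BC[OF h, symmetric] rep_homD(2)[OF P e] BC[OF t] using cc by (simp add: mat_assoc)
    finally have 1: "B (head G e) * vmap N e = vmap M e * B (tail G e)" unfolding CB[OF t] using cc by simp
    have "B' (head G e) * vmap N' e = (B' (head G e) * C' (head G e)) * vmap M e * B' (tail G e)"
      using cc by (simp add: N'_def mat_assoc)
    also have "\<dots> = vmap M e * B' (tail G e) * (C' (tail G e) * B' (tail G e))"
      unfolding BC'[OF h, symmetric] comm'[OF e] BC'[OF t] using cc by (simp add: mat_assoc)
    finally have 2: "B' (head G e) * vmap N' e = vmap M e * B' (tail G e)" unfolding CB'[OF t] using cc by simp
    show "F' (head G e) * vmap (direct_sum [N, N']) e = vmap M e * F' (tail G e)"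
      unfolding map[OF e] F'_def row_diag_mult[OF cN[OF e] cc(1,5)] mult_row[OF cc(9,3,7)] 1 2 ..
  qed (use c c' in \<open>auto simp: F'_def intro!: row_block_carrier\<close>)
  have "rep_iso G M (direct_sum [N, N'])" unfolding rep_iso_def
  proof (intro exI conjI ballI, rule F, rule F')
    fix v assume v: "v \<in> verts G"
    note cc = c(1)[OF v] c(2)[OF v] c'(1)[OF v] c'(2)[OF v]
    show "F' v * F v = 1\<^sub>m (?n v)"
      unfolding F_def F'_def row_col_mult[OF cc(1,3,2,4)] using BC[OF v] BC'[OF v] PP'(4)[OF v] by simp
    show "F v * F' v = 1\<^sub>m (vdim (direct_sum [N, N']) v)"
      unfolding F_def F'_def col_row_mult[OF cc(2,4,1,3)] by (simp add: CB[OF v] CB'[OF v] orth[OF v] dim)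
  qed
  then have "zero_rep G N \<or> zero_rep G N'" using ind rN by (auto simp: indecomposable_def)
  then show ?thesis
  proof
    assume z: "zero_rep G N"
    have "P v = 0\<^sub>m (?n v) (?n v)" if v: "v \<in> verts G" for v
      using z c(1)[OF v] c(2)[OF v] mult_empty BC[OF v] v by (auto simp: zero_rep_def N_def)
    then show ?thesis by blast
  next
    assume z: "zero_rep G N'"
    have "P v = 1\<^sub>m (?n v)" if v: "v \<in> verts G" for v
    proof -
      have "P' v = 0\<^sub>m (?n v) (?n v)"
        using z c'(1)[OF v] c'(2)[OF v] mult_empty BC'[OF v] v by (auto simp: zero_rep_def N'_def)
      then show ?thesis using PP'(4)[OF v] cP[OF v] by simp
    qed
    then show ?thesis by blast
  qed
qed

section \<open>The Krull--Schmidt property\<close>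

text \<open>
  Inclusions \<open>j\<close> and projections \<open>p\<close> of the summands.  The last equation is stated for operators, as
  a sum of matrices over a finite index set has no meaning for a type without a common zero.
\<close>

definition (in wf_digraph) biproduct :: "('a, 'b, 'k::field) quiver_rep \<Rightarrow> ('a, 'b, 'k) quiver_rep list
    \<Rightarrow> (nat \<Rightarrow> 'a \<Rightarrow> 'k mat) \<Rightarrow> (nat \<Rightarrow> 'a \<Rightarrow> 'k mat) \<Rightarrow> bool" where
  "biproduct D Ns j p \<longleftrightarrow>
    (\<forall>i<length Ns. rep_hom G (Ns ! i) D (j i) \<and> rep_hom G D (Ns ! i) (p i)) \<and>
    (\<forall>i<length Ns. \<forall>k<length Ns. \<forall>v\<in>verts G.
       p i v * j k v = (if i = k then 1\<^sub>m (vdim (Ns ! i) v) else 0\<^sub>m (vdim (Ns ! i) v) (vdim (Ns ! k) v))) \<and>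
    (\<Sum>i<length Ns. block_op (verts G) (\<lambda>v. j i v * p i v)) = block_op (verts G) (\<lambda>v. 1\<^sub>m (vdim D v))"

lemma (in wf_digraph) direct_sum_biproduct:
  fixes Ns :: "('a, 'b, 'k::field) quiver_rep list"
  assumes "\<And>N. N \<in> set Ns \<Longrightarrow> is_rep G N"
  shows "\<exists>j p. biproduct (direct_sum Ns) Ns j p"
  using assms
proof (induction Ns)
  case Nil
  have "(0 :: ('a \<times> nat, 'k) additive_op) = block_op (verts G) (\<lambda>v. 0\<^sub>m 0 0)"
    by (rule block_op_zero[symmetric])
  moreover have "(1\<^sub>m 0 :: 'k mat) = 0\<^sub>m 0 0" by (intro eq_matI) auto
  ultimately show ?case by (simp add: biproduct_def direct_sum_Nil)
next
  case (Cons N Ns)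
  define D where "D = direct_sum Ns"
  define X where "X = direct_sum (N # Ns)"
  have rN: "is_rep G N" and rD: "is_rep G D" and rX: "is_rep G X"
    using Cons.prems is_rep_direct_sum[of Ns G] is_rep_direct_sum[of "N # Ns" G] by (auto simp: D_def X_def)
  obtain j p where bi: "biproduct D Ns j p" using Cons unfolding D_def by auto
  then have jp: "\<And>i. i < length Ns \<Longrightarrow> rep_hom G (Ns ! i) D (j i)"
      "\<And>i. i < length Ns \<Longrightarrow> rep_hom G D (Ns ! i) (p i)"
    and pj: "\<And>i k v. i < length Ns \<Longrightarrow> k < length Ns \<Longrightarrow> v \<in> verts G \<Longrightarrow>
       p i v * j k v = (if i = k then 1\<^sub>m (vdim (Ns ! i) v) else 0\<^sub>m (vdim (Ns ! i) v) (vdim (Ns ! k) v))"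
    and sum: "(\<Sum>i<length Ns. block_op (verts G) (\<lambda>v. j i v * p i v)) = block_op (verts G) (\<lambda>v. 1\<^sub>m (vdim D v))"
    unfolding biproduct_def by blast+
  let ?a = "vdim N" and ?b = "vdim D"
  have Xv: "vdim X v = ?a v + ?b v" for v by (simp add: X_def D_def direct_sum_Cons_vdim)
  have Xe: "vmap X e = four_block_mat (vmap N e) (0\<^sub>m (?a (head G e)) (?b (tail G e)))
     (0\<^sub>m (?b (head G e)) (?a (tail G e))) (vmap D e)" if "e \<in> arcs G" for e
    unfolding X_def D_def using direct_sum_Cons_vmap[OF is_repD[OF rN that] is_repD[OF rD[unfolded D_def] that]]
    by (simp add: D_def)
  define i1 i2 where "i1 v = col_block (1\<^sub>m (?a v)) (0\<^sub>m (?b v) (?a v) :: 'k mat)"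
    and "i2 v = col_block (0\<^sub>m (?a v) (?b v)) (1\<^sub>m (?b v) :: 'k mat)" for v
  define p1 p2 where "p1 v = row_block (1\<^sub>m (?a v)) (0\<^sub>m (?a v) (?b v) :: 'k mat)"
    and "p2 v = row_block (0\<^sub>m (?b v) (?a v)) (1\<^sub>m (?b v) :: 'k mat)" for v
  note z = zero_carrier_mat and o = one_carrier_mat
  have c: "i1 v \<in> carrier_mat (vdim X v) (?a v)" "i2 v \<in> carrier_mat (vdim X v) (?b v)"
    "p1 v \<in> carrier_mat (?a v) (vdim X v)" "p2 v \<in> carrier_mat (?b v) (vdim X v)" for v
    unfolding i1_def i2_def p1_def p2_def Xv by (auto intro!: row_block_carrier col_block_carrier)
  have hom: "rep_hom G N X i1" "rep_hom G D X i2" "rep_hom G X N p1" "rep_hom G X D p2"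
  proof -
    have "i1 (head G e) * vmap N e = vmap X e * i1 (tail G e)"
      "i2 (head G e) * vmap D e = vmap X e * i2 (tail G e)"
      "p1 (head G e) * vmap X e = vmap N e * p1 (tail G e)"
      "p2 (head G e) * vmap X e = vmap D e * p2 (tail G e)" if e: "e \<in> arcs G" for e
    proof -
      note m = is_repD[OF rN e] is_repD[OF rD e]
      show "i1 (head G e) * vmap N e = vmap X e * i1 (tail G e)"
        unfolding Xe[OF e] i1_def col_mult[OF o z m(1)] diag_col_mult[OF m o z] using m by simp
      show "i2 (head G e) * vmap D e = vmap X e * i2 (tail G e)"
        unfolding Xe[OF e] i2_def col_mult[OF z o m(2)] diag_col_mult[OF m z o] using m by simp
      show "p1 (head G e) * vmap X e = vmap N e * p1 (tail G e)"
        unfolding Xe[OF e] p1_def row_diag_mult[OF m o z] mult_row[OF m(1) o z] using m by simp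
      show "p2 (head G e) * vmap X e = vmap D e * p2 (tail G e)"
        unfolding Xe[OF e] p2_def row_diag_mult[OF m z o] mult_row[OF m(2) z o] using m by simp
    qed
    then show "rep_hom G N X i1" "rep_hom G D X i2" "rep_hom G X N p1" "rep_hom G X D p2"
      using c by (auto simp: rep_hom_def)
  qed
  have p1i1: "p1 v * i1 v = 1\<^sub>m (?a v)" and p1i2: "p1 v * i2 v = 0\<^sub>m (?a v) (?b v)"
    and p2i1: "p2 v * i1 v = 0\<^sub>m (?b v) (?a v)" and p2i2: "p2 v * i2 v = 1\<^sub>m (?b v)" for v
    unfolding p1_def p2_def i1_def i2_def
      row_col_mult[OF o z o z] row_col_mult[OF o z z o] row_col_mult[OF z o o z] row_col_mult[OF z o z o]
    by simp_all
  have ip: "i1 v * p1 v + i2 v * p2 v = 1\<^sub>m (vdim X v)" for v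
  proof -
    have "i1 v * p1 v + i2 v * p2 v =
      four_block_mat (1\<^sub>m (?a v)) (0\<^sub>m (?a v) (?b v)) (0\<^sub>m (?b v) (?a v)) (0\<^sub>m (?b v) (?b v)) +
      four_block_mat (0\<^sub>m (?a v) (?a v)) (0\<^sub>m (?a v) (?b v)) (0\<^sub>m (?b v) (?a v)) (1\<^sub>m (?b v))"
      unfolding p1_def p2_def i1_def i2_def col_row_mult[OF o z o z] col_row_mult[OF z o z o] by simp
    also have "\<dots> = 1\<^sub>m (vdim X v)"
      unfolding Xv by (subst add_four_block_mat[OF o z z z z z z o]) simp
    finally show ?thesis .
  qed
  define j' where "j' i = (case i of 0 \<Rightarrow> i1 | Suc k \<Rightarrow> (\<lambda>v. i2 v * j k v))" for i
  define p' where "p' i = (case i of 0 \<Rightarrow> p1 | Suc k \<Rightarrow> (\<lambda>v. p k v * p2 v))" for i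
  have cj: "i < length Ns \<Longrightarrow> v \<in> verts G \<Longrightarrow> j i v \<in> carrier_mat (?b v) (vdim (Ns ! i) v)"
    and cp: "i < length Ns \<Longrightarrow> v \<in> verts G \<Longrightarrow> p i v \<in> carrier_mat (vdim (Ns ! i) v) (?b v)" for i v
    using rep_homD(1)[OF jp(1)] rep_homD(1)[OF jp(2)] by auto
  have rNs: "i < length Ns \<Longrightarrow> is_rep G (Ns ! i)" for i using Cons.prems by simp
  have hj: "rep_hom G ((N # Ns) ! i) X (j' i)" if "i < length (N # Ns)" for i
    using that hom rep_hom_comp[OF jp(1) hom(2) rNs rD rX] by (cases i) (auto simp: j'_def)
  have hp: "rep_hom G X ((N # Ns) ! i) (p' i)" if "i < length (N # Ns)" for i
    using that hom rep_hom_comp[OF hom(4) jp(2) rX rD rNs] by (cases i) (auto simp: p'_def)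
  have pj': "p' i v * j' k v = (if i = k then 1\<^sub>m (vdim ((N # Ns) ! i) v) else 0\<^sub>m (vdim ((N # Ns) ! i) v) (vdim ((N # Ns) ! k) v))"
    if i: "i < length (N # Ns)" and k: "k < length (N # Ns)" and v: "v \<in> verts G" for i k v
  proof (cases i; cases k)
    assume "i = 0" "k = 0" then show ?thesis by (simp add: p'_def j'_def p1i1)
  next
    fix k' assume e: "i = 0" "k = Suc k'"
    then have "p' i v * j' k v = (p1 v * i2 v) * j k' v"
      using k v cj[of k' v] c[of v] by (simp add: p'_def j'_def mat_assoc)
    then show ?thesis using e k v cj[of k' v] by (simp add: p1i2)
  next
    fix i' assume e: "i = Suc i'" "k = 0"
    then have "p' i v * j' k v = p i' v * (p2 v * i1 v)"
      using i v cp[of i' v] c[of v] by (simp add: p'_def j'_def mat_assoc)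
    then show ?thesis using e i v cp[of i' v] by (simp add: p2i1)
  next
    fix i' k' assume e: "i = Suc i'" "k = Suc k'"
    then have "p' i v * j' k v = p i' v * ((p2 v * i2 v) * j k' v)"
      using i k v cp[of i' v] cj[of k' v] c[of v] by (simp add: p'_def j'_def mat_assoc)
    then show ?thesis using e i k v cj[of k' v] pj[of i' k' v] by (simp add: p2i2)
  qed
  let ?o = "block_op (verts G)"
  have "(\<Sum>i<length (N # Ns). ?o (\<lambda>v. j' i v * p' i v)) =
     ?o (\<lambda>v. i1 v * p1 v) + (\<Sum>i<length Ns. ?o (\<lambda>v. (i2 v * j i v) * (p i v * p2 v)))"
    by (simp add: sum.lessThan_Suc_shift j'_def p'_def del: sum.lessThan_Suc)
  also have "(\<Sum>i<length Ns. ?o (\<lambda>v. (i2 v * j i v) * (p i v * p2 v))) =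
     (\<Sum>i<length Ns. ?o i2 * ?o (\<lambda>v. j i v * p i v) * ?o p2)"
  proof (rule sum.cong)
    fix i assume "i \<in> {..<length Ns}"
    then have i: "i < length Ns" by simp
    have d: "v \<in> verts G \<Longrightarrow> dim_row (j i v) = ?b v \<and> dim_col (j i v) = vdim (Ns ! i) v \<and>
        dim_row (p i v) = vdim (Ns ! i) v \<and> dim_col (p i v) = ?b v \<and> dim_col (i2 v) = ?b v \<and> dim_row (p2 v) = ?b v" for v
      using cj[OF i] cp[OF i] c[of v] by fastforce
    have "?o i2 * ?o (\<lambda>v. j i v * p i v) * ?o p2 = ?o (\<lambda>v. i2 v * (j i v * p i v) * p2 v)"
      using d by (simp add: block_op_mult)
    also have "\<dots> = ?o (\<lambda>v. (i2 v * j i v) * (p i v * p2 v))"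
      using d by (intro block_op_cong) (simp add: mat_assoc)
    finally show "?o (\<lambda>v. (i2 v * j i v) * (p i v * p2 v)) = ?o i2 * ?o (\<lambda>v. j i v * p i v) * ?o p2" ..
  qed simp
  also have "\<dots> = ?o i2 * ?o (\<lambda>v. 1\<^sub>m (?b v)) * ?o p2"
    by (simp add: sum[symmetric] sum_distrib_left sum_distrib_right)
  also have "\<dots> = ?o (\<lambda>v. i2 v * p2 v)"
  proof -
    have d: "dim_col (i2 v) = ?b v" "dim_row (p2 v) = ?b v" for v using c[of v] by auto
    have "?o i2 * ?o (\<lambda>v. 1\<^sub>m (?b v)) * ?o p2 = ?o (\<lambda>v. i2 v * 1\<^sub>m (?b v) * p2 v)"
      using d by (simp add: block_op_mult)
    also have "\<dots> = ?o (\<lambda>v. i2 v * p2 v)"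
      by (intro block_op_cong) (simp add: right_mult_one_mat[OF c(2)])
    finally show ?thesis .
  qed
  also have "?o (\<lambda>v. i1 v * p1 v) + ?o (\<lambda>v. i2 v * p2 v) = ?o (\<lambda>v. i1 v * p1 v + i2 v * p2 v)"
    by (intro block_op_add[of _ _ "vdim X" "vdim X"] mult_carrier_mat[OF c(1,3)] mult_carrier_mat[OF c(2,4)])
  finally have sum': "(\<Sum>i<length (N # Ns). ?o (\<lambda>v. j' i v * p' i v)) = ?o (\<lambda>v. 1\<^sub>m (vdim X v))"
    by (simp only: ip)
  show ?case
    unfolding biproduct_def X_def[symmetric]
    by (rule exI[of _ j'], rule exI[of _ p'], intro conjI) (use hj hp pj' sum' in \<open>blast+\<close>)
qed

text \<open>
  The corner ring of the idempotent \<open>j p\<close> is the endomorphism ring of \<open>N\<close>: an idempotent \<open>w\<close> under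
  \<open>j p\<close> corresponds to the idempotent \<open>p w j\<close> of \<open>N\<close>, which is trivial.
\<close>

lemma (in fin_digraph) indecomposable_summand_primitive:
  fixes M N :: "('a, 'b, 'k::field) quiver_rep"
  assumes r: "is_rep G M" and ind: "indecomposable G N"
    and j: "rep_hom G N M j" and p: "rep_hom G M N p"
    and pj: "\<And>v. v \<in> verts G \<Longrightarrow> p v * j v = 1\<^sub>m (vdim N v)"
  shows "pi_regular_subring.primitive (End_ring G M) (block_op (verts G) (\<lambda>v. j v * p v))"
proof -
  interpret R: pi_regular_subring "End_ring G M" by (rule End_ring_pi_regular[OF r])
  have rN: "is_rep G N" and nz: "\<not> zero_rep G N" using ind by (auto simp: indecomposable_def)
  let ?o = "block_op (verts G)"
  note cj = rep_homD(1)[OF j] and cp = rep_homD(1)[OF p]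
  have d: "v \<in> verts G \<Longrightarrow> dim_row (j v) = vdim M v \<and> dim_col (j v) = vdim N v \<and>
      dim_row (p v) = vdim N v \<and> dim_col (p v) = vdim M v" for v
    using cj cp by fastforce
  define J P E I where "J = ?o j" and "P = ?o p" and "E = ?o (\<lambda>v. j v * p v)" and "I = ?o (\<lambda>v. 1\<^sub>m (vdim N v) :: 'k mat)"
  have E: "E = J * P" unfolding J_def P_def E_def using d by (simp add: block_op_mult)
  have PJ: "P * J = I"
  proof -
    have "P * J = ?o (\<lambda>v. p v * j v)" unfolding J_def P_def using d by (simp add: block_op_mult)
    also have "\<dots> = I" unfolding I_def by (rule block_op_cong) (rule pj)
    finally show ?thesis .
  qed
  have JI: "J * I = J"
  proof -
    have "J * I = ?o (\<lambda>v. j v * 1\<^sub>m (vdim N v))" unfolding J_def I_def using d by (simp add: block_op_mult)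
    also have "\<dots> = J" unfolding J_def by (intro block_op_cong) (rule right_mult_one_mat[OF cj])
    finally show ?thesis .
  qed
  have EE: "E * E = E" using E PJ JI by (metis mult.assoc)
  have IP: "I * P = P"
  proof -
    have "I * P = ?o (\<lambda>v. 1\<^sub>m (vdim N v) * p v)" unfolding P_def I_def using d by (simp add: block_op_mult)
    also have "\<dots> = P" unfolding P_def by (intro block_op_cong) (rule left_mult_one_mat[OF cp])
    finally show ?thesis .
  qed
  have "E \<in> End_ring G M" unfolding E_def End_ring_def using rep_hom_comp[OF p j r rN r] by blast
  moreover have "E \<noteq> 0"
  proof
    assume "E = 0"
    then have "P * (J * P) * J = 0" using E by simp
    then have "I * I = 0" using PJ by (simp add: mult.assoc[symmetric]) (simp add: mult.assoc)
    then have "I = 0" using PJ JI by (metis mult.assoc)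
    then have "I = ?o (\<lambda>v. 0\<^sub>m (vdim N v) (vdim N v))" by (simp add: block_op_zero)
      then have I0: "?o (\<lambda>v. 1\<^sub>m (vdim N v) :: 'k mat) = ?o (\<lambda>v. 0\<^sub>m (vdim N v) (vdim N v))" by (simp add: I_def)
    have eq: "(1\<^sub>m (vdim N v) :: 'k mat) = 0\<^sub>m (vdim N v) (vdim N v)" if "v \<in> verts G" for v
      by (rule block_op_inject[OF _ _ I0 that, of "vdim N" "vdim N"]) auto
    have "vdim N v = 0" if "v \<in> verts G" for v
      by (rule one_mat_eq_zero) (rule eq[OF that])
    then show False using nz by (simp add: zero_rep_def)
  qed
  moreover have "w = 0 \<or> w = E" if w: "w \<in> End_ring G M" "w * w = w" "E * w = w" "w * E = w" for w
  proof -
    obtain W where W: "rep_hom G M M W" and wW: "w = ?o W" using w by (auto simp: End_ring_def)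
    note cW = rep_homD(1)[OF W]
    have dW: "v \<in> verts G \<Longrightarrow> dim_row (W v) = vdim M v \<and> dim_col (W v) = vdim M v" for v
      using cW by fastforce
    define U where "U v = p v * (W v * j v)" for v
    have U: "rep_hom G N N U" unfolding U_def
      by (rule rep_hom_comp[OF rep_hom_comp[OF j W rN r r] p rN r rN])
    note cU = rep_homD(1)[OF U]
    have u: "?o U = P * (w * J)" unfolding P_def J_def wW U_def using d dW by (simp add: block_op_mult)
    have "?o U * ?o U = P * (w * (J * P) * w) * J" by (simp add: u mult.assoc)
    also have "\<dots> = ?o U" using w by (simp add: u E[symmetric] mult.assoc[symmetric])
    finally have UU: "?o (\<lambda>v. U v * U v) = ?o U" using cU by (subst (asm) block_op_mult) fastforce+
    have "U v * U v = U v" if "v \<in> verts G" for v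
      by (rule block_op_inject[OF mult_carrier_mat[OF cU cU] cU UU that])
    from indecomposable_idempotent_trivial[OF ind U this]
    have "?o U = 0 \<or> ?o U = I"
    proof
      assume "\<forall>v\<in>verts G. U v = 0\<^sub>m (vdim N v) (vdim N v)"
      then have "?o U = ?o (\<lambda>v. 0\<^sub>m (vdim N v) (vdim N v))" by (intro block_op_cong) simp
      then show ?thesis by (simp add: block_op_zero)
    next
      assume "\<forall>v\<in>verts G. U v = 1\<^sub>m (vdim N v)"
      then have "?o U = I" unfolding I_def by (intro block_op_cong) simp
      then show ?thesis ..
    qed
    moreover have "w = J * ?o U * P"
    proof -
      have "w = E * (w * E)" using w by simp
      then show ?thesis by (simp add: u E mult.assoc)
    qed
    ultimately show ?thesis using IP E by (auto simp: mult.assoc)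
  qed
  ultimately show ?thesis using EE unfolding E_def[symmetric] R.primitive_def by blast
qed

lemma (in fin_digraph) primitive_decomposition:
  fixes M :: "('a, 'b, 'k::field) quiver_rep"
  assumes r: "is_rep G M" and ind: "\<And>N. N \<in> set Ns \<Longrightarrow> indecomposable G N"
    and iso: "rep_iso G M (direct_sum Ns)"
  shows "\<exists>e. (\<forall>i<length Ns. pi_regular_subring.primitive (End_ring G M) (e i)) \<and>
    (\<forall>i<length Ns. \<forall>k<length Ns. i \<noteq> k \<longrightarrow> e i * e k = 0) \<and>
    (\<Sum>i<length Ns. e i) = block_op (verts G) (\<lambda>v. 1\<^sub>m (vdim M v))"
proof -
  let ?o = "block_op (verts G)"
  define D where "D = direct_sum Ns"
  have rNs: "is_rep G N" if "N \<in> set Ns" for N using ind[OF that] by (simp add: indecomposable_def)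
  have rD: "is_rep G D" unfolding D_def using rNs by (rule is_rep_direct_sum)
  obtain j p where bi: "biproduct D Ns j p" using direct_sum_biproduct rNs unfolding D_def by blast
  then have jp: "\<And>i. i < length Ns \<Longrightarrow> rep_hom G (Ns ! i) D (j i)"
      "\<And>i. i < length Ns \<Longrightarrow> rep_hom G D (Ns ! i) (p i)"
    and pj: "\<And>i k v. i < length Ns \<Longrightarrow> k < length Ns \<Longrightarrow> v \<in> verts G \<Longrightarrow>
       p i v * j k v = (if i = k then 1\<^sub>m (vdim (Ns ! i) v) else 0\<^sub>m (vdim (Ns ! i) v) (vdim (Ns ! k) v))"
    and sum: "(\<Sum>i<length Ns. ?o (\<lambda>v. j i v * p i v)) = ?o (\<lambda>v. 1\<^sub>m (vdim D v))"
    unfolding biproduct_def by blast+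
  obtain F F' where F: "rep_hom G M D F" and F': "rep_hom G D M F'"
    and FF: "\<And>v. v \<in> verts G \<Longrightarrow> F' v * F v = 1\<^sub>m (vdim M v)" "\<And>v. v \<in> verts G \<Longrightarrow> F v * F' v = 1\<^sub>m (vdim D v)"
    using iso unfolding rep_iso_def D_def by blast
  define j' where "j' i v = F' v * j i v" for i v
  define p' where "p' i v = p i v * F v" for i v
  define e where "e i = ?o (\<lambda>v. j' i v * p' i v)" for i
  have d: "dim_row (F v) = vdim D v" "dim_col (F v) = vdim M v" "dim_row (F' v) = vdim M v" "dim_col (F' v) = vdim D v"
    if "v \<in> verts G" for v
    using rep_homD(1)[OF F that] rep_homD(1)[OF F' that] by auto
  have dj: "dim_row (j i v) = vdim D v" "dim_col (j i v) = vdim (Ns ! i) v"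
    "dim_row (p i v) = vdim (Ns ! i) v" "dim_col (p i v) = vdim D v" if "i < length Ns" "v \<in> verts G" for i v
    using rep_homD(1)[OF jp(1)[OF that(1)] that(2)] rep_homD(1)[OF jp(2)[OF that(1)] that(2)] by auto
  have pj': "p' i v * j' k v = p i v * j k v" if "i < length Ns" "k < length Ns" "v \<in> verts G" for i k v
    unfolding p'_def j'_def using left_inverse_cancel[OF FF(2)[OF that(3)], of "j k v"] that
    by (simp add: mat_assoc d dj)
  have "\<forall>i<length Ns. pi_regular_subring.primitive (End_ring G M) (e i)"
  proof (intro allI impI)
    fix i assume i: "i < length Ns"
    have N: "Ns ! i \<in> set Ns" using i by simp
    show "pi_regular_subring.primitive (End_ring G M) (e i)"
      unfolding e_def
    proof (rule indecomposable_summand_primitive[OF r ind[OF N]])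
      show "rep_hom G (Ns ! i) M (j' i)" unfolding j'_def by (rule rep_hom_comp[OF jp(1)[OF i] F' rNs[OF N] rD r])
      show "rep_hom G M (Ns ! i) (p' i)" unfolding p'_def by (rule rep_hom_comp[OF F jp(2)[OF i] r rD rNs[OF N]])
      show "p' i v * j' i v = 1\<^sub>m (vdim (Ns ! i) v)" if "v \<in> verts G" for v using pj' pj i that by simp
    qed
  qed
  moreover have "\<forall>i<length Ns. \<forall>k<length Ns. i \<noteq> k \<longrightarrow> e i * e k = 0"
  proof (intro allI impI)
    fix i k assume i: "i < length Ns" and k: "k < length Ns" and ik: "i \<noteq> k"
    have "e i * e k = ?o (\<lambda>v. (j' i v * p' i v) * (j' k v * p' k v))"
      unfolding e_def using i k by (intro block_op_mult) (simp add: j'_def p'_def d dj)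
    also have "\<dots> = ?o (\<lambda>v. 0\<^sub>m (vdim M v) (vdim M v))"
    proof (rule block_op_cong)
      fix v assume v: "v \<in> verts G"
      have "(j' i v * p' i v) * (j' k v * p' k v) = j' i v * ((p' i v * j' k v) * p' k v)"
        using i k v by (simp add: mat_assoc j'_def p'_def d dj)
      also have "\<dots> = 0\<^sub>m (vdim M v) (vdim M v)"
        unfolding pj'[OF i k v] pj[OF i k v] using ik i k v
        by (simp add: j'_def p'_def d dj)
      finally show "(j' i v * p' i v) * (j' k v * p' k v) = 0\<^sub>m (vdim M v) (vdim M v)" .
    qed
    finally show "e i * e k = 0" by (simp add: block_op_zero)
  qed
  moreover have "(\<Sum>i<length Ns. e i) = ?o (\<lambda>v. 1\<^sub>m (vdim M v))"
  proof -
    have "e i = ?o F' * ?o (\<lambda>v. j i v * p i v) * ?o F" if i: "i < length Ns" for i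
    proof -
      have "?o F' * ?o (\<lambda>v. j i v * p i v) * ?o F = ?o (\<lambda>v. F' v * (j i v * p i v) * F v)"
        using i by (simp add: block_op_mult d dj)
      also have "\<dots> = e i" unfolding e_def
        using i by (intro block_op_cong) (simp add: j'_def p'_def mat_assoc d dj)
      finally show ?thesis ..
    qed
    then have "(\<Sum>i<length Ns. e i) = ?o F' * ?o (\<lambda>v. 1\<^sub>m (vdim D v)) * ?o F"
      by (simp add: sum[symmetric] sum_distrib_left sum_distrib_right)
    also have "\<dots> = ?o (\<lambda>v. F' v * 1\<^sub>m (vdim D v) * F v)" by (simp add: block_op_mult d)
    also have "\<dots> = ?o (\<lambda>v. 1\<^sub>m (vdim M v))"
    proof (rule block_op_cong)
      fix v assume v: "v \<in> verts G"
      show "F' v * 1\<^sub>m (vdim D v) * F v = 1\<^sub>m (vdim M v)"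
        using rep_homD(1)[OF F' v] FF(1)[OF v] by simp
    qed
    finally show ?thesis .
  qed
  ultimately show ?thesis by blast
qed

theorem (in fin_digraph) Krull_Schmidt_length:
  fixes M :: "('a, 'b, 'k::field) quiver_rep"
  assumes r: "is_rep G M"
    and Ns: "\<And>N. N \<in> set Ns \<Longrightarrow> indecomposable G N" "rep_iso G M (direct_sum Ns)"
    and Ns': "\<And>N. N \<in> set Ns' \<Longrightarrow> indecomposable G N" "rep_iso G M (direct_sum Ns')"
  shows "length Ns = length Ns'"
proof -
  interpret R: pi_regular_subring "End_ring G M" by (rule End_ring_pi_regular[OF r])
  obtain e where e: "\<forall>i<length Ns. R.primitive (e i)" "\<forall>i<length Ns. \<forall>k<length Ns. i \<noteq> k \<longrightarrow> e i * e k = 0"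
    "(\<Sum>i<length Ns. e i) = block_op (verts G) (\<lambda>v. 1\<^sub>m (vdim M v))"
    using primitive_decomposition[OF r Ns] by blast
  obtain f where f: "\<forall>i<length Ns'. R.primitive (f i)" "\<forall>i<length Ns'. \<forall>k<length Ns'. i \<noteq> k \<longrightarrow> f i * f k = 0"
    "(\<Sum>i<length Ns'. f i) = block_op (verts G) (\<lambda>v. 1\<^sub>m (vdim M v))"
    using primitive_decomposition[OF r Ns'] by blast
  have "card {..<length Ns} = card {..<length Ns'}"
    using e f by (intro R.card_primitive_decomposition[of _ _ e f]) auto
  then show ?thesis by simp
qed

lemma (in fin_digraph) num_indec_summands_eq:
  fixes M :: "('a, 'b, 'k::field) quiver_rep"
  assumes "is_rep G M" "\<And>N. N \<in> set Ns \<Longrightarrow> indecomposable G N" "rep_iso G M (direct_sum Ns)"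
  shows "num_indec_summands G M = length Ns"
  unfolding num_indec_summands_def
  using assms Krull_Schmidt_length[OF assms(1)] by (intro the_equality) blast+

section \<open>Positive roots of type D\<close>

text \<open>
  Expanding the squares counts the inner entries twice, but the first one only once, whence the
  additional square of \<open>z 1\<close>.
\<close>

lemma chain_squares:
  fixes z :: "nat \<Rightarrow> int"
  shows "(z 1)\<^sup>2 + (\<Sum>k=1..m. (z k - z (k + 1))\<^sup>2) =
    2 * (\<Sum>k=1..m. (z k)\<^sup>2) - 2 * (\<Sum>k=1..m. z k * z (k + 1)) + (z (m + 1))\<^sup>2"
  by (induction m) (simp_all add: algebra_simps power2_eq_square)

lemma twin_root_simps:
  "twin_root i j VA = 1" "twin_root i j VB = 1"
  "twin_root i j (VC k) = (if 1 \<le> k \<and> k \<le> i then 1 else 0) + (if 1 \<le> k \<and> k \<le> j then 1 else 0)"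
proof -
  have *: "(\<Sum>k'=1..i. if VC k = VC k' then (1::nat) else 0) = (if 1 \<le> k \<and> k \<le> i then 1 else 0)" for i
    by (simp add: sum.delta)
  show "twin_root i j (VC k) = (if 1 \<le> k \<and> k \<le> i then 1 else 0) + (if 1 \<le> k \<and> k \<le> j then 1 else 0)"
    unfolding twin_root_def std_basis_def * by simp
qed (simp_all add: twin_root_def std_basis_def)

lemma telescope:
  fixes z :: "nat \<Rightarrow> int"
  assumes "k \<le> m + 1"
  shows "z k = (\<Sum>j=k..m. z j - z (j + 1)) + z (m + 1)"
  using assms
proof (induction m)
  case (Suc m)
  show ?case
  proof (cases "k = Suc m + 1")
    case False
    then show ?thesis using Suc by simp
  qed simp
next
  case 0
  then show ?case by (cases k) auto
qed

lemma le_square: "(t::int) \<le> t\<^sup>2"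
  using self_le_ge2_pow[of 2 "nat t"] by (cases "t \<le> 0") (auto simp: power2_eq_square intro: order_trans[of _ 0])

lemma int_square_le_4: "(t::int)\<^sup>2 \<le> 4 \<Longrightarrow> t \<le> 2"
  using power2_le_imp_le[of t 2] by simp

lemma int_square_le_2: "(t::int)\<^sup>2 \<le> 2 \<Longrightarrow> t \<le> 1"
proof (rule ccontr)
  assume "t\<^sup>2 \<le> 2" "\<not> t \<le> 1"
  then have "2 * 2 \<le> t * t" by (intro mult_mono) auto
  then show False using \<open>t\<^sup>2 \<le> 2\<close> by (simp add: power2_eq_square)
qed

locale type_D =
  fixes l :: nat and Q :: "(dvertex, darrow) pre_digraph"
  assumes l: "l \<ge> 4" and D: "dynkin_D l Q"
begin

lemma verts: "verts Q = {VA, VB} \<union> VC ` {1..l - 2}"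
  and arcs: "arcs Q = {Alpha, Beta} \<union> Gamma ` {1..l - 3}"
  and ends: "e \<in> arcs Q \<Longrightarrow> {tail Q e, head Q e} = D_ends e"
  using D by (auto simp: dynkin_D_def)

lemma ends_cases:
  assumes "e \<in> arcs Q" "D_ends e = {u, w}"
  shows "tail Q e = u \<and> head Q e = w \<or> tail Q e = w \<and> head Q e = u"
  using ends[OF assms(1)] assms(2) by (simp add: doubleton_eq_iff)

sublocale fin_digraph Q
proof
  show "tail Q e \<in> verts Q" "head Q e \<in> verts Q" if "e \<in> arcs Q" for e
  proof -
    have "D_ends e \<subseteq> verts Q" using that l unfolding verts arcs by auto
    then show "tail Q e \<in> verts Q" "head Q e \<in> verts Q" using ends[OF that] by auto
  qed
qed (auto simp: verts arcs)

lemma tail_neq_head: "e \<in> arcs Q \<Longrightarrow> tail Q e \<noteq> head Q e"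
  using ends[of e] by (cases e) (auto simp: doubleton_eq_iff)

lemma D_ends_inject: "D_ends e = D_ends e' \<Longrightarrow> e = e'"
  by (cases e; cases e') (auto simp: doubleton_eq_iff)

lemma sum_verts: "(\<Sum>v\<in>verts Q. f v) = f VA + (f VB + (\<Sum>k=1..l - 2. f (VC k)))" for f :: "dvertex \<Rightarrow> 'b::comm_monoid_add"
proof -
  have "(\<Sum>v\<in>VC ` {1..l - 2}. f v) = (\<Sum>k=1..l - 2. f (VC k))"
    by (subst sum.reindex) (auto simp: inj_on_def)
  then show ?thesis unfolding verts Un_insert_left
    by (subst sum.insert, simp, force, subst sum.insert, simp, force, simp)
qed

lemma sum_arcs:
  fixes g :: "dvertex \<Rightarrow> dvertex \<Rightarrow> 'b::comm_monoid_add"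
  assumes sym: "\<And>u w. g u w = g w u"
  shows "(\<Sum>e\<in>arcs Q. g (tail Q e) (head Q e)) =
    g VA (VC 1) + (g VB (VC 1) + (\<Sum>k=1..l - 3. g (VC k) (VC (k + 1))))"
proof -
  define h where "h e = (case e of Alpha \<Rightarrow> g VA (VC 1) | Beta \<Rightarrow> g VB (VC 1) | Gamma k \<Rightarrow> g (VC k) (VC (k + 1)))" for e
  have "g (tail Q e) (head Q e) = h e" if "e \<in> arcs Q" for e
    using ends[OF that] sym by (cases e) (auto simp: h_def doubleton_eq_iff)
  then have "(\<Sum>e\<in>arcs Q. g (tail Q e) (head Q e)) = (\<Sum>e\<in>arcs Q. h e)" by simp
  moreover have "(\<Sum>e\<in>Gamma ` {1..l - 3}. h e) = (\<Sum>k=1..l - 3. h (Gamma k))"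
    by (subst sum.reindex) (auto simp: inj_on_def)
  ultimately show ?thesis unfolding arcs Un_insert_left
    by (simp add: h_def image_iff)
qed

lemma sum_chain_arcs:
  fixes c :: "nat \<Rightarrow> 'b::comm_monoid_add"
  assumes "c (l - 2) = 0"
  shows "(\<Sum>k=1..l - 3. c k) = (\<Sum>k=1..l - 2. c k)"
proof -
  have "{1..l - 2} = insert (l - 2) {1..l - 3}" using l by auto
  moreover have "l - 2 \<notin> {1..l - 3}" using l by auto
  ultimately show ?thesis using assms by simp
qed

text \<open>
  The entries at \<open>VA\<close> and \<open>VB\<close> each complete a square; together these use up half of the square of
  the entry at \<open>VC 1\<close>, and the rest is half of the sum of the squared steps of the chain.  The vertex
  beyond the end of the chain carries the value 0, so the last summand is the square of the last
  entry.
\<close>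

lemma tits_form_squares:
  assumes "\<And>v. v \<notin> verts Q \<Longrightarrow> d v = 0"
  shows "4 * tits_form Q d =
    (2 * int (d VA) - int (d (VC 1)))\<^sup>2 + (2 * int (d VB) - int (d (VC 1)))\<^sup>2
     + 2 * (\<Sum>k=1..l - 2. (int (d (VC k)) - int (d (VC (k + 1))))\<^sup>2)"
proof -
  define z where "z k = int (d (VC k))" for k
  have z0: "z (l - 2 + 1) = 0" using l by (simp add: z_def assms verts image_iff)
  have 1: "(\<Sum>v\<in>verts Q. (int (d v))\<^sup>2) = (int (d VA))\<^sup>2 + ((int (d VB))\<^sup>2 + (\<Sum>k=1..l - 2. (z k)\<^sup>2))"
    unfolding sum_verts z_def ..
  have "(\<Sum>e\<in>arcs Q. int (d (tail Q e)) * int (d (head Q e))) =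
      int (d VA) * z 1 + (int (d VB) * z 1 + (\<Sum>k=1..l - 3. z k * z (k + 1)))"
    unfolding z_def by (rule sum_arcs) simp
  also have "(\<Sum>k=1..l - 3. z k * z (k + 1)) = (\<Sum>k=1..l - 2. z k * z (k + 1))"
    using z0 by (intro sum_chain_arcs) simp
  finally have 2: "(\<Sum>e\<in>arcs Q. int (d (tail Q e)) * int (d (head Q e))) =
      int (d VA) * z 1 + (int (d VB) * z 1 + (\<Sum>k=1..l - 2. z k * z (k + 1)))" .
  show ?thesis using chain_squares[of z "l - 2"] z0
    unfolding tits_form_def 1 2 by (simp add: z_def[symmetric] power2_eq_square algebra_simps)
qed

text \<open>
  The sum \<open>S\<close> of the squared steps \<open>\<delta>\<close> along the chain is at most 2, and it bounds all entries of the
  chain because the chain ends in 0.  For \<open>S = 2\<close> the other two squares vanish, so \<open>z 1\<close> is 0 or 2.  In the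
  first case the chain rises once and falls once, in the second it falls twice, at \<open>i < j\<close>, which
  is the twin root.
\<close>

lemma root_cases:
  assumes d: "d \<in> pos_roots Q"
  shows "(\<forall>v. d v \<le> 1) \<or> d \<in> twin_roots l"
proof -
  have off: "d v = 0" if "v \<notin> verts Q" for v using d that by (auto simp: pos_roots_def)
  define z where "z k = int (d (VC k))" for k
  define \<delta> where "\<delta> k = z k - z (k + 1)" for k
  define m where "m = l - 2"
  define S where "S = (\<Sum>k=1..m. (\<delta> k)\<^sup>2)"
  define a b where "a = 2 * int (d VA) - z 1" and "b = 2 * int (d VB) - z 1"
  have z_off: "z k = 0" if "k = 0 \<or> m < k" for k using that by (auto simp: z_def m_def off verts image_iff)
  have eq: "a\<^sup>2 + b\<^sup>2 + 2 * S = 4"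
    using tits_form_squares[of d] off d by (simp add: a_def b_def S_def \<delta>_def z_def m_def pos_roots_def)
  have S0: "S \<ge> 0" unfolding S_def by (simp add: sum_nonneg)
  have z_tail: "z k = (\<Sum>j=k..m. \<delta> j)" if "k \<le> m + 1" for k
    using telescope[OF that, of z] z_off[of "m + 1"] by (simp add: \<delta>_def)
  have z_S: "z k \<le> S" for k
  proof (cases "k = 0 \<or> m < k")
    case True then show ?thesis using S0 by (simp add: z_off)
  next
    case False
    then have "z k \<le> (\<Sum>j=k..m. (\<delta> j)\<^sup>2)" using z_tail[of k] le_square by (auto intro!: sum_mono)
    also have "\<dots> \<le> S" unfolding S_def using False by (intro sum_mono2) auto
    finally show ?thesis .
  qed
  have a4: "a\<^sup>2 \<le> 4 - 2 * S" "b\<^sup>2 \<le> 4 - 2 * S" using eq zero_le_power2[of a] zero_le_power2[of b] by linarith+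
  then have "S \<le> 2" using zero_le_power2[of a] by linarith
  then consider "S = 0" | "S = 1" | "S = 2" using S0 by linarith
  then show ?thesis
  proof cases
    case 1
    then have "d (VC k) = 0" for k using z_S[of k] by (simp add: z_def)
    moreover have "d VA \<le> 1" "d VB \<le> 1"
      using a4 1 int_square_le_4[of a] int_square_le_4[of b] z_S[of 1] by (auto simp: a_def b_def z_def)
    ultimately have "d v \<le> 1" for v by (cases v) auto
    then show ?thesis by blast
  next
    case 2
    have "d (VC k) \<le> 1" for k using z_S[of k] 2 by (simp add: z_def)
    moreover have "d VA \<le> 1" "d VB \<le> 1"
      using a4 2 int_square_le_2[of a] int_square_le_2[of b] z_S[of 1] by (auto simp: a_def b_def z_def)
    ultimately have "d v \<le> 1" for v by (cases v) auto
    then show ?thesis by blast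
  next
    case 3
    then have ab: "a = 0" "b = 0" using a4 by auto
    show ?thesis
    proof (cases "z 1 = 0")
      case True
      have "z k \<le> 1" for k
      proof (cases "k = 0 \<or> m < k")
        case True then show ?thesis by (simp add: z_off)
      next
        case False
        have 1: "z k \<le> (\<Sum>j=k..m. (\<delta> j)\<^sup>2)" using False z_tail[of k] le_square by (auto intro!: sum_mono)
        \<comment> \<open>The steps up to \<open>k\<close> and those from \<open>k\<close> on both add up to \<open>z k\<close> in absolute value and
          share the budget \<open>S = 2\<close>.\<close>
        have "{1..m} = {1..<k} \<union> {k..m}" using False by auto
        then have U: "(\<Sum>j=1..m. f j) = (\<Sum>j=1..<k. f j) + (\<Sum>j=k..m. f j)" for f :: "nat \<Rightarrow> int"
          by (simp only:) (rule sum.union_disjoint, auto)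
        have "0 = (\<Sum>j=1..m. \<delta> j)" using z_tail[of 1] True by simp
        then have "z k = (\<Sum>j=1..<k. - \<delta> j)" using U[of \<delta>] z_tail[of k] False by (simp add: sum_negf)
        also have "\<dots> \<le> (\<Sum>j=1..<k. (\<delta> j)\<^sup>2)" using le_square[of "- \<delta> _"] by (intro sum_mono) simp
        finally have "2 * z k \<le> S" using 1 U[of "\<lambda>j. (\<delta> j)\<^sup>2"] by (simp add: S_def)
        then show ?thesis using 3 by simp
      qed
      then have "d (VC k) \<le> 1" for k unfolding z_def by simp
      moreover have "d VA \<le> 1" "d VB \<le> 1" using ab True by (auto simp: a_def b_def)
      ultimately have "d v \<le> 1" for v by (cases v) auto
      then show ?thesis by blast
    next
      case False
      have "z 1 \<le> 2" "z 1 \<ge> 0" "z 1 = 2 * int (d VA)" using z_S[of 1] 3 ab by (auto simp: a_def z_def)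
      then have z1: "z 1 = 2" and dA: "d VA = 1" and dB: "d VB = 1" using False ab by (auto simp: b_def)
      have sum2: "(\<Sum>j=1..m. \<delta> j) = 2" using z_tail[of 1] z1 by simp
      \<comment> \<open>The steps and their squares have the same sum, so all steps are 0 or 1.\<close>
      have "(\<Sum>j=1..m. (\<delta> j)\<^sup>2 - \<delta> j) = 0" using 3 sum2 by (simp add: sum_subtractf S_def)
      then have "\<forall>j\<in>{1..m}. (\<delta> j)\<^sup>2 - \<delta> j = 0"
        using le_square by (subst (asm) sum_nonneg_eq_0_iff) auto
      then have \<delta>01: "\<delta> j = 0 \<or> \<delta> j = 1" if "j \<in> {1..m}" for j
        using that by (auto simp: power2_eq_square)
      define K where "K = {j\<in>{1..m}. \<delta> j = 1}"
      have \<delta>K: "(\<Sum>j\<in>J. \<delta> j) = int (card (J \<inter> K))" if "J \<subseteq> {1..m}" for J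
      proof -
        have fin: "finite J" using that finite_subset by blast
        have "(\<Sum>j\<in>J. \<delta> j) = (\<Sum>j\<in>J. if j \<in> K then 1 else 0)"
        proof (rule sum.cong)
          fix j assume "j \<in> J"
          then have "j \<in> {1..m}" using that by blast
          then show "\<delta> j = (if j \<in> K then 1 else 0)" using \<delta>01[of j] by (auto simp: K_def)
        qed simp
        also have "\<dots> = int (card (J \<inter> K))" using fin by (simp add: sum.If_cases)
        finally show ?thesis .
      qed
      have "{1..m} \<inter> K = K" by (auto simp: K_def)
      then have "card K = 2" using \<delta>K[of "{1..m}"] sum2 by simp
      then obtain i j where ij: "K = {i, j}" "i < j"
        by (metis card_2_iff insert_commute linorder_neqE_nat)
      then have range: "1 \<le> i" "j \<le> m" unfolding K_def by auto
      have "z k = (if k \<le> i then 1 else 0) + (if k \<le> j then 1 else 0)" if "1 \<le> k" "k \<le> m" for k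
      proof -
        have "z k = int (card ({k..m} \<inter> K))" using z_tail[of k] \<delta>K[of "{k..m}"] that by simp
        also have "{k..m} \<inter> K = (if k \<le> i then {i} else {}) \<union> (if k \<le> j then {j} else {})"
          using ij range by auto
        also have "int (card \<dots>) = (if k \<le> i then 1 else 0) + (if k \<le> j then 1 else 0)" using ij by auto
        finally show ?thesis .
      qed
      then have "int (d (VC k)) = int (twin_root i j (VC k))" if "1 \<le> k" "k \<le> m" for k
        using that unfolding twin_root_simps by (simp add: z_def)
      then have dC: "d (VC k) = twin_root i j (VC k)" if "1 \<le> k" "k \<le> m" for k
        using that of_nat_eq_iff by blast
      have "d v = twin_root i j v" for v
      proof (cases v)
        case (VC k)
        show ?thesis
        proof (cases "1 \<le> k \<and> k \<le> m")
          case True then show ?thesis using dC VC by blast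
        next
          case F: False
          then have "k = 0 \<or> m < k" by auto
          then have "d (VC k) = 0" using z_off[of k] by (simp add: z_def)
          moreover have "twin_root i j (VC k) = 0" using F range ij unfolding twin_root_simps by auto
          ultimately show ?thesis using VC by simp
        qed
      qed (simp_all add: dA dB twin_root_simps)
      then have "d = twin_root i j" by (rule ext)
      then have "d \<in> twin_roots l" unfolding twin_roots_def m_def[symmetric] using ij range by blast
      then show ?thesis ..
    qed
  qed
qed

lemma twin_root_in_pos_roots:
  assumes "1 \<le> i" "i < j" "j \<le> l - 2"
  shows "twin_root i j \<in> pos_roots Q"
proof -
  let ?d = "twin_root i j"
  have off: "?d v = 0" if "v \<notin> verts Q" for v
    using that assms by (cases v) (auto simp: verts twin_root_simps image_iff)
  have "(\<Sum>k=1..l - 2. (int (?d (VC k)) - int (?d (VC (k + 1))))\<^sup>2) = (\<Sum>k=1..l - 2. (if k = i then 1 else 0) + (if k = j then 1 else 0))"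
    using assms by (intro sum.cong) (auto simp: twin_root_simps)
  also have "\<dots> = 2" using assms by (simp add: sum.distrib)
  finally have "4 * tits_form Q ?d = 4"
    using assms by (subst tits_form_squares) (auto simp: off twin_root_simps)
  moreover have "?d \<noteq> (\<lambda>_. 0)" using twin_root_simps(1)[of i j] by (metis zero_neq_one)
  ultimately show ?thesis using off by (simp add: pos_roots_def)
qed

lemma finite_pos_roots: "finite (pos_roots Q)"
proof (rule finite_subset)
  have le: "d v \<le> 2" if "d \<in> pos_roots Q" for d v
    using root_cases[OF that]
  proof
    assume "d \<in> twin_roots l"
    then show ?thesis by (cases v) (auto simp: twin_roots_def twin_root_simps)
  qed (simp add: le_SucI numeral_2_eq_2)
  show "pos_roots Q \<subseteq> {d. \<forall>v. (v \<in> verts Q \<longrightarrow> d v \<in> {..2}) \<and> (v \<notin> verts Q \<longrightarrow> d v = 0)}"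
    using le by (auto simp: pos_roots_def)
  show "finite {d. \<forall>v. (v \<in> verts Q \<longrightarrow> d v \<in> {..2::nat}) \<and> (v \<notin> verts Q \<longrightarrow> d v = 0)}"
    by (rule finite_set_of_finite_funs) (auto simp: verts)
qed

lemma twin_roots_subset: "twin_roots l \<subseteq> pos_roots Q"
  using twin_root_in_pos_roots by (auto simp: twin_roots_def)

text \<open>
  For entries 0 and 1 the left-hand side is the Tits form.  For a twin root the entries decrease along
  the chain, so the minima over the arrows of the chain are the entries with the first one left out.
\<close>

lemma root_defect:
  assumes d: "d \<in> pos_roots Q"
  shows "(\<Sum>v\<in>verts Q. int (d v)) - (\<Sum>e\<in>arcs Q. int (min (d (tail Q e)) (d (head Q e)))) =
    1 + (if d \<in> twin_roots l then 1 else 0)"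
proof (cases "d \<in> twin_roots l")
  case False
  then have le: "d v \<le> 1" for v using root_cases[OF d] by blast
  then have d01: "d v = 0 \<or> d v = 1" for v by (metis le_Suc_eq One_nat_def le_zero_eq)
  have "int (d v) = (int (d v))\<^sup>2" for v using d01[of v] by auto
  moreover have "int (min (d u) (d v)) = int (d u) * int (d v)" for u v using d01[of u] d01[of v] by auto
  ultimately have "(\<Sum>v\<in>verts Q. int (d v)) - (\<Sum>e\<in>arcs Q. int (min (d (tail Q e)) (d (head Q e)))) = tits_form Q d"
    unfolding tits_form_def by presburger
  then show ?thesis using d False by (simp add: pos_roots_def)
next
  case True
  then obtain i j where ij: "1 \<le> i" "i < j" "j \<le> l - 2" and d': "d = twin_root i j"
    by (auto simp: twin_roots_def)
  define z where "z k = int (twin_root i j (VC k))" for k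
  have z: "z k = (if k \<le> i then 1 else 0) + (if k \<le> j then 1 else 0)" if "1 \<le> k" for k
    using that by (simp add: z_def twin_root_simps)
  have ind: "(\<Sum>k=1..m. if k \<le> i then 1 else 0) = (int i)" if "i \<le> m" for i m
  proof -
    have "(\<Sum>k=1..m. if k \<le> i then 1 else 0) = (\<Sum>k=1..i. 1::int)"
      using that by (intro sum.mono_neutral_cong_right) auto
    then show ?thesis by simp
  qed
  have zsum: "(\<Sum>k=1..l - 2. z k) = int i + int j"
  proof -
    have "(\<Sum>k=1..l - 2. z k) = (\<Sum>k=1..l - 2. (if k \<le> i then 1 else 0) + (if k \<le> j then 1 else 0))"
      using z by (intro sum.cong) auto
    then show ?thesis using ij ind[of i "l - 2"] ind[of j "l - 2"] by (simp add: sum.distrib)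
  qed
  have "(\<Sum>e\<in>arcs Q. int (min (d (tail Q e)) (d (head Q e)))) =
    int (min (d VA) (d (VC 1))) + (int (min (d VB) (d (VC 1))) + (\<Sum>k=1..l - 3. int (min (d (VC k)) (d (VC (k + 1))))))"
    by (rule sum_arcs) (simp add: min.commute)
  also have "(\<Sum>k=1..l - 3. int (min (d (VC k)) (d (VC (k + 1))))) = (\<Sum>k=1..l - 3. z (Suc k))"
    unfolding d' by (intro sum.cong) (auto simp: z_def twin_root_simps)
  also have "\<dots> = (\<Sum>k=2..l - 2. z k)"
  proof -
    have "Suc (l - 3) = l - 2" using l by simp
    then show ?thesis using sum.shift_bounds_cl_Suc_ivl[of z 1 "l - 3"] by (simp only: Suc_1)
  qed
  also have "\<dots> = int i + int j - 2"
  proof -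
    have "(\<Sum>k=1..l - 2. z k) = z 1 + (\<Sum>k=2..l - 2. z k)"
      using l by (subst sum.atLeast_Suc_atMost) (auto simp: numeral_2_eq_2)
    then show ?thesis using zsum z[of 1] ij by simp
  qed
  finally have arcs_sum: "(\<Sum>e\<in>arcs Q. int (min (d (tail Q e)) (d (head Q e)))) = int i + int j"
    using ij by (simp add: d' twin_root_simps)
  have "(\<Sum>v\<in>verts Q. int (d v)) = 2 + (int i + int j)"
    unfolding sum_verts zsum[symmetric] by (simp add: d' z_def twin_root_simps(1,2))
  then show ?thesis using arcs_sum True by simp
qed

definition arc_root :: "darrow \<Rightarrow> dvertex \<Rightarrow> nat" where
  "arc_root e = (\<lambda>v. std_basis (tail Q e) v + std_basis (head Q e) v)"

lemma arc_root_value: "e \<in> arcs Q \<Longrightarrow> arc_root e v = (if v \<in> D_ends e then 1 else 0)"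
  using ends[of e] tail_neq_head[of e] by (auto simp: arc_root_def std_basis_def)

lemma arc_root_inj: "inj_on arc_root (arcs Q)"
proof
  fix e e' assume e: "e \<in> arcs Q" "e' \<in> arcs Q" and eq: "arc_root e = arc_root e'"
  have "v \<in> D_ends e \<longleftrightarrow> v \<in> D_ends e'" for v
    using fun_cong[OF eq, of v] unfolding arc_root_value[OF e(1)] arc_root_value[OF e(2)]
    by (simp split: if_splits)
  then show "e = e'" by (intro D_ends_inject) blast
qed

lemma D_ends_verts: "e \<in> arcs Q \<Longrightarrow> D_ends e \<subseteq> verts Q"
  using head_in_verts[of e] tail_in_verts[of e] by (simp add: ends[symmetric])

lemma card_D_ends: "card (D_ends e) = 2"
  by (cases e) auto

text \<open>
  A root of length 2 has a positive product at some arrow, since its squares add up to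
  more than the value 1 of the Tits form; the two ends of this arrow exhaust the length.
\<close>

lemma roots_of_length_2: "{d \<in> pos_roots Q. dv_length Q d = 2} = arc_root ` arcs Q"
proof (intro equalityI subsetI)
  fix d assume "d \<in> arc_root ` arcs Q"
  then obtain e where e: "e \<in> arcs Q" and d: "d = arc_root e" by blast
  have val: "d v = (if v \<in> D_ends e then 1 else 0)" for v unfolding d by (rule arc_root_value[OF e])
  have fin: "finite (verts Q)" by simp
  have len: "(\<Sum>v\<in>verts Q. d v) = 2"
    using D_ends_verts[OF e] card_D_ends[of e] fin
    by (simp add: val sum.If_cases Int_absorb1)
  have "(\<Sum>e'\<in>arcs Q. int (d (tail Q e')) * int (d (head Q e'))) = (\<Sum>e'\<in>arcs Q. if e' = e then 1 else 0)"
  proof (rule sum.cong)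
    fix e' assume e': "e' \<in> arcs Q"
    have "e' = e" if "tail Q e' \<in> D_ends e" "head Q e' \<in> D_ends e"
    proof -
      have "D_ends e' \<subseteq> D_ends e" unfolding ends[OF e', symmetric] using that by simp
      then have "D_ends e' = D_ends e" using card_D_ends[of e] card_D_ends[of e']
        by (metis card.infinite card_subset_eq zero_neq_numeral)
      then show ?thesis by (rule D_ends_inject)
    qed
    moreover have "tail Q e \<in> D_ends e" "head Q e \<in> D_ends e" using ends[OF e] by auto
    ultimately show "int (d (tail Q e')) * int (d (head Q e')) = (if e' = e then 1 else 0)"
      by (auto simp: val)
  qed simp
  then have arcs1: "(\<Sum>e'\<in>arcs Q. int (d (tail Q e')) * int (d (head Q e'))) = 1" using e by simp
  have "(\<Sum>v\<in>verts Q. (int (d v))\<^sup>2) = (\<Sum>v\<in>verts Q. int (d v))" by (intro sum.cong) (auto simp: val)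
  then have "tits_form Q d = 1" using len arcs1 unfolding tits_form_def by (simp flip: of_nat_sum)
  moreover have "d v = 0" if "v \<notin> verts Q" for v using that val D_ends_verts[OF e] by auto
  moreover have "d \<noteq> (\<lambda>_. 0)" using len by auto
  ultimately show "d \<in> {d \<in> pos_roots Q. dv_length Q d = 2}" using len by (simp add: pos_roots_def dv_length_def)
next
  fix d assume "d \<in> {d \<in> pos_roots Q. dv_length Q d = 2}"
  then have off: "\<And>v. v \<notin> verts Q \<Longrightarrow> d v = 0" and q: "tits_form Q d = 1" and len: "(\<Sum>v\<in>verts Q. d v) = 2"
    by (auto simp: pos_roots_def dv_length_def)
  have fin: "finite (verts Q)" by simp
  have "(\<Sum>v\<in>verts Q. int (d v)) \<le> (\<Sum>v\<in>verts Q. (int (d v))\<^sup>2)" by (intro sum_mono le_square)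
  then have "(\<Sum>e\<in>arcs Q. int (d (tail Q e)) * int (d (head Q e))) \<noteq> 0"
    using q len unfolding tits_form_def by (simp flip: of_nat_sum)
  then obtain e where e: "e \<in> arcs Q" and "int (d (tail Q e)) * int (d (head Q e)) \<noteq> 0"
    by (elim sum.not_neutral_contains_not_neutral)
  then have pos: "d (tail Q e) \<ge> 1" "d (head Q e) \<ge> 1" by auto
  note v = tail_in_verts[OF e] head_in_verts[OF e]
  let ?R = "verts Q - {tail Q e} - {head Q e}"
  have "(\<Sum>v\<in>verts Q. d v) = d (tail Q e) + (d (head Q e) + (\<Sum>v\<in>?R. d v))"
    using v tail_neq_head[OF e] fin by (simp add: sum.remove)
  then have 1: "d (tail Q e) = 1" "d (head Q e) = 1" and "(\<Sum>v\<in>?R. d v) = 0" using pos len by linarith+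
  then have 0: "\<forall>v\<in>?R. d v = 0" using fin by simp
  have "d v = arc_root e v" for v
    using 1 0 off[of v] unfolding arc_root_value[OF e, of v] ends[OF e, symmetric] by auto
  then show "d \<in> arc_root ` arcs Q" using e by (intro image_eqI[of _ _ e]) auto
qed

lemma dv_min_arc_root:
  assumes e: "e \<in> arcs Q" and ge: "d' \<ge> arc_root e"
  shows "dv_min Q (dv_mult d' (arc_root e)) = min (d' (tail Q e)) (d' (head Q e))"
proof -
  have t: "tail Q e \<in> D_ends e" and h: "head Q e \<in> D_ends e" and E: "D_ends e = {tail Q e, head Q e}"
    by (simp_all add: ends[OF e, symmetric])
  have pos: "d' (tail Q e) > 0" "d' (head Q e) > 0"
    using le_funD[OF ge, of "tail Q e"] le_funD[OF ge, of "head Q e"] arc_root_value[OF e] t h by auto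
  have val: "dv_mult d' (arc_root e) v = (if v = tail Q e \<or> v = head Q e then d' v else 0)" for v
    by (simp add: dv_mult_def arc_root_value[OF e] E)
  have "{dv_mult d' (arc_root e) v |v. v \<in> verts Q \<and> 0 < dv_mult d' (arc_root e) v} = {d' (tail Q e), d' (head Q e)}"
  proof (intro equalityI subsetI)
    fix x assume "x \<in> {d' (tail Q e), d' (head Q e)}"
    then obtain v where "v = tail Q e \<or> v = head Q e" "x = d' v" by blast
    then show "x \<in> {dv_mult d' (arc_root e) v |v. v \<in> verts Q \<and> 0 < dv_mult d' (arc_root e) v}"
      using pos tail_in_verts[OF e] head_in_verts[OF e] by (intro CollectI exI[of _ v]) (auto simp: val)
  qed (auto simp: val split: if_splits)
  then show ?thesis by (simp add: dv_min_def)
qed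

lemma not_ge_arc_root:
  assumes e: "e \<in> arcs Q" and nge: "\<not> d' \<ge> arc_root e"
  shows "min (d' (tail Q e)) (d' (head Q e)) = 0"
proof -
  obtain v where "\<not> arc_root e v \<le> d' v" using nge by (auto simp: le_fun_def)
  then have "v \<in> D_ends e" "d' v = 0" using arc_root_value[OF e, of v] by (auto split: if_splits)
  then have "v = tail Q e \<or> v = head Q e" by (auto simp: ends[OF e, symmetric])
  then show ?thesis using \<open>d' v = 0\<close> by auto
qed

end

section \<open>Ranks of the arrows of indecomposable representations\<close>

lemma minus_zero_mat: "X \<in> carrier_mat a b \<Longrightarrow> X - 0\<^sub>m a b = (X :: 'a::field mat)"
  by (intro eq_matI) auto

text \<open>
  For \<open>\<psi> * u = 1\<close> this is the projection along the line spanned by \<open>u\<close> onto the kernel of \<open>\<psi>\<close>.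
\<close>

definition proj :: "nat \<Rightarrow> 'a::field mat \<Rightarrow> 'a mat \<Rightarrow> 'a mat" where
  "proj n u \<psi> = 1\<^sub>m n - u * \<psi>"

lemma proj_carrier: "u \<in> carrier_mat n 1 \<Longrightarrow> \<psi> \<in> carrier_mat 1 n \<Longrightarrow> proj n u \<psi> \<in> carrier_mat n n"
  unfolding proj_def by (intro minus_carrier_mat) auto

lemma proj_mult:
  assumes "u \<in> carrier_mat n 1" "\<psi> \<in> carrier_mat 1 n" "A \<in> carrier_mat n k"
  shows "proj n u \<psi> * A = A - u * (\<psi> * A)"
  unfolding proj_def using assms
  by (subst minus_mult_distrib_mat[OF one_carrier_mat _ assms(3)]) (auto simp: mat_assoc)

lemma mult_proj:
  assumes "u \<in> carrier_mat n 1" "\<psi> \<in> carrier_mat 1 n" "A \<in> carrier_mat k n"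
  shows "A * proj n u \<psi> = A - A * u * \<psi>"
  unfolding proj_def using assms
  by (subst mult_minus_distrib_mat[OF assms(3) one_carrier_mat]) (auto simp: mat_assoc)

lemma proj_idem:
  assumes c: "u \<in> carrier_mat n 1" "\<psi> \<in> carrier_mat 1 n" and 1: "\<psi> * u = 1\<^sub>m 1"
  shows "proj n u \<psi> * proj n u \<psi> = proj n u \<psi>"
proof -
  have "\<psi> * proj n u \<psi> = \<psi> - \<psi> * u * \<psi>" using c by (intro mult_proj)
  also have "\<dots> = 0\<^sub>m 1 n" unfolding 1 using c by simp
  finally show ?thesis using c proj_carrier[OF c] by (subst proj_mult[OF c]) (auto simp: minus_zero_mat)
qed

lemma left_inverse_of_col:
  fixes u :: "'a::field mat"
  assumes u: "u \<in> carrier_mat n 1" and nz: "u \<noteq> 0\<^sub>m n 1"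
  shows "\<exists>\<psi>\<in>carrier_mat 1 n. \<psi> * u = 1\<^sub>m 1"
proof -
  obtain r where r: "has_rank u r" using has_rank_exists[OF u] by blast
  then have "r \<noteq> 0" using has_rank_0D[OF _ u] nz by auto
  then have r1: "r = 1" using has_rank_le_dim(2)[OF r u] by simp
  obtain B C L R where c: "B \<in> carrier_mat n 1" "C \<in> carrier_mat 1 1" "L \<in> carrier_mat 1 n" "R \<in> carrier_mat 1 1"
    and e: "u = B * C" "L * B = 1\<^sub>m 1" "C * R = 1\<^sub>m 1"
    using has_rankE[OF r[unfolded r1] u] by metis
  have "R * C = 1\<^sub>m 1" using mat_mult_left_right_inverse[OF c(2,4) e(3)] .
  then have "(R * L) * u = 1\<^sub>m 1" unfolding e(1) using c e(2)
    by (simp add: mat_assoc left_inverse_cancel[OF e(2)])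
  then show ?thesis using c by (intro bexI[of _ "R * L"]) auto
qed

lemma square_full_rank_inverse:
  fixes A :: "'a::field mat"
  assumes A: "A \<in> carrier_mat n n" and r: "has_rank A n"
  shows "\<exists>A'\<in>carrier_mat n n. A * A' = 1\<^sub>m n \<and> A' * A = 1\<^sub>m n"
proof -
  obtain B C L R where c: "B \<in> carrier_mat n n" "C \<in> carrier_mat n n" "L \<in> carrier_mat n n" "R \<in> carrier_mat n n"
    and e: "A = B * C" "L * B = 1\<^sub>m n" "C * R = 1\<^sub>m n"
    using has_rankE[OF r A] by metis
  have BL: "B * L = 1\<^sub>m n" using mat_mult_left_right_inverse[OF c(3,1) e(2)] .
  have 1: "A * (R * L) = 1\<^sub>m n" unfolding e(1) using c BL
    by (simp add: mat_assoc left_inverse_cancel[OF e(3)])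
  have RL: "R * L \<in> carrier_mat n n" using c by simp
  show ?thesis using 1 mat_mult_left_right_inverse[OF A RL 1] RL by blast
qed

text \<open>
  Cramer's rule for the determinant \<open>D\<close> of the two columns.
\<close>

lemma dependent_or_separated:
  fixes u w :: "'a::field mat"
  assumes u: "u \<in> carrier_mat 2 1" and w: "w \<in> carrier_mat 2 1" and nz: "u \<noteq> 0\<^sub>m 2 1"
  shows "(\<exists>t\<in>carrier_mat 1 1. w = u * t) \<or> (\<exists>\<psi>\<in>carrier_mat 1 2. \<psi> * u = 1\<^sub>m 1 \<and> \<psi> * w = 0\<^sub>m 1 1)"
proof -
  define D where "D = u $$ (0,0) * w $$ (1,0) - u $$ (1,0) * w $$ (0,0)"
  have nz': "u $$ (0,0) \<noteq> 0 \<or> u $$ (1,0) \<noteq> 0"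
  proof (rule ccontr)
    assume "\<not> ?thesis"
    then have "u = 0\<^sub>m 2 1" using u by (intro eq_matI) (auto simp: less_2_cases_iff)
    then show False using nz by simp
  qed
  show ?thesis
  proof (cases "D = 0")
    case True
    define t where "t = (if u $$ (0,0) \<noteq> 0 then w $$ (0,0) / u $$ (0,0) else w $$ (1,0) / u $$ (1,0))"
    have t: "w $$ (0,0) = u $$ (0,0) * t" "w $$ (1,0) = u $$ (1,0) * t"
      using True nz' by (auto simp: t_def D_def field_simps)
    have "w = u * mat 1 1 (\<lambda>_. t)"
      using u w t by (intro eq_matI) (auto simp: scalar_prod_def less_2_cases_iff)
    then show ?thesis by (intro disjI1 bexI[of _ "mat 1 1 (\<lambda>_. t)"]) auto
  next
    case False
    define \<psi> where "\<psi> = mat 1 2 (\<lambda>(i,j). if j = 0 then w $$ (1,0) / D else - w $$ (0,0) / D)"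
    have "w $$ (1,0) / D * u $$ (0,0) + - w $$ (0,0) / D * u $$ (1,0) = D / D"
      by (simp add: D_def mult.commute flip: diff_divide_distrib)
    then have "\<psi> * u = 1\<^sub>m 1"
      using u False by (intro eq_matI) (auto simp: \<psi>_def scalar_prod_def numeral_2_eq_2)
    moreover have "\<psi> * w = 0\<^sub>m 1 1"
      using w by (intro eq_matI) (auto simp: \<psi>_def scalar_prod_def numeral_2_eq_2)
    moreover have "\<psi> \<in> carrier_mat 1 2" by (simp add: \<psi>_def)
    ultimately show ?thesis by blast
  qed
qed

lemma row_kernel_vector:
  fixes C :: "'a::field mat"
  assumes C: "C \<in> carrier_mat 1 2" and nz: "C \<noteq> 0\<^sub>m 1 2"
  shows "\<exists>u\<in>carrier_mat 2 1. u \<noteq> 0\<^sub>m 2 1 \<and> C * u = 0\<^sub>m 1 1"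
proof -
  define u where "u = mat 2 1 (\<lambda>(i,j). if i = 0 then C $$ (0,1) else - C $$ (0,0))"
  have "C * u = 0\<^sub>m 1 1"
    using C by (auto intro!: eq_matI simp: u_def scalar_prod_def numeral_2_eq_2 mult.commute)
  moreover have "u \<noteq> 0\<^sub>m 2 1"
  proof
    assume u0: "u = 0\<^sub>m 2 1"
    have "C $$ (0,1) = u $$ (0,0)" "C $$ (0,0) = - u $$ (1,0)" by (auto simp: u_def)
    then have "C $$ (0,1) = 0" "C $$ (0,0) = 0" unfolding u0 by auto
    then have "C = 0\<^sub>m 1 2" using C by (intro eq_matI) (auto simp: less_2_cases_iff)
    then show False using nz by simp
  qed
  ultimately show ?thesis by (intro bexI[of _ u]) (auto simp: u_def)
qed

context type_D
begin

text \<open>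
  The component not containing the vertex \<open>VC 1\<close> after removing \<open>Alpha\<close> or \<open>Beta\<close>, or the one containing
  \<open>VC (k + 1)\<close> after removing \<open>Gamma k\<close>.
\<close>

definition arc_side :: "darrow \<Rightarrow> dvertex set" where
  "arc_side e = (case e of Alpha \<Rightarrow> {VA} | Beta \<Rightarrow> {VB} | Gamma k \<Rightarrow> VC ` {k<..})"

lemma arc_side_separates:
  assumes "e \<in> arcs Q" shows "tail Q e \<in> arc_side e \<longleftrightarrow> head Q e \<notin> arc_side e"
  using ends[OF assms] by (cases e) (auto simp: arc_side_def doubleton_eq_iff)

lemma arc_side_other:
  assumes e: "e \<in> arcs Q" and e': "e' \<in> arcs Q" and "e' \<noteq> e"
  shows "tail Q e' \<in> arc_side e \<longleftrightarrow> head Q e' \<in> arc_side e"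
proof -
  have "u \<in> arc_side e \<longleftrightarrow> w \<in> arc_side e" if "u \<in> D_ends e'" "w \<in> D_ends e'" for u w
    using that assms by (cases e; cases e') (auto simp: arc_side_def arcs)
  then show ?thesis by (simp add: ends[OF e', symmetric])
qed

text \<open>
  If the arrow is zero, the identity on one side of the arrow and zero on the other form an
  endomorphism, which is a nontrivial idempotent.
\<close>

lemma arc_nonzero:
  fixes N :: "(dvertex, darrow, 'k::field) quiver_rep"
  assumes ind: "indecomposable Q N" and e: "e \<in> arcs Q"
    and nz: "vdim N (tail Q e) \<noteq> 0" "vdim N (head Q e) \<noteq> 0"
  shows "vmap N e \<noteq> 0\<^sub>m (vdim N (head Q e)) (vdim N (tail Q e))"
proof
  assume 0: "vmap N e = 0\<^sub>m (vdim N (head Q e)) (vdim N (tail Q e))"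
  have r: "is_rep Q N" using ind by (simp add: indecomposable_def)
  define P where "P v = (if v \<in> arc_side e then 1\<^sub>m (vdim N v) else 0\<^sub>m (vdim N v) (vdim N v) :: 'k mat)" for v
  have "rep_hom Q N N P" unfolding rep_hom_def
  proof (intro conjI ballI)
    fix e' assume e': "e' \<in> arcs Q"
    show "P (head Q e') * vmap N e' = vmap N e' * P (tail Q e')"
    proof (cases "e' = e")
      case True
      then show ?thesis by (simp add: P_def 0)
    next
      case False
      then show ?thesis using arc_side_other[OF e e' False] is_repD[OF r e'] by (simp add: P_def)
    qed
  qed (simp add: P_def)
  moreover have "P v * P v = P v" for v by (simp add: P_def)
  ultimately have "(\<forall>v\<in>verts Q. P v = 0\<^sub>m (vdim N v) (vdim N v)) \<or> (\<forall>v\<in>verts Q. P v = 1\<^sub>m (vdim N v))"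
    by (intro indecomposable_idempotent_trivial[OF ind])
  then show False
  proof
    assume z: "\<forall>v\<in>verts Q. P v = 0\<^sub>m (vdim N v) (vdim N v)"
    have "vdim N v = 0" if v: "v \<in> verts Q" "v \<in> arc_side e" for v
    proof -
      have P: "P v = 1\<^sub>m (vdim N v)" using v(2) by (simp add: P_def)
      show ?thesis by (rule one_mat_eq_zero) (rule trans[OF P[symmetric] bspec[OF z v(1)]])
    qed
    from this[OF tail_in_verts[OF e]] this[OF head_in_verts[OF e]] show False
      using nz arc_side_separates[OF e] by argo
  next
    assume z: "\<forall>v\<in>verts Q. P v = 1\<^sub>m (vdim N v)"
    have "vdim N v = 0" if v: "v \<in> verts Q" "v \<notin> arc_side e" for v
    proof -
      have P: "P v = 0\<^sub>m (vdim N v) (vdim N v)" using v(2) by (simp add: P_def)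
      show ?thesis by (rule one_mat_eq_zero) (rule trans[OF bspec[OF z v(1), symmetric] P])
    qed
    from this[OF tail_in_verts[OF e]] this[OF head_in_verts[OF e]] show False
      using nz arc_side_separates[OF e] by argo
  qed
qed

text \<open>
  The part of \<open>N\<close> from \<open>VC m\<close> on, with a line in its first space distinguished, decomposes: there is
  an idempotent endomorphism of this part which is at \<open>VC m\<close> a projection along the line spanned by
  \<open>u\<close>.
\<close>

definition adapted :: "(dvertex, darrow, 'k::field) quiver_rep \<Rightarrow> nat \<Rightarrow> 'k mat \<Rightarrow> bool" where
  "adapted N m u \<longleftrightarrow> (\<exists>\<psi> P. \<psi> \<in> carrier_mat 1 2 \<and> \<psi> * u = 1\<^sub>m 1 \<and> P (VC m) = proj 2 u \<psi> \<and>
     (\<forall>k\<in>{m..l - 2}. P (VC k) \<in> carrier_mat (vdim N (VC k)) (vdim N (VC k)) \<and> P (VC k) * P (VC k) = P (VC k)) \<and>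
     (\<forall>k\<in>{m..l - 3}. P (head Q (Gamma k)) * vmap N (Gamma k) = vmap N (Gamma k) * P (tail Q (Gamma k))))"

lemma Gamma_cases:
  assumes "k \<in> {1..l - 3}"
  obtains (forward) "tail Q (Gamma k) = VC k" "head Q (Gamma k) = VC (k + 1)"
    | (backward) "tail Q (Gamma k) = VC (k + 1)" "head Q (Gamma k) = VC k"
  using ends_cases[of "Gamma k" "VC k" "VC (k + 1)"] assms by (auto simp: arcs)

lemma Gamma_arc: "k \<in> {1..l - 3} \<Longrightarrow> Gamma k \<in> arcs Q"
  by (auto simp: arcs)

text \<open>
  At the last two-dimensional space the arrow to the one-dimensional neighbour singles out at most one
  more line, the kernel or the image of \<open>\<gamma>\<close>.  The projection can be chosen so that it fixes or
  annihilates this line, and beyond \<open>VC i\<close> the endomorphism is 1 or 0 accordingly (parameter \<open>b\<close>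
  below).
\<close>

lemma adapted_base:
  fixes N :: "(dvertex, darrow, 'k::field) quiver_rep"
  assumes r: "is_rep Q N" and i: "i \<in> {1..l - 3}"
    and d: "vdim N (VC i) = 2" "vdim N (VC (i + 1)) = 1"
    and u: "u \<in> carrier_mat 2 1" "u \<noteq> 0\<^sub>m 2 1"
  shows "adapted N i u"
proof -
  define \<gamma> where "\<gamma> = vmap N (Gamma i)"
  define P where "P b \<psi> v = (if v = VC i then proj 2 u \<psi> else if b then 1\<^sub>m (vdim N v) else 0\<^sub>m (vdim N v) (vdim N v))"
    for b \<psi> v
  have main: "adapted N i u" if \<psi>: "\<psi> \<in> carrier_mat 1 2" "\<psi> * u = 1\<^sub>m 1"
    and comm: "P b \<psi> (head Q (Gamma i)) * \<gamma> = \<gamma> * P b \<psi> (tail Q (Gamma i))" for b \<psi>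
    unfolding adapted_def
  proof (intro exI conjI ballI)
    show "P b \<psi> (VC i) = proj 2 u \<psi>" by (simp add: P_def)
    fix k
    show "P b \<psi> (VC k) \<in> carrier_mat (vdim N (VC k)) (vdim N (VC k))"
      using proj_carrier[OF u(1) \<psi>(1)] d by (auto simp: P_def)
    show "P b \<psi> (VC k) * P b \<psi> (VC k) = P b \<psi> (VC k)"
      using proj_idem[OF u(1) \<psi>] by (auto simp: P_def)
    assume k: "k \<in> {i..l - 3}"
    show "P b \<psi> (head Q (Gamma k)) * vmap N (Gamma k) = vmap N (Gamma k) * P b \<psi> (tail Q (Gamma k))"
    proof (cases "k = i")
      case True
      then show ?thesis using comm by (simp add: \<gamma>_def)
    next
      case False
      have k': "k \<in> {1..l - 3}" using k i by auto
      have g: "vmap N (Gamma k) \<in> carrier_mat (vdim N (head Q (Gamma k))) (vdim N (tail Q (Gamma k)))"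
        by (rule is_repD[OF r Gamma_arc[OF k']])
      have "head Q (Gamma k) \<noteq> VC i" "tail Q (Gamma k) \<noteq> VC i"
        using k False by (cases rule: Gamma_cases[OF k'], auto)+
      then show ?thesis using g by (simp add: P_def)
    qed
  qed (use \<psi> in auto)
  have \<gamma>: "\<gamma> \<in> carrier_mat (vdim N (head Q (Gamma i))) (vdim N (tail Q (Gamma i)))"
    unfolding \<gamma>_def by (rule is_repD[OF r Gamma_arc[OF i]])
  from i show ?thesis
  proof (cases rule: Gamma_cases)
    case forward
    have g: "\<gamma> \<in> carrier_mat 1 2" using \<gamma> d forward by simp
    show ?thesis
    proof (cases "\<gamma> * u = 0\<^sub>m 1 1")
      case True
      obtain \<psi> where \<psi>: "\<psi> \<in> carrier_mat 1 2" "\<psi> * u = 1\<^sub>m 1" using left_inverse_of_col[OF u] by blast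
      have "\<gamma> * proj 2 u \<psi> = \<gamma>" unfolding mult_proj[OF u(1) \<psi>(1) g] True using \<psi> g by (simp add: minus_zero_mat)
      then show ?thesis using g d by (intro main[OF \<psi>, of True]) (simp add: P_def forward)
    next
      case False
      obtain s where s: "s \<in> carrier_mat 1 1" "s * (\<gamma> * u) = 1\<^sub>m 1"
        using left_inverse_of_col[OF _ False] g u by (metis mult_carrier_mat)
      have gu: "\<gamma> * u \<in> carrier_mat 1 1" using g u by simp
      have \<psi>: "s * \<gamma> \<in> carrier_mat 1 2" "s * \<gamma> * u = 1\<^sub>m 1" using s g u by (auto simp: mat_assoc)
      have "(\<gamma> * u) * s = 1\<^sub>m 1" by (rule mat_mult_left_right_inverse[OF s(1) gu s(2)])
      then have "\<gamma> * u * (s * \<gamma>) = \<gamma>" using s(1) g u gu left_inverse_cancel[of "\<gamma> * u" s 1 \<gamma>] by simp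
      then have "\<gamma> * proj 2 u (s * \<gamma>) = 0\<^sub>m 1 2" unfolding mult_proj[OF u(1) \<psi>(1) g] using g by simp
      then show ?thesis using g d by (intro main[OF \<psi>, of False]) (simp add: P_def forward)
    qed
  next
    case backward
    have g: "\<gamma> \<in> carrier_mat 2 1" using \<gamma> d backward by simp
    from dependent_or_separated[OF u(1) g u(2)] show ?thesis
    proof
      assume "\<exists>t\<in>carrier_mat 1 1. \<gamma> = u * t"
      then obtain t where t: "t \<in> carrier_mat 1 1" "\<gamma> = u * t" by blast
      obtain \<psi> where \<psi>: "\<psi> \<in> carrier_mat 1 2" "\<psi> * u = 1\<^sub>m 1" using left_inverse_of_col[OF u] by blast
      have "\<psi> * \<gamma> = t" unfolding t(2) using left_inverse_cancel[OF \<psi>(2), of t] \<psi> u t by simp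
      then have "proj 2 u \<psi> * \<gamma> = 0\<^sub>m 2 1" unfolding proj_mult[OF u(1) \<psi>(1) g] t(2)[symmetric] using t g by simp
      then show ?thesis using g d by (intro main[OF \<psi>, of False]) (simp add: P_def backward)
    next
      assume "\<exists>\<psi>\<in>carrier_mat 1 2. \<psi> * u = 1\<^sub>m 1 \<and> \<psi> * \<gamma> = 0\<^sub>m 1 1"
      then obtain \<psi> where \<psi>: "\<psi> \<in> carrier_mat 1 2" "\<psi> * u = 1\<^sub>m 1" and 0: "\<psi> * \<gamma> = 0\<^sub>m 1 1" by blast
      have "proj 2 u \<psi> * \<gamma> = \<gamma>" unfolding proj_mult[OF u(1) \<psi>(1) g] 0 using u g by (simp add: minus_zero_mat)
      then show ?thesis using g d by (intro main[OF \<psi>, of True]) (simp add: P_def backward)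
    qed
  qed
qed

text \<open>
  An invertible arrow transports the line to the next space and the projection back.  Here \<open>h\<close> is the
  map from the space at \<open>VC m\<close> to that at \<open>VC (m + 1)\<close>: the arrow itself or its inverse.
\<close>

lemma adapted_step:
  fixes N :: "(dvertex, darrow, 'k::field) quiver_rep"
  assumes r: "is_rep Q N" and m: "m \<in> {1..l - 3}"
    and d: "vdim N (VC m) = 2" "vdim N (VC (m + 1)) = 2"
    and full: "has_rank (vmap N (Gamma m)) 2"
    and IH: "\<And>u. u \<in> carrier_mat 2 1 \<Longrightarrow> u \<noteq> 0\<^sub>m 2 1 \<Longrightarrow> adapted N (m + 1) u"
    and u: "u \<in> carrier_mat 2 1" "u \<noteq> 0\<^sub>m 2 1"
  shows "adapted N m u"
proof -
  define \<gamma> where "\<gamma> = vmap N (Gamma m)"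
  have g: "\<gamma> \<in> carrier_mat 2 2"
    using is_repD[OF r Gamma_arc[OF m]] d by (cases rule: Gamma_cases[OF m]) (auto simp: \<gamma>_def)
  obtain \<gamma>' where g': "\<gamma>' \<in> carrier_mat 2 2" "\<gamma> * \<gamma>' = 1\<^sub>m 2" "\<gamma>' * \<gamma> = 1\<^sub>m 2"
    using square_full_rank_inverse[OF g] full by (auto simp: \<gamma>_def)
  have main: "adapted N m u" if h: "h \<in> carrier_mat 2 2" "h' \<in> carrier_mat 2 2" "h' * h = 1\<^sub>m 2"
    and comm: "\<And>\<psi>. \<psi> \<in> carrier_mat 1 2 \<Longrightarrow> if tail Q (Gamma m) = VC m
        then proj 2 (h * u) \<psi> * \<gamma> = \<gamma> * proj 2 u (\<psi> * h) else proj 2 u (\<psi> * h) * \<gamma> = \<gamma> * proj 2 (h * u) \<psi>"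
    for h h'
  proof -
    have hu: "h * u \<in> carrier_mat 2 1" using h u by simp
    have "h' * (h * u) = u" using left_inverse_cancel[OF h(3), of u] h u by simp
    then have "h * u \<noteq> 0\<^sub>m 2 1" using u h by auto
    from IH[OF hu this] obtain \<psi> P where \<psi>: "\<psi> \<in> carrier_mat 1 2" "\<psi> * (h * u) = 1\<^sub>m 1"
      and Pm: "P (VC (m + 1)) = proj 2 (h * u) \<psi>"
      and P: "\<And>k. k \<in> {m + 1..l - 2} \<Longrightarrow> P (VC k) \<in> carrier_mat (vdim N (VC k)) (vdim N (VC k))"
        "\<And>k. k \<in> {m + 1..l - 2} \<Longrightarrow> P (VC k) * P (VC k) = P (VC k)"
      and PG: "\<And>k. k \<in> {m + 1..l - 3} \<Longrightarrow> P (head Q (Gamma k)) * vmap N (Gamma k) = vmap N (Gamma k) * P (tail Q (Gamma k))"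
      unfolding adapted_def by blast
    have \<psi>h: "\<psi> * h \<in> carrier_mat 1 2" "\<psi> * h * u = 1\<^sub>m 1" using \<psi> h u by (auto simp: mat_assoc)
    define P' where "P' = P(VC m := proj 2 u (\<psi> * h))"
    show ?thesis unfolding adapted_def
    proof (intro exI conjI ballI)
      show "P' (VC m) = proj 2 u (\<psi> * h)" by (simp add: P'_def)
      fix k
      {
        assume k: "k \<in> {m..l - 2}"
        show "P' (VC k) \<in> carrier_mat (vdim N (VC k)) (vdim N (VC k))"
          using P(1)[of k] k proj_carrier[OF u(1) \<psi>h(1)] d by (auto simp: P'_def)
        show "P' (VC k) * P' (VC k) = P' (VC k)"
          using P(2)[of k] k proj_idem[OF u(1) \<psi>h] by (auto simp: P'_def)
      }
      assume k: "k \<in> {m..l - 3}"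
      then have k': "k \<in> {1..l - 3}" using m by auto
      show "P' (head Q (Gamma k)) * vmap N (Gamma k) = vmap N (Gamma k) * P' (tail Q (Gamma k))"
      proof (cases "k = m")
        case True
        then show ?thesis using comm[OF \<psi>(1)] Pm
          by (cases rule: Gamma_cases[OF k']) (auto simp: P'_def \<gamma>_def)
      next
        case False
        then have "head Q (Gamma k) \<noteq> VC m" "tail Q (Gamma k) \<noteq> VC m"
          using k by (cases rule: Gamma_cases[OF k'], auto)+
        then show ?thesis using PG[of k] k False by (auto simp: P'_def)
      qed
    qed (use \<psi>h in auto)
  qed
  from m show ?thesis
  proof (cases rule: Gamma_cases)
    case forward
    show ?thesis
    proof (rule main[OF g g'(1,3)])
      fix \<psi> :: "'k mat" assume \<psi>: "\<psi> \<in> carrier_mat 1 2"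
      have c: "\<gamma> * u \<in> carrier_mat 2 1" "\<psi> * \<gamma> \<in> carrier_mat 1 2" using \<psi> g u by auto
      show "if tail Q (Gamma m) = VC m
        then proj 2 (\<gamma> * u) \<psi> * \<gamma> = \<gamma> * proj 2 u (\<psi> * \<gamma>) else proj 2 u (\<psi> * \<gamma>) * \<gamma> = \<gamma> * proj 2 (\<gamma> * u) \<psi>"
        using forward by (simp add: proj_mult[OF c(1) \<psi> g] mult_proj[OF u(1) c(2) g])
    qed
  next
    case backward
    show ?thesis
    proof (rule main[OF g'(1) g g'(2)])
      fix \<psi> :: "'k mat" assume \<psi>: "\<psi> \<in> carrier_mat 1 2"
      have c: "\<gamma>' * u \<in> carrier_mat 2 1" "\<psi> * \<gamma>' \<in> carrier_mat 1 2" using \<psi> g' u by auto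
      have "\<psi> * \<gamma>' * \<gamma> = \<psi>" using \<psi> g g' by (simp add: mat_assoc)
      moreover have "\<gamma> * (\<gamma>' * u) = u" using left_inverse_cancel[OF g'(2), of u] g g'(1) u by simp
      ultimately show "if tail Q (Gamma m) = VC m
        then proj 2 (\<gamma>' * u) \<psi> * \<gamma> = \<gamma> * proj 2 u (\<psi> * \<gamma>') else proj 2 u (\<psi> * \<gamma>') * \<gamma> = \<gamma> * proj 2 (\<gamma>' * u) \<psi>"
        using backward by (simp add: proj_mult[OF u(1) c(2) g] mult_proj[OF c(1) \<psi> g])
    qed
  qed
qed

text \<open>
  Suppose the arrow has rank 1, with factorisation \<open>B C\<close>.  If it points away from \<open>VC 1\<close>, take the
  projection along its image on the far side and zero on the near side; otherwise take the projection
  along its kernel on the far side and the identity on the near side (\<open>X\<close> is the value at \<open>VC m\<close>).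
  Both are nontrivial idempotent endomorphisms.
\<close>

lemma adapted_full_rank:
  fixes N :: "(dvertex, darrow, 'k::field) quiver_rep"
  assumes ind: "indecomposable Q N" and m: "m \<in> {1..l - 3}"
    and d: "vdim N (VC m) = 2" "vdim N (VC (m + 1)) = 2"
    and ad: "\<And>u. u \<in> carrier_mat 2 1 \<Longrightarrow> u \<noteq> 0\<^sub>m 2 1 \<Longrightarrow> adapted N (m + 1) u"
  shows "has_rank (vmap N (Gamma m)) 2"
proof -
  have r: "is_rep Q N" using ind by (simp add: indecomposable_def)
  note e = Gamma_arc[OF m]
  define \<gamma> where "\<gamma> = vmap N (Gamma m)"
  have g: "\<gamma> \<in> carrier_mat 2 2"
    using is_repD[OF r e] d by (cases rule: Gamma_cases[OF m]) (auto simp: \<gamma>_def)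
  have nz: "\<gamma> \<noteq> 0\<^sub>m 2 2"
    using arc_nonzero[OF ind e] d by (cases rule: Gamma_cases[OF m]) (auto simp: \<gamma>_def)
  obtain s where s: "has_rank \<gamma> s" using has_rank_exists[OF g] by blast
  have "s \<noteq> 0" using has_rank_0D[OF _ g] s nz by auto
  moreover have "s \<le> 2" using has_rank_le_dim[OF s g] by simp
  moreover have "s \<noteq> 1"
  proof
    assume "s = 1"
    then obtain B C L R where c: "B \<in> carrier_mat 2 1" "C \<in> carrier_mat 1 2" "L \<in> carrier_mat 1 2" "R \<in> carrier_mat 2 1"
      and fac: "\<gamma> = B * C" "L * B = 1\<^sub>m 1" "C * R = 1\<^sub>m 1"
      using has_rankE[OF s g] by metis
    have vm: "VC m \<in> verts Q" "VC (m + 1) \<in> verts Q" using m by (auto simp: verts)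
    have main: False if u: "u \<in> carrier_mat 2 1" "u \<noteq> 0\<^sub>m 2 1"
      and comm: "\<And>\<psi>. \<psi> \<in> carrier_mat 1 2 \<Longrightarrow> \<psi> * u = 1\<^sub>m 1 \<Longrightarrow> if tail Q (Gamma m) = VC m
        then proj 2 u \<psi> * \<gamma> = \<gamma> * X else X * \<gamma> = \<gamma> * proj 2 u \<psi>"
      and b: "b \<longleftrightarrow> tail Q (Gamma m) \<noteq> VC m" and X: "X = (if b then 1\<^sub>m 2 else 0\<^sub>m 2 2)" for u X b
    proof -
      obtain \<psi> P where \<psi>: "\<psi> \<in> carrier_mat 1 2" "\<psi> * u = 1\<^sub>m 1"
        and Pm: "P (VC (m + 1)) = proj 2 u \<psi>"
        and P: "\<And>k. k \<in> {m + 1..l - 2} \<Longrightarrow> P (VC k) \<in> carrier_mat (vdim N (VC k)) (vdim N (VC k))"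
          "\<And>k. k \<in> {m + 1..l - 2} \<Longrightarrow> P (VC k) * P (VC k) = P (VC k)"
        and PG: "\<And>k. k \<in> {m + 1..l - 3} \<Longrightarrow> P (head Q (Gamma k)) * vmap N (Gamma k) = vmap N (Gamma k) * P (tail Q (Gamma k))"
        using ad[OF u] unfolding adapted_def by blast
      define P' where "P' v = (if v \<in> VC ` {m<..} then P v else if b then 1\<^sub>m (vdim N v) else 0\<^sub>m (vdim N v) (vdim N v))" for v
      have P'm: "P' (VC m) = X" using d X by (auto simp: P'_def)
      have P'm1: "P' (VC (m + 1)) = proj 2 u \<psi>" using Pm by (simp add: P'_def)
      have right: "v \<in> verts Q \<Longrightarrow> v \<in> VC ` {m<..} \<Longrightarrow> \<exists>k\<in>{m + 1..l - 2}. v = VC k" for v by (auto simp: verts)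
      have hom: "rep_hom Q N N P'" unfolding rep_hom_def
      proof (intro conjI ballI)
        show "P' v \<in> carrier_mat (vdim N v) (vdim N v)" if "v \<in> verts Q" for v
          using right[OF that] P(1) by (auto simp: P'_def)
        fix e' assume e': "e' \<in> arcs Q"
        note m' = is_repD[OF r e']
        show "P' (head Q e') * vmap N e' = vmap N e' * P' (tail Q e')"
        proof (cases "e' = Gamma m")
          case True
          then show ?thesis using comm[OF \<psi>] P'm P'm1
            by (cases rule: Gamma_cases[OF m]) (auto simp: \<gamma>_def)
        next
          case False
          have same: "tail Q e' \<in> VC ` {m<..} \<longleftrightarrow> head Q e' \<in> VC ` {m<..}"
            using arc_side_other[OF e e' False] by (simp add: arc_side_def)
          show ?thesis
          proof (cases "tail Q e' \<in> VC ` {m<..}")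
            case True
            then have in2: "D_ends e' \<subseteq> VC ` {m<..}" using same by (simp add: ends[OF e', symmetric])
            then obtain k where k: "e' = Gamma k" "k \<in> {m + 1..l - 3}"
              using e' by (cases e') (auto simp: arcs)
            show ?thesis using PG[OF k(2)] True same by (simp add: P'_def k(1))
          next
            case False
            then show ?thesis using same m' by (simp add: P'_def)
          qed
        qed
      qed
      have "P' v * P' v = P' v" if "v \<in> verts Q" for v
        using right[OF that] P(2) by (auto simp: P'_def)
      from indecomposable_idempotent_trivial[OF ind hom this]
      have triv: "(P' (VC m) = 0\<^sub>m 2 2 \<and> P' (VC (m + 1)) = 0\<^sub>m 2 2) \<or> (P' (VC m) = 1\<^sub>m 2 \<and> P' (VC (m + 1)) = 1\<^sub>m 2)"
        using vm d by metis
      have p0: "proj 2 u \<psi> \<noteq> 0\<^sub>m 2 2"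
      proof
        assume "proj 2 u \<psi> = 0\<^sub>m 2 2"
        then have z: "(1\<^sub>m 2 - u * \<psi>) $$ (i,j) = 0" if "i < 2" "j < 2" for i j
          using that by (simp add: proj_def)
        have "u * \<psi> = 1\<^sub>m 2"
          using u \<psi> z by (intro eq_matI) auto
        then have "(2::nat) \<le> 1" by (rule identity_factor_le[OF u(1) \<psi>(1)])
        then show False by simp
      qed
      have p1: "proj 2 u \<psi> \<noteq> 1\<^sub>m 2"
      proof
        assume "proj 2 u \<psi> = 1\<^sub>m 2"
        then have "u = proj 2 u \<psi> * u" using u by simp
        also have "\<dots> = u - u * (\<psi> * u)" by (rule proj_mult[OF u(1) \<psi>(1) u(1)])
        also have "\<dots> = 0\<^sub>m 2 1" unfolding \<psi>(2) using u by simp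
        finally show False using u by simp
      qed
      show False using triv p0 p1 unfolding P'm1 by blast
    qed
    from m show False
    proof (cases rule: Gamma_cases)
      case forward
      have B: "B \<noteq> 0\<^sub>m 2 1"
      proof
        assume "B = 0\<^sub>m 2 1"
        moreover have "L * 0\<^sub>m 2 1 = 0\<^sub>m 1 1" using c by simp
        ultimately have "(1\<^sub>m 1 :: 'k mat) = 0\<^sub>m 1 1" using fac(2) by metis
        then have "(1::nat) = 0" by (rule one_mat_eq_zero)
        then show False by simp
      qed
      show False
      proof (rule main[OF c(1) B, of "0\<^sub>m 2 2" False])
        fix \<psi> :: "'k mat" assume \<psi>: "\<psi> \<in> carrier_mat 1 2" "\<psi> * B = 1\<^sub>m 1"
        have "\<psi> * \<gamma> = C" unfolding fac(1) using left_inverse_cancel[OF \<psi>(2), of C] \<psi> c by simp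
        then have "proj 2 B \<psi> * \<gamma> = \<gamma> - \<gamma>" unfolding proj_mult[OF c(1) \<psi>(1) g] using fac(1) by simp
        then show "if tail Q (Gamma m) = VC m then proj 2 B \<psi> * \<gamma> = \<gamma> * 0\<^sub>m 2 2 else 0\<^sub>m 2 2 * \<gamma> = \<gamma> * proj 2 B \<psi>"
          using forward g by simp
      qed (use forward in auto)
    next
      case backward
      have "C \<noteq> 0\<^sub>m 1 2"
      proof
        assume "C = 0\<^sub>m 1 2"
        moreover have "0\<^sub>m 1 2 * R = 0\<^sub>m 1 1" using c by simp
        ultimately have "(1\<^sub>m 1 :: 'k mat) = 0\<^sub>m 1 1" using fac(3) by metis
        then have "(1::nat) = 0" by (rule one_mat_eq_zero)
        then show False by simp
      qed
      from row_kernel_vector[OF c(2) this] obtain u where u: "u \<in> carrier_mat 2 1" "u \<noteq> 0\<^sub>m 2 1" "C * u = 0\<^sub>m 1 1" by blast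
      show False
      proof (rule main[OF u(1,2), of "1\<^sub>m 2" True])
        fix \<psi> :: "'k mat" assume \<psi>: "\<psi> \<in> carrier_mat 1 2" "\<psi> * u = 1\<^sub>m 1"
        have "\<gamma> * u = 0\<^sub>m 2 1" unfolding fac(1) using c u by (simp add: mat_assoc)
        then have "\<gamma> * proj 2 u \<psi> = \<gamma>" unfolding mult_proj[OF u(1) \<psi>(1) g] using \<psi> g by (simp add: minus_zero_mat)
        then show "if tail Q (Gamma m) = VC m then proj 2 u \<psi> * \<gamma> = \<gamma> * 1\<^sub>m 2 else 1\<^sub>m 2 * \<gamma> = \<gamma> * proj 2 u \<psi>"
          using backward g by simp
      qed (use backward in auto)
    qed
  qed
  ultimately have "s = 2" by linarith
  then show ?thesis using s by (simp add: \<gamma>_def)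
qed

text \<open>
  Induction from the last two-dimensional space downwards, in which the two preceding lemmas alternate:
  a decomposition for every line at \<open>VC (k + 1)\<close> forces the arrow \<open>Gamma k\<close> to be invertible, and an
  invertible arrow gives decompositions at \<open>VC k\<close>.
\<close>

lemma twin_chain_full_rank:
  fixes N :: "(dvertex, darrow, 'k::field) quiver_rep"
  assumes ind: "indecomposable Q N" and ij: "1 \<le> i" "i < j" "j \<le> l - 2"
    and d: "\<And>v. v \<in> verts Q \<Longrightarrow> vdim N v = twin_root i j v" and m: "1 \<le> m" "m < i"
  shows "has_rank (vmap N (Gamma m)) 2"
proof -
  have r: "is_rep Q N" using ind by (simp add: indecomposable_def)
  have d2: "vdim N (VC k) = 2" if "1 \<le> k" "k \<le> i" for k
    using d[of "VC k"] that ij by (simp add: verts twin_root_simps)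
  have d1: "vdim N (VC (i + 1)) = 1" using d[of "VC (i + 1)"] ij by (simp add: verts twin_root_simps)
  have "\<forall>u. u \<in> carrier_mat 2 1 \<longrightarrow> u \<noteq> 0\<^sub>m 2 1 \<longrightarrow> adapted N k u" if "1 \<le> k" "k \<le> i" for k
    using that(2,1)
  proof (induction k rule: inc_induct)
    case base
    then show ?case using adapted_base[OF r _ _ d1] d2[of i] ij by auto
  next
    case (step k)
    have k: "k \<in> {1..l - 3}" "1 \<le> k" "k < i" using step ij by auto
    have ad: "\<And>u. u \<in> carrier_mat 2 1 \<Longrightarrow> u \<noteq> 0\<^sub>m 2 1 \<Longrightarrow> adapted N (k + 1) u" using step by simp
    have dk: "vdim N (VC k) = 2" "vdim N (VC (k + 1)) = 2" using k d2 by auto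
    show ?case using adapted_step[OF r k(1) dk adapted_full_rank[OF ind k(1) dk ad] ad] by blast
  qed
  from this[of "m + 1"] show ?thesis using m ij d2
    by (intro adapted_full_rank[OF ind]) auto
qed

text \<open>
  A nonzero arrow has the largest possible rank as soon as one of its ends has dimension at most 1.
  Arrows with larger dimensions at both ends occur only for twin roots.
\<close>

theorem root_rep_arc_rank:
  fixes N :: "(dvertex, darrow, 'k::field) quiver_rep"
  assumes root: "d \<in> pos_roots Q" and ind: "indecomposable Q N" and d: "dim_vector Q N = d" and e: "e \<in> arcs Q"
  shows "has_rank (vmap N e) (min (d (tail Q e)) (d (head Q e)))"
proof -
  have r: "is_rep Q N" using ind by (simp add: indecomposable_def)
  have dv: "vdim N v = d v" if "v \<in> verts Q" for v using d that by (auto simp: dim_vector_def)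
  let ?t = "tail Q e" and ?h = "head Q e"
  have dt: "vdim N ?t = d ?t" "vdim N ?h = d ?h" using dv tail_in_verts[OF e] head_in_verts[OF e] by auto
  have c: "vmap N e \<in> carrier_mat (d ?h) (d ?t)" using is_repD[OF r e] dt by simp
  obtain s where s: "has_rank (vmap N e) s" using has_rank_exists[OF c] by blast
  have le: "s \<le> min (d ?t) (d ?h)" using has_rank_le_dim[OF s c] by simp
  have pos: "s \<ge> 1" if "min (d ?t) (d ?h) \<ge> 1"
  proof (rule ccontr)
    assume "\<not> s \<ge> 1"
    then have "s = 0" by simp
    then have "vmap N e = 0\<^sub>m (d ?h) (d ?t)" using has_rank_0D[OF _ c] s by simp
    then show False using arc_nonzero[OF ind e] that dt by simp
  qed
  show ?thesis
  proof (cases "min (d ?t) (d ?h) \<le> 1")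
    case True
    then have "s = min (d ?t) (d ?h)" using le pos by linarith
    then show ?thesis using s by simp
  next
    case False
    then have "\<not> (\<forall>v. d v \<le> 1)" by (auto simp: not_le)
    then have "d \<in> twin_roots l" using root_cases[OF root] by blast
    then obtain i j where ij: "1 \<le> i" "i < j" "j \<le> l - 2" and tw: "d = twin_root i j" by (auto simp: twin_roots_def)
    have big: "d v \<ge> 2" if "v \<in> D_ends e" for v using False that by (auto simp: ends[OF e, symmetric])
    have big': "\<exists>k. v = VC k \<and> k \<le> i" if "v \<in> D_ends e" for v
      using big[OF that] ij by (cases v) (auto simp: tw twin_root_simps split: if_splits)
    obtain m where m: "e = Gamma m" using big'[of VA] big'[of VB] by (cases e) auto
    have m': "1 \<le> m" "m < i" using e big'[of "VC (m + 1)"] by (auto simp: m arcs)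
    have "has_rank (vmap N e) 2"
      unfolding m using dv by (intro twin_chain_full_rank[OF ind ij _ m']) (simp add: tw)
    moreover have "d v \<le> 2" for v by (cases v) (simp_all add: tw twin_root_simps)
    then have "min (d ?t) (d ?h) = 2" using False by (metis antisym min_le_iff_disj not_less_eq_eq One_nat_def numeral_2_eq_2)
    ultimately show ?thesis by simp
  qed
qed

end

section \<open>Tensor powers of representations of type D\<close>

lemma (in wf_digraph) rep_iso_vdim:
  fixes M N :: "('a, 'b, 'k::field) quiver_rep"
  assumes "rep_iso G M N" "v \<in> verts G"
  shows "vdim M v = vdim N v"
proof -
  obtain P P' where P: "rep_hom G M N P" "rep_hom G N M P'"
    and 1: "P' v * P v = 1\<^sub>m (vdim M v)" "P v * P' v = 1\<^sub>m (vdim N v)"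
    using assms unfolding rep_iso_def by blast
  note c = rep_homD(1)[OF P(1) assms(2)] rep_homD(1)[OF P(2) assms(2)]
  show ?thesis using identity_factor_le[OF c(2,1) 1(1)] identity_factor_le[OF c(1,2) 1(2)] by simp
qed

lemma (in wf_digraph) rep_iso_has_rank:
  fixes M N :: "('a, 'b, 'k::field) quiver_rep"
  assumes r: "is_rep G M" "is_rep G N" and iso: "rep_iso G M N" and e: "e \<in> arcs G" and s: "has_rank (vmap N e) s"
  shows "has_rank (vmap M e) s"
proof -
  obtain P P' where P: "rep_hom G M N P" "rep_hom G N M P'"
    and 1: "\<And>v. v \<in> verts G \<Longrightarrow> P' v * P v = 1\<^sub>m (vdim M v)" "\<And>v. v \<in> verts G \<Longrightarrow> P v * P' v = 1\<^sub>m (vdim N v)"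
    using iso unfolding rep_iso_def by blast
  note h = head_in_verts[OF e] and t = tail_in_verts[OF e]
  note c = rep_homD(1)[OF P(1)] rep_homD(1)[OF P(2)]
  note m = is_repD[OF r(1) e] is_repD[OF r(2) e]
  have "P' (head G e) * vmap N e * P (tail G e) = P' (head G e) * (P (head G e) * vmap M e)"
    unfolding rep_homD(2)[OF P(1) e] using c(1)[OF t] c(2)[OF h] m by (simp add: mat_assoc)
  also have "\<dots> = vmap M e"
    using left_inverse_cancel[OF 1(1)[OF h], of "vmap M e"] c(1)[OF h] c(2)[OF h] m by simp
  finally have eq: "P' (head G e) * vmap N e * P (tail G e) = vmap M e" .
  show ?thesis
    using has_rank_transform[OF s m(2) c(2)[OF h] c(1)[OF h] 1(2)[OF h] c(1)[OF t] c(2)[OF t] 1(2)[OF t]]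
    unfolding eq .
qed

context type_D
begin

text \<open>
  The enumeration chosen by \<open>direct_sum_over\<close>.
\<close>

definition root_list :: "(dvertex \<Rightarrow> nat) list" where
  "root_list = (SOME ds. distinct ds \<and> set ds = pos_roots Q)"

lemma root_list: "distinct root_list" "set root_list = pos_roots Q"
proof -
  have "\<exists>ds. distinct ds \<and> set ds = pos_roots Q" using finite_distinct_list[OF finite_pos_roots] by blast
  then have "distinct root_list \<and> set root_list = pos_roots Q" unfolding root_list_def by (rule someI_ex)
  then show "distinct root_list" "set root_list = pos_roots Q" by auto
qed

definition summands :: "((dvertex \<Rightarrow> nat) \<Rightarrow> (dvertex, darrow, 'k::field) quiver_rep) \<Rightarrow> ((dvertex \<Rightarrow> nat) \<Rightarrow> nat)
    \<Rightarrow> (dvertex, darrow, 'k) quiver_rep list" where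
  "summands R a = concat (map (\<lambda>d. replicate (a d) (R d)) root_list)"

lemma direct_sum_summands:
  "direct_sum_over (pos_roots Q) (\<lambda>d. multiple (a d) (R d)) = direct_sum (summands R a)"
proof -
  have "direct_sum_over (pos_roots Q) (\<lambda>d. multiple (a d) (R d)) = direct_sum (map direct_sum (map (\<lambda>d. replicate (a d) (R d)) root_list))"
    by (simp add: direct_sum_over_def root_list_def multiple_def comp_def)
  then show ?thesis unfolding direct_sum_concat summands_def .
qed

lemma set_summands: "set (summands R a) \<subseteq> R ` pos_roots Q"
  unfolding summands_def using root_list(2) by auto

lemma sum_list_summands: "(\<Sum>N\<leftarrow>summands R a. f N) = (\<Sum>d\<in>pos_roots Q. a d * f (R d))" for f :: "_ \<Rightarrow> nat"
proof -
  have "(\<Sum>N\<leftarrow>concat (map (\<lambda>d. replicate (a d) (R d)) ds). f N) = (\<Sum>d\<leftarrow>ds. a d * f (R d))" for ds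
    by (induction ds) (auto simp: sum_list_replicate)
  then show ?thesis unfolding summands_def
    by (simp add: sum_list_distinct_conv_sum_set[OF root_list(1)] root_list(2))
qed

lemma length_summands: "length (summands R a) = (\<Sum>d\<in>pos_roots Q. a d)"
  using sum_list_summands[of "\<lambda>_. 1" R a] by (simp add: sum_list_triv)

context
  fixes R :: "(dvertex \<Rightarrow> nat) \<Rightarrow> (dvertex, darrow, 'k::field) quiver_rep"
  assumes R: "\<And>d. d \<in> pos_roots Q \<Longrightarrow> indecomposable Q (R d) \<and> dim_vector Q (R d) = d"
begin

lemma summands_indecomposable: "N \<in> set (summands R a) \<Longrightarrow> indecomposable Q N"
  using set_summands[of R a] R by blast

lemma is_rep_summands: "is_rep Q (direct_sum (summands R a))"
  by (rule is_rep_direct_sum) (use summands_indecomposable in \<open>auto simp: indecomposable_def\<close>)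

lemma decomposition_vdim:
  assumes iso: "rep_iso Q X (direct_sum (summands R a))" and v: "v \<in> verts Q"
  shows "vdim X v = (\<Sum>d\<in>pos_roots Q. a d * d v)"
proof -
  have "vdim X v = (\<Sum>N\<leftarrow>summands R a. vdim N v)"
    using rep_iso_vdim[OF iso v] by (simp add: direct_sum_def)
  also have "\<dots> = (\<Sum>d\<in>pos_roots Q. a d * vdim (R d) v)" by (rule sum_list_summands)
  also have "\<dots> = (\<Sum>d\<in>pos_roots Q. a d * d v)"
  proof (rule sum.cong)
    fix d assume "d \<in> pos_roots Q"
    then have "dim_vector Q (R d) v = d v" using R by simp
    then show "a d * vdim (R d) v = a d * d v" using v by (simp add: dim_vector_def)
  qed simp
  finally show ?thesis .
qed

lemma decomposition_rank:
  assumes rX: "is_rep Q X" and iso: "rep_iso Q X (direct_sum (summands R a))" and e: "e \<in> arcs Q"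
  shows "has_rank (vmap X e) (\<Sum>d\<in>pos_roots Q. a d * min (d (tail Q e)) (d (head Q e)))"
proof -
  have "has_rank (vmap (direct_sum (summands R a)) e) (\<Sum>N\<leftarrow>summands R a. mrank (vmap N e))"
    unfolding direct_sum_def by (simp add: has_rank_diag_block_mat has_rank_mrank)
  also have "(\<Sum>N\<leftarrow>summands R a. mrank (vmap N e)) = (\<Sum>d\<in>pos_roots Q. a d * mrank (vmap (R d) e))"
    by (rule sum_list_summands)
  also have "\<dots> = (\<Sum>d\<in>pos_roots Q. a d * min (d (tail Q e)) (d (head Q e)))"
  proof (rule sum.cong)
    fix d assume d: "d \<in> pos_roots Q"
    have "has_rank (vmap (R d) e) (min (d (tail Q e)) (d (head Q e)))"
      using root_rep_arc_rank[OF d _ _ e] R[OF d] by blast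
    then have "mrank (vmap (R d) e) = min (d (tail Q e)) (d (head Q e))"
      using has_rank_unique has_rank_mrank by blast
    then show "a d * mrank (vmap (R d) e) = a d * min (d (tail Q e)) (d (head Q e))" by simp
  qed simp
  finally show ?thesis using rep_iso_has_rank[OF rX is_rep_summands iso e] by blast
qed

end

text \<open>
  Roots that are not above the arrow root have a zero entry at one of its ends, hence minimum 0.
\<close>

lemma arc_root_sum:
  assumes e: "e \<in> arcs Q"
  shows "(\<Sum>d'\<in>{d' \<in> pos_roots Q. d' \<ge> arc_root e}. int (dv_min Q (dv_mult d' (arc_root e))) * int (a d')) =
    int (\<Sum>d'\<in>pos_roots Q. a d' * min (d' (tail Q e)) (d' (head Q e)))"
proof -
  have "(\<Sum>d'\<in>{d' \<in> pos_roots Q. d' \<ge> arc_root e}. int (dv_min Q (dv_mult d' (arc_root e))) * int (a d')) =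
    (\<Sum>d'\<in>pos_roots Q. int (a d' * min (d' (tail Q e)) (d' (head Q e))))"
  proof (rule sum.mono_neutral_cong_left)
    show "\<forall>d'\<in>pos_roots Q - {d' \<in> pos_roots Q. d' \<ge> arc_root e}. int (a d' * min (d' (tail Q e)) (d' (head Q e))) = 0"
      using not_ge_arc_root[OF e] by auto
    show "int (dv_min Q (dv_mult d' (arc_root e))) * int (a d') = int (a d' * min (d' (tail Q e)) (d' (head Q e)))"
      if "d' \<in> {d' \<in> pos_roots Q. d' \<ge> arc_root e}" for d'
      using dv_min_arc_root[OF e, of d'] that by simp
  qed (use finite_pos_roots in auto)
  then show ?thesis by simp
qed

end

theorem theorem5p12:
  fixes l n :: nat
    and Q :: "(dvertex, darrow) pre_digraph"
    and M :: "(dvertex, darrow, 'k::alg_closed_field) quiver_rep"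
    and R :: "(dvertex \<Rightarrow> nat) \<Rightarrow> (dvertex, darrow, 'k) quiver_rep"
    and a an :: "(dvertex \<Rightarrow> nat) \<Rightarrow> nat"
  assumes "l \<ge> 4"
    and "dynkin_D l Q"
    and "n \<ge> 1"
    and "is_rep Q M"
    and "\<And>d. d \<in> pos_roots Q \<Longrightarrow> indecomposable Q (R d) \<and> dim_vector Q (R d) = d"
    and "rep_iso Q M (direct_sum_over (pos_roots Q) (\<lambda>d. multiple (a d) (R d)))"
    and "rep_iso Q (tensor_power M n) (direct_sum_over (pos_roots Q) (\<lambda>d. multiple (an d) (R d)))"
  shows "int (num_summands_power Q M n) =
      (\<Sum>i\<in>verts Q. int (vdim M i) ^ n)
    - (\<Sum>d\<in>{d \<in> pos_roots Q. dv_length Q d = 2}.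
         (\<Sum>d'\<in>{d' \<in> pos_roots Q. d' \<ge> d}. int (dv_min Q (dv_mult d' d)) * int (a d')) ^ n)
    - (\<Sum>d\<in>twin_roots l. int (an d))"
proof -
  interpret type_D l Q by unfold_locales (fact assms)+
  let ?I = "pos_roots Q"
  let ?\<mu> = "\<lambda>d e. min (d (tail Q e)) (d (head Q e))"
  let ?T = "tensor_power M n"
  note R = assms(5)
  have isoM: "rep_iso Q M (direct_sum (summands R a))" and isoT: "rep_iso Q ?T (direct_sum (summands R an))"
    using assms(6,7) by (simp_all add: direct_sum_summands)
  have rT: "is_rep Q ?T" by (rule is_rep_tensor_power) fact
  have b: "num_summands_power Q M n = (\<Sum>d\<in>?I. an d)"
    unfolding num_summands_power_def length_summands[symmetric, of _ R]
    by (rule num_indec_summands_eq[OF rT summands_indecomposable[OF R] isoT])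
  have dims: "vdim M v ^ n = (\<Sum>d\<in>?I. an d * d v)" if "v \<in> verts Q" for v
    using decomposition_vdim[OF R isoT that] by (simp add: tensor_power_vdim)
  have ranks: "(\<Sum>d\<in>?I. a d * ?\<mu> d e) ^ n = (\<Sum>d\<in>?I. an d * ?\<mu> d e)" if e: "e \<in> arcs Q" for e
    by (rule has_rank_unique[OF has_rank_tensor_power[OF decomposition_rank[OF R assms(4) isoM e]]
          decomposition_rank[OF R rT isoT e]])
  have "int (an d) = (\<Sum>v\<in>verts Q. int (an d * d v)) - (\<Sum>e\<in>arcs Q. int (an d * ?\<mu> d e))
      - (if d \<in> twin_roots l then int (an d) else 0)" if d: "d \<in> ?I" for d
  proof -
    have "(\<Sum>v\<in>verts Q. int (an d * d v)) - (\<Sum>e\<in>arcs Q. int (an d * ?\<mu> d e)) =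
        int (an d) * ((\<Sum>v\<in>verts Q. int (d v)) - (\<Sum>e\<in>arcs Q. int (?\<mu> d e)))"
      by (simp only: of_nat_mult sum_distrib_left right_diff_distrib)
    then show ?thesis unfolding root_defect[OF d] by (simp add: distrib_left)
  qed
  then have "int (\<Sum>d\<in>?I. an d) = (\<Sum>d\<in>?I. (\<Sum>v\<in>verts Q. int (an d * d v)) - (\<Sum>e\<in>arcs Q. int (an d * ?\<mu> d e))
      - (if d \<in> twin_roots l then int (an d) else 0))"
    unfolding of_nat_sum by (rule sum.cong[OF refl])
  also have "\<dots> = (\<Sum>v\<in>verts Q. int (\<Sum>d\<in>?I. an d * d v)) - (\<Sum>e\<in>arcs Q. int (\<Sum>d\<in>?I. an d * ?\<mu> d e))
      - (\<Sum>d\<in>twin_roots l. int (an d))"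
  proof -
    have "(\<Sum>d\<in>?I. if d \<in> twin_roots l then int (an d) else 0) = (\<Sum>d\<in>twin_roots l. int (an d))"
      using twin_roots_subset finite_pos_roots by (simp add: sum.If_cases Int_absorb1)
    then show ?thesis
      by (simp only: sum_subtractf of_nat_sum sum.swap[of _ _ ?I])
  qed
  also have "(\<Sum>v\<in>verts Q. int (\<Sum>d\<in>?I. an d * d v)) = (\<Sum>v\<in>verts Q. int (vdim M v) ^ n)"
    by (rule sum.cong) (simp_all add: dims[symmetric])
  also have "(\<Sum>e\<in>arcs Q. int (\<Sum>d\<in>?I. an d * ?\<mu> d e)) =
      (\<Sum>d\<in>{d \<in> pos_roots Q. dv_length Q d = 2}.
         (\<Sum>d'\<in>{d' \<in> pos_roots Q. d' \<ge> d}. int (dv_min Q (dv_mult d' d)) * int (a d')) ^ n)"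
    unfolding roots_of_length_2 sum.reindex[OF arc_root_inj]
    by (rule sum.cong) (simp_all add: arc_root_sum ranks[symmetric] del: of_nat_sum)
  finally show ?thesis unfolding b .
qed

end
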